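(* Let $E$ and $F$ be Banach spaces and $n=cd(E,F)<cd(E)$. If $\mathcal K(E)$ is an $M$-ideal in $\mathcal L(E)$ and $F$ has property $(M)$, then $\mathcal P_w(^nE,F)$ is an $M$-ideal in $\mathcal P(^nE,F)$.
   Context: $\mathcal K(E)$ and $\mathcal L(E)$ are the spaces of compact and bounded linear operators on $E$. $\mathcal P(^nE,F)$ is the Banach space of continuous $n$-homogeneous polynomials $P:E\to F$ with norm $\|P\|=\sup_{\|x\|\le1}\|P(x)\|$. $\mathcal P_w(^nE,F)$ is the subspace of polynomials that are weakly continuous on bounded sets: $\|P(x_\alpha)-P(x)\|\to0$ for every bounded net $(x_\alpha)$ converging weakly to $x\in E$. The critical degree $cd(E,F)$ is the smallest $k\ge1$ such that $\mathcal P_w(^kE,F)\ne\mathcal P(^kE,F)$ (the hypothesis $n=cd(E,F)$ includes that it exists); $cd(E)=cd(E,\mathbb K)$, with $cd(E)=\infty$ if no such $k$ exists. A closed subspace $J$ of a Banach space $X$ is an $M$-ideal if there is a linear projection $\pi$ on $X^*$ with kernel $J^\perp$ such that $\|x^*\|=\|\pi(x^* )\|+\|x^*-\pi(x^* )\|$ for all $x^*\in X^*$. A Banach space $X$ has property $(M)$ if for all $x,\tilde x\in X$ with $\|x\|\le\|\tilde x\|$ and every bounded weakly null net $(x_\alpha)_\alpha$ in $X$, $\limsup_\alpha\|x+x_\alpha\|\le\limsup_\alpha\|\tilde x+x_\alpha\|$. *)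

theory Defs
  imports "HOL-Analysis.Analysis" "HOL-Library.Function_Algebras" "HOL-Library.Extended_Nat"
begin

section \<open>The scalar field and Banach spaces over it\<close>

text \<open>The field is \<open>\<real>\<close> or \<open>\<complex>\<close>, up to isometric isomorphism.\<close>

class real_or_complex = real_normed_field +
  assumes real_or_complex:
    "(\<forall>z. \<exists>a. z = a *\<^sub>R 1) \<or>
     (\<exists>i. i * i = - 1 \<and> (\<forall>z. \<exists>a b. z = a *\<^sub>R 1 + b *\<^sub>R i) \<and>
       (\<forall>a b. norm (a *\<^sub>R 1 + b *\<^sub>R i) = sqrt (a\<^sup>2 + b\<^sup>2)))"

instance real :: real_or_complex
  by standard auto

instance complex :: real_or_complex
proof
  have "z = Re z *\<^sub>R 1 + Im z *\<^sub>R \<i>" for z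
    by (simp add: complex_eq_iff)
  moreover have "\<i> * \<i> = - 1"
    by simp
  moreover have "norm (a *\<^sub>R 1 + b *\<^sub>R \<i>) = sqrt (a\<^sup>2 + b\<^sup>2)" for a b
    by (simp add: cmod_def)
  ultimately show "(\<forall>z::complex. \<exists>a. z = a *\<^sub>R 1) \<or>
     (\<exists>i::complex. i * i = - 1 \<and> (\<forall>z. \<exists>a b. z = a *\<^sub>R 1 + b *\<^sub>R i) \<and>
       (\<forall>a b. norm (a *\<^sub>R 1 + b *\<^sub>R i) = sqrt (a\<^sup>2 + b\<^sup>2)))"
    by (intro disjI2 exI[of _ \<i>] conjI allI) blast+
qed

text \<open>The library's class \<open>banach\<close> only provides real scalars; the locale adds a compatible
  action of the field.\<close>

locale banach_over = vector_space scale
  for scale :: "'k::real_or_complex \<Rightarrow> 'a::banach \<Rightarrow> 'a" +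
  assumes scale_of_real: "scale (of_real r) x = r *\<^sub>R x"
    and norm_scale: "norm (scale c x) = norm c * norm x"

lemma banach_over_scaleR: "banach_over ((*\<^sub>R) :: real \<Rightarrow> 'a::banach \<Rightarrow> 'a)"
  by unfold_locales (auto simp: algebra_simps)

lemma banach_over_complex: "banach_over ((*) :: complex \<Rightarrow> complex \<Rightarrow> complex)"
  by unfold_locales (auto simp: algebra_simps norm_mult scaleR_conv_of_real)


section \<open>Dual spaces and M-ideals\<close>

text \<open>A normed space over the field \<open>'k\<close> is given by a carrier \<open>X\<close>, a scalar multiplication
  \<open>s\<close> and a norm \<open>N\<close>.  A functional on \<open>X\<close> is represented by a function that vanishes off \<open>X\<close>, so that
  equality of functionals is equality of functions.\<close>

definition fun_scale :: "('k \<Rightarrow> 'b \<Rightarrow> 'b) \<Rightarrow> 'k \<Rightarrow> ('a \<Rightarrow> 'b) \<Rightarrow> 'a \<Rightarrow> 'b" where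
  "fun_scale s c f = (\<lambda>x. s c (f x))"

definition dual_space ::
    "('k::real_or_complex \<Rightarrow> 'v::ab_group_add \<Rightarrow> 'v) \<Rightarrow> 'v set \<Rightarrow> ('v \<Rightarrow> real) \<Rightarrow> ('v \<Rightarrow> 'k) set" where
  "dual_space s X N = {\<phi>.
     (\<forall>x\<in>X. \<forall>y\<in>X. \<phi> (x + y) = \<phi> x + \<phi> y) \<and>
     (\<forall>c. \<forall>x\<in>X. \<phi> (s c x) = c * \<phi> x) \<and>
     (\<exists>C. \<forall>x\<in>X. norm (\<phi> x) \<le> C * N x) \<and>
     (\<forall>x. x \<notin> X \<longrightarrow> \<phi> x = 0)}"

definition dual_norm :: "'v set \<Rightarrow> ('v \<Rightarrow> real) \<Rightarrow> ('v \<Rightarrow> 'k::real_or_complex) \<Rightarrow> real" where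
  "dual_norm X N \<phi> = (SUP x\<in>{x\<in>X. N x \<le> 1}. norm (\<phi> x))"

definition annihilator ::
    "('k::real_or_complex \<Rightarrow> 'v::ab_group_add \<Rightarrow> 'v) \<Rightarrow> 'v set \<Rightarrow> ('v \<Rightarrow> real) \<Rightarrow> 'v set \<Rightarrow> ('v \<Rightarrow> 'k) set" where
  "annihilator s X N J = {\<phi> \<in> dual_space s X N. \<forall>x\<in>J. \<phi> x = 0}"

definition closed_subspace_of ::
    "('k::real_or_complex \<Rightarrow> 'v::ab_group_add \<Rightarrow> 'v) \<Rightarrow> 'v set \<Rightarrow> ('v \<Rightarrow> real) \<Rightarrow> 'v set \<Rightarrow> bool" where
  "closed_subspace_of s X N J \<longleftrightarrow>
     J \<subseteq> X \<and> module.subspace s J \<and>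
     (\<forall>x\<in>X. (\<forall>e>0. \<exists>y\<in>J. N (x - y) < e) \<longrightarrow> x \<in> J)"

definition M_ideal ::
    "('k::real_or_complex \<Rightarrow> 'v::ab_group_add \<Rightarrow> 'v) \<Rightarrow> 'v set \<Rightarrow> ('v \<Rightarrow> real) \<Rightarrow> 'v set \<Rightarrow> bool" where
  "M_ideal s X N J \<longleftrightarrow> closed_subspace_of s X N J \<and>
     (\<exists>\<pi>. (\<forall>\<phi>\<in>dual_space s X N. \<pi> \<phi> \<in> dual_space s X N) \<and>
          (\<forall>\<phi>\<in>dual_space s X N. \<forall>\<psi>\<in>dual_space s X N. \<pi> (\<phi> + \<psi>) = \<pi> \<phi> + \<pi> \<psi>) \<and>
          (\<forall>c. \<forall>\<phi>\<in>dual_space s X N. \<pi> (fun_scale (*) c \<phi>) = fun_scale (*) c (\<pi> \<phi>)) \<and>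
          (\<forall>\<phi>\<in>dual_space s X N. \<pi> (\<pi> \<phi>) = \<pi> \<phi>) \<and>
          {\<phi>\<in>dual_space s X N. \<pi> \<phi> = 0} = annihilator s X N J \<and>
          (\<forall>\<phi>\<in>dual_space s X N.
             dual_norm X N \<phi> = dual_norm X N (\<pi> \<phi>) + dual_norm X N (\<phi> - \<pi> \<phi>)))"


section \<open>Bounded and compact operators\<close>

text \<open>These operators are normed by the library's \<open>onorm\<close>.\<close>

definition bounded_operators ::
    "('k::real_or_complex \<Rightarrow> 'a::real_normed_vector \<Rightarrow> 'a) \<Rightarrow> ('a \<Rightarrow> 'a) set" where
  "bounded_operators s = {T. Vector_Spaces.linear s s T \<and> bounded_linear T}"

definition compact_operators ::
    "('k::real_or_complex \<Rightarrow> 'a::real_normed_vector \<Rightarrow> 'a) \<Rightarrow> ('a \<Rightarrow> 'a) set" where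
  "compact_operators s = {T \<in> bounded_operators s. compact (closure (T ` cball 0 1))}"


section \<open>Weak convergence and property (M)\<close>

text \<open>Filters play the role of nets: a net in a space induces the filter of the sets that contain
  one of its tails, every proper filter arises in this way, and boundedness (of a tail), weak
  limits and upper limits depend only on the induced filter.\<close>

definition weakly_converges ::
    "('k::real_or_complex \<Rightarrow> 'a::real_normed_vector \<Rightarrow> 'a) \<Rightarrow> 'a filter \<Rightarrow> 'a \<Rightarrow> bool" where
  "weakly_converges s G x \<longleftrightarrow> (\<forall>\<phi>\<in>dual_space s UNIV norm. (\<phi> \<longlongrightarrow> \<phi> x) G)"

definition property_M :: "('k::real_or_complex \<Rightarrow> 'a::real_normed_vector \<Rightarrow> 'a) \<Rightarrow> bool" where
  "property_M s \<longleftrightarrow>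
     (\<forall>x x'. norm x \<le> norm x' \<longrightarrow>
       (\<forall>G. Bfun (\<lambda>y. y) G \<and> weakly_converges s G 0 \<longrightarrow>
         Limsup G (\<lambda>y. ereal (norm (x + y))) \<le> Limsup G (\<lambda>y. ereal (norm (x' + y)))))"


section \<open>Homogeneous polynomials and the critical degree\<close>

text \<open>An \<open>n\<close>-tuple is represented by a sequence of which only the entries below \<open>n\<close> matter.\<close>

definition multilinear ::
    "('k::real_or_complex \<Rightarrow> 'a::real_normed_vector \<Rightarrow> 'a) \<Rightarrow>
     ('k \<Rightarrow> 'b::real_normed_vector \<Rightarrow> 'b) \<Rightarrow> nat \<Rightarrow> ((nat \<Rightarrow> 'a) \<Rightarrow> 'b) \<Rightarrow> bool" where
  "multilinear sE sF n A \<longleftrightarrow>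
     (\<forall>x y. (\<forall>i<n. x i = y i) \<longrightarrow> A x = A y) \<and>
     (\<forall>x. \<forall>i<n. Vector_Spaces.linear sE sF (\<lambda>y. A (x(i := y))))"

definition hom_polys ::
    "('k::real_or_complex \<Rightarrow> 'a::real_normed_vector \<Rightarrow> 'a) \<Rightarrow>
     ('k \<Rightarrow> 'b::real_normed_vector \<Rightarrow> 'b) \<Rightarrow> nat \<Rightarrow> ('a \<Rightarrow> 'b) set" where
  "hom_polys sE sF n =
     {P. continuous_on UNIV P \<and> (\<exists>A. multilinear sE sF n A \<and> (\<forall>x. P x = A (\<lambda>i. x)))}"

definition poly_norm :: "('a::real_normed_vector \<Rightarrow> 'b::real_normed_vector) \<Rightarrow> real" where
  "poly_norm P = (SUP x\<in>cball 0 1. norm (P x))"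

definition weakly_cont_polys ::
    "('k::real_or_complex \<Rightarrow> 'a::real_normed_vector \<Rightarrow> 'a) \<Rightarrow>
     ('k \<Rightarrow> 'b::real_normed_vector \<Rightarrow> 'b) \<Rightarrow> nat \<Rightarrow> ('a \<Rightarrow> 'b) set" where
  "weakly_cont_polys sE sF n =
     {P \<in> hom_polys sE sF n.
        \<forall>G x. Bfun (\<lambda>y. y) G \<and> weakly_converges sE G x \<longrightarrow> ((\<lambda>y. norm (P y - P x)) \<longlongrightarrow> 0) G}"

text \<open>In \<^typ>\<open>enat\<close> the infimum of the empty set is \<open>\<infinity>\<close>.\<close>

definition critical_degree ::
    "('k::real_or_complex \<Rightarrow> 'a::real_normed_vector \<Rightarrow> 'a) \<Rightarrow>
     ('k \<Rightarrow> 'b::real_normed_vector \<Rightarrow> 'b) \<Rightarrow> enat" where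
  "critical_degree sE sF =
     (INF k\<in>{k. 1 \<le> k \<and> weakly_cont_polys sE sF k \<noteq> hom_polys sE sF k}. enat k)"

definition scalar_critical_degree ::
    "('k::real_or_complex \<Rightarrow> 'a::real_normed_vector \<Rightarrow> 'a) \<Rightarrow> enat" where
  "scalar_critical_degree sE = critical_degree sE ((*) :: 'k \<Rightarrow> 'k \<Rightarrow> 'k)"

end

(* M-ideality of the compact operators yields, by Hahn-Banach, a net of compact operators K with
   norm at most 1 in the limit, K -> Id and K* -> Id strongly, and limsup |S + Id - K| <= max(1,|S|)
   for compact S; rank-one S give property (M) of E. Since all polynomials of degree below n are
   weakly continuous on bounded sets, P - P o (Id - K) is so too for P of degree n, whereas
   P o (Id - K) -> 0 and P o K -> P in norm when P itself is. The two properties (M), together with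
   f o Q being weakly continuous for functionals f on F (n < cd(E)), give
   |P o K_b + Q o (Id - K_a)| <= max(|P|,|Q|) in the limit over a, then b. Hence
   phi |-> lim phi(P o K_b) is the L-projection that exhibits the M-ideal. Limits are taken along
   an ultrafilter of operators, so that no subnets are needed. *)
theory Submission
  imports Defs
begin


section \<open>Ultrafilters\<close>

text \<open>Why Hahn-Banach yields compact operators: the assignment of (\<pi> \<phi>)(Id) to
  \<phi>, with \<pi> the given L-projection, is an element of the bidual of L(E) that behaves like a
  member of K(E). Finitely many norm constraints that it meets with some slack are met by an
  operator in K(E). Norms of polynomials are suprema over the unit ball, so an estimate along K is
  tested on selections x_K of unit vectors. Norm convergence of K* f to f makes x_K - K x_K weakly
  null for every selection, but x_K itself need not have a weak limit. Therefore P o K -> P requires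
  uniform weak continuity on balls, which has to be derived from weak continuity at points. Property
  (M) compares vectors, not polynomials. For fixed b the vectors K_b x_a converge to some u, which
  is why the limit over a is the inner one. P u is then to be dominated by Q x' with |x'| <= |u|;
  this asks for |P| <= |Q|, so the estimate is first proved for |Q| = 1 and then extended by
  convexity.\<close>

definition ultrafilter :: "'i filter \<Rightarrow> bool" where
  "ultrafilter U \<longleftrightarrow> U \<noteq> bot \<and> (\<forall>P. eventually P U \<or> eventually (\<lambda>i. \<not> P i) U)"

lemma ultrafilter_not_eventually:
  "ultrafilter U \<Longrightarrow> \<not> eventually P U \<Longrightarrow> eventually (\<lambda>i. \<not> P i) U"
  unfolding ultrafilter_def by blast

text \<open>Zorn's lemma for the reversed order; the empty chain is covered by \<open>ne\<close>. It
  produces ultrafilters as minimal proper filters and linear functionals as minimal sublinear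
  ones.\<close>

lemma Zorn_minimal:
  fixes A :: "'a::order set"
  assumes ne: "A \<noteq> {}"
    and chain: "\<And>C. C \<noteq> {} \<Longrightarrow> C \<subseteq> A \<Longrightarrow> \<forall>a\<in>C. \<forall>b\<in>C. a \<le> b \<or> b \<le> a \<Longrightarrow> \<exists>u\<in>A. \<forall>a\<in>C. u \<le> a"
  shows "\<exists>m\<in>A. \<forall>a\<in>A. a \<le> m \<longrightarrow> a = m"
proof (rule predicate_Zorn)
  show "partial_order_on A (relation_of (\<lambda>a b. b \<le> a) A)"
    by (auto simp: partial_order_on_def preorder_on_def refl_on_def trans_def antisym_def
        relation_of_def)
  fix C assume "C \<in> Chains (relation_of (\<lambda>a b. b \<le> a) A)"
  then have "C \<subseteq> A" "\<forall>a\<in>C. \<forall>b\<in>C. a \<le> b \<or> b \<le> a"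
    by (auto simp: Chains_def relation_of_def)
  then show "\<exists>u\<in>A. \<forall>a\<in>C. u \<le> a" using chain[of C] ne by (cases "C = {}") auto
qed

text \<open>A minimal proper filter decides every \<open>P\<close>: its meet with
  \<open>{i. P i}\<close> is either \<open>bot\<close>, so that \<open>P\<close> fails eventually,
  or by minimality the filter itself, so that \<open>P\<close> holds eventually.\<close>

lemma ultrafilter_exists:
  assumes "G \<noteq> bot"
  obtains U where "ultrafilter U" "U \<le> G"
proof -
  let ?A = "{H. H \<noteq> bot \<and> H \<le> G}"
  have "\<exists>m\<in>?A. \<forall>a\<in>?A. a \<le> m \<longrightarrow> a = m"
  proof (rule Zorn_minimal)
    show "?A \<noteq> {}" using assms by blast
    fix C assume C: "C \<noteq> {}" "C \<subseteq> ?A" and tot: "\<forall>a\<in>C. \<forall>b\<in>C. a \<le> b \<or> b \<le> a"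
    \<comment> \<open>A finite part of the chain has a least member, which is proper; so all finite
      infima, and with them the infimum of the chain, are proper.\<close>
    have least: "\<exists>m\<in>C. \<forall>b\<in>B. m \<le> b" if "finite B" "B \<subseteq> C" for B
      using that
    proof (induction B)
      case empty
      then show ?case using C(1) by auto
    next
      case (insert b B)
      then obtain m where "m \<in> C" "\<forall>x\<in>B. m \<le> x" by auto
      then show ?case
        using tot insert.prems by (metis insert_iff order_trans subsetD)
    qed
    have "Inf C \<noteq> bot"
    proof (rule Inf_filter_not_bot)
      fix B assume "B \<subseteq> C" "finite B"
      then obtain m where "m \<in> C" "m \<le> Inf B"
        using least[of B] by (auto intro: Inf_greatest)
      then show "Inf B \<noteq> bot" using C(2) by (auto simp: bot_unique)
    qed
    moreover have "Inf C \<le> G"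
      using C by (metis (mono_tags, lifting) Inf_lower2 ex_in_conv mem_Collect_eq subsetD)
    ultimately show "\<exists>u\<in>?A. \<forall>a\<in>C. u \<le> a" by (auto intro: Inf_lower)
  qed
  then obtain U where U: "U \<noteq> bot" "U \<le> G" and min: "\<And>H. H \<noteq> bot \<Longrightarrow> H \<le> G \<Longrightarrow> H \<le> U \<Longrightarrow> H = U"
    by auto
  have "eventually P U \<or> eventually (\<lambda>i. \<not> P i) U" for P
  proof (cases "inf U (principal {i. P i}) = bot")
    case True
    then show ?thesis
      by (auto simp: trivial_limit_def eventually_inf_principal)
  next
    case False
    then have "inf U (principal {i. P i}) = U"
      using U by (intro min) (auto intro: le_infI1)
    then have "U \<le> principal {i. P i}" by (metis inf.cobounded2)
    then show ?thesis by (simp add: le_principal)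
  qed
  then show ?thesis using that U by (auto simp: ultrafilter_def)
qed

text \<open>Compactness gives a cluster point; an ultrafilter that does not eventually stay in a
  neighbourhood of it eventually avoids that neighbourhood, so the cluster point is a limit.\<close>

lemma ultrafilter_tendsto_compact:
  assumes "ultrafilter U" "compact S" "eventually (\<lambda>i. g i \<in> S) U"
  obtains l where "l \<in> S" "(g \<longlongrightarrow> l) U"
proof -
  have "filtermap g U \<noteq> bot" "eventually (\<lambda>x. x \<in> S) (filtermap g U)"
    using assms by (auto simp: ultrafilter_def filtermap_bot_iff eventually_filtermap)
  then obtain l where l: "l \<in> S" "inf (nhds l) (filtermap g U) \<noteq> bot"
    using assms(2) unfolding compact_filter by blast
  have "(g \<longlongrightarrow> l) U"
    unfolding tendsto_def
  proof (intro allI impI)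
    fix V assume V: "open V" "l \<in> V"
    show "eventually (\<lambda>i. g i \<in> V) U"
    proof (rule ccontr)
      assume "\<not> ?thesis"
      then have "eventually (\<lambda>i. g i \<notin> V) U"
        using assms(1) by (rule ultrafilter_not_eventually[rotated])
      then have "eventually (\<lambda>x. x \<notin> V) (filtermap g U)"
        by (simp add: eventually_filtermap)
      moreover have "eventually (\<lambda>x. x \<in> V) (nhds l)"
        using V by (rule eventually_nhds_in_open)
      ultimately have "eventually (\<lambda>x. False) (inf (nhds l) (filtermap g U))"
        unfolding eventually_inf by blast
      then show False using l(2) by (simp add: trivial_limit_def)
    qed
  qed
  with l(1) show ?thesis using that by blast
qed

text \<open>If convergence fails, the filter can be traced on a set where \<open>g\<close> stays
  away from 0 and then refined to an ultrafilter. This makes compactness arguments available for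
  arbitrary filters.\<close>

lemma tendsto_zero_if_ultrafilters:
  fixes g :: "'i \<Rightarrow> 'a::real_normed_vector"
  assumes "\<And>U. ultrafilter U \<Longrightarrow> U \<le> G \<Longrightarrow> (g \<longlongrightarrow> 0) U"
  shows "(g \<longlongrightarrow> 0) G"
proof (rule ccontr)
  assume "\<not> ?thesis"
  then obtain e where e: "e > 0" "\<not> eventually (\<lambda>i. norm (g i) < e) G"
    unfolding tendsto_iff by auto
  then have "inf G (principal {i. \<not> norm (g i) < e}) \<noteq> bot"
    by (simp add: trivial_limit_def eventually_inf_principal)
  then obtain U where U: "ultrafilter U" "U \<le> inf G (principal {i. \<not> norm (g i) < e})"
    by (rule ultrafilter_exists)
  then have "(g \<longlongrightarrow> 0) U" using assms by auto
  then have "eventually (\<lambda>i. norm (g i) < e) U"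
    using e(1) unfolding tendsto_iff by auto
  moreover have "eventually (\<lambda>i. \<not> norm (g i) < e) U"
    using U(2) by (simp add: le_principal)
  ultimately have "eventually (\<lambda>i. False) U" by eventually_elim simp
  then show False using U(1) by (simp add: ultrafilter_def trivial_limit_def)
qed


section \<open>Scalars\<close>

text \<open>The real part, by polarisation: a formula that makes sense in any real normed field.\<close>

definition scalar_Re :: "'k::real_or_complex \<Rightarrow> real" where
  "scalar_Re z = ((norm (z + 1))\<^sup>2 - (norm z)\<^sup>2 - 1) / 2"

lemma scalar_Re_le_norm: "scalar_Re z \<le> norm z"
proof -
  have "norm (z + 1) \<le> norm z + 1"
    using norm_triangle_ineq[of z 1] by simp
  then have "(norm (z + 1))\<^sup>2 \<le> (norm z + 1)\<^sup>2"
    by (intro power_mono) auto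
  then show ?thesis
    by (simp add: scalar_Re_def power2_eq_square algebra_simps)
qed

lemma scalar_Re_of_real: "scalar_Re (of_real r :: 'k::real_or_complex) = r"
proof -
  have "norm (of_real r + 1 :: 'k) = \<bar>r + 1\<bar>"
    by (metis norm_of_real of_real_1 of_real_add)
  then show ?thesis
    by (simp add: scalar_Re_def power2_eq_square algebra_simps)
qed

lemma scalar_cases:
  obtains (real) "\<And>z::'k::real_or_complex. \<exists>a. z = of_real a"
  | (complex) i :: "'k::real_or_complex" where "i * i = - 1" "\<And>z. \<exists>a b. z = of_real a + of_real b * i"
      "\<And>a b. norm (of_real a + of_real b * i) = sqrt (a\<^sup>2 + b\<^sup>2)"
      "\<And>a b. scalar_Re (of_real a + of_real b * i) = a"
  using real_or_complex[where 'a='k]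
proof
  assume "\<forall>z::'k. \<exists>a. z = a *\<^sub>R 1"
  then show ?thesis by (intro real) (simp add: of_real_def)
next
  assume "\<exists>i::'k. i * i = - 1 \<and> (\<forall>z. \<exists>a b. z = a *\<^sub>R 1 + b *\<^sub>R i) \<and>
       (\<forall>a b. norm (a *\<^sub>R 1 + b *\<^sub>R i) = sqrt (a\<^sup>2 + b\<^sup>2))"
  then obtain i :: 'k where i: "i * i = - 1" "\<And>z. \<exists>a b. z = of_real a + of_real b * i"
       "\<And>a b. norm (of_real a + of_real b * i) = sqrt (a\<^sup>2 + b\<^sup>2)"
    by (auto simp: scaleR_conv_of_real)
  have "scalar_Re (of_real a + of_real b * i) = a" for a b
  proof -
    have "of_real a + of_real b * i + 1 = of_real (a + 1) + of_real b * i"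
      by (simp add: algebra_simps)
    then show ?thesis unfolding scalar_Re_def
      by (simp only: i(3) real_sqrt_pow2[OF sum_power2_ge_zero]) (simp add: power2_eq_square algebra_simps)
  qed
  with i show ?thesis by (rule complex)
qed

text \<open>Local compactness of the field is what makes bounded scalar families converge along
  ultrafilters and rank-one operators compact. It is carried over from the real line or the real
  plane.\<close>

lemma compact_cball_scalar: "compact (cball (0::'k::real_or_complex) r)"
proof (cases rule: scalar_cases[where 'k='k])
  case real
  have "cball (0::'k) r = of_real ` cball 0 r"
    using real by force
  then show ?thesis
    by (auto intro!: compact_continuous_image continuous_intros)
next
  case (complex i)
  have "cball (0::'k) r = (\<lambda>ab. of_real (fst ab) + of_real (snd ab) * i) ` cball 0 r"
  proof (intro equalityI subsetI)
    fix z :: 'k assume z: "z \<in> cball 0 r"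
    obtain a b where ab: "z = of_real a + of_real b * i" using complex(2) by blast
    then have "(a, b) \<in> cball 0 r" using z complex(3)[of a b] by (simp add: norm_Pair)
    then show "z \<in> (\<lambda>ab. of_real (fst ab) + of_real (snd ab) * i) ` cball 0 r"
      using ab by (intro image_eqI[of _ _ "(a, b)"]) auto
  qed (auto simp: norm_Pair complex(3))
  then show ?thesis
    by (auto intro!: compact_continuous_image continuous_intros)
qed

lemma scalar_Re_add: "scalar_Re (z + w) = scalar_Re z + scalar_Re (w::'k::real_or_complex)"
proof (cases rule: scalar_cases[where 'k='k])
  case real
  then show ?thesis by (metis of_real_add scalar_Re_of_real)
next
  case (complex i)
  obtain a b c d where zw: "z = of_real a + of_real b * i" "w = of_real c + of_real d * i"
    using complex(2) by metis
  have "z + w = of_real (a + c) + of_real (b + d) * i"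
    using zw by (simp add: algebra_simps)
  then show ?thesis using zw complex(4) by metis
qed

lemma scalar_Re_sum: "scalar_Re (sum g I) = (\<Sum>i\<in>I. scalar_Re (g i :: 'k::real_or_complex))"
  using scalar_Re_of_real[of 0, where 'k='k]
  by (induction I rule: infinite_finite_induct) (auto simp: scalar_Re_add)

lemma scalar_phase:
  obtains c :: "'k::real_normed_field" where "norm c = 1" "c * z = of_real (norm z)"
proof (cases "z = 0")
  case True
  then show ?thesis using that[of 1] by simp
next
  case False
  then show ?thesis using that[of "of_real (norm z) / z"] by (simp add: norm_divide)
qed

lemma module_real_scale:
  assumes "module (s :: 'k::real_normed_field \<Rightarrow> 'v::ab_group_add \<Rightarrow> 'v)"
  shows "module (\<lambda>r. s (of_real r))"
proof -
  interpret module s by fact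
  show ?thesis
    by unfold_locales (auto simp: scale_right_distrib scale_left_distrib)
qed

lemma module_fun_scale:
  assumes "module (s :: 'k::comm_ring_1 \<Rightarrow> 'b::ab_group_add \<Rightarrow> 'b)"
  shows "module (fun_scale s :: 'k \<Rightarrow> ('a \<Rightarrow> 'b) \<Rightarrow> 'a \<Rightarrow> 'b)"
proof -
  interpret module s by fact
  show ?thesis
    by unfold_locales
      (auto simp: fun_scale_def fun_eq_iff scale_right_distrib scale_left_distrib)
qed


section \<open>The Hahn--Banach theorem on a carrier\<close>

definition sublinear_on :: "(real \<Rightarrow> 'v::ab_group_add \<Rightarrow> 'v) \<Rightarrow> 'v set \<Rightarrow> ('v \<Rightarrow> real) \<Rightarrow> bool" where
  "sublinear_on s X p \<longleftrightarrow> (\<forall>x\<in>X. \<forall>y\<in>X. p (x + y) \<le> p x + p y) \<and>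
     (\<forall>r\<ge>0. \<forall>x\<in>X. p (s r x) = r * p x)"

definition linear_on :: "(real \<Rightarrow> 'v::ab_group_add \<Rightarrow> 'v) \<Rightarrow> 'v set \<Rightarrow> ('v \<Rightarrow> real) \<Rightarrow> bool" where
  "linear_on s X f \<longleftrightarrow> (\<forall>x\<in>X. \<forall>y\<in>X. f (x + y) = f x + f y) \<and>
     (\<forall>r. \<forall>x\<in>X. f (s r x) = r * f x)"

text \<open>Operators and polynomials form subsets of function types rather than types of their own,
  so Hahn-Banach is developed relative to a carrier \<open>X\<close>.\<close>

locale real_carrier = module s
  for s :: "real \<Rightarrow> 'v::ab_group_add \<Rightarrow> 'v" +
  fixes X
  assumes X: "subspace X"
begin

lemma sublinear_zero: "sublinear_on s X p \<Longrightarrow> p 0 = 0"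
  using subspace_0[OF X] unfolding sublinear_on_def
  by (metis mult_zero_left order_refl scale_zero_left)

lemma sublinear_lower: 
  assumes "sublinear_on s X p" "x \<in> X"
  shows "- p (- x) \<le> p x"
proof -
  have "p (x + - x) \<le> p x + p (- x)"
    using assms subspace_neg[OF X] unfolding sublinear_on_def by blast
  then show ?thesis using sublinear_zero[OF assms(1)] by simp
qed

text \<open>The inequality for \<open>r\<close> gives the reverse one when it is applied to
  \<open>s r x\<close> with the factor \<open>inverse r\<close>.\<close>

lemma sublinear_onI:
  assumes "\<And>x y. x \<in> X \<Longrightarrow> y \<in> X \<Longrightarrow> p (x + y) \<le> p x + p y" and zero: "p 0 = 0"
    and le: "\<And>x r. x \<in> X \<Longrightarrow> r > 0 \<Longrightarrow> p (s r x) \<le> r * p x"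
  shows "sublinear_on s X p"
proof -
  have "p (s r x) = r * p x" if x: "x \<in> X" and r: "r \<ge> 0" for x r
  proof (cases "r = 0")
    case True
    then show ?thesis using zero by simp
  next
    case False
    then have r: "r > 0" using r by simp
    have "p (s (inverse r) (s r x)) \<le> inverse r * p (s r x)"
      using r x X by (intro le subspace_scale) auto
    then have "r * p x \<le> p (s r x)"
      using r by (simp add: field_simps)
    then show ?thesis using le[OF x r] by simp
  qed
  then show ?thesis using assms(1) unfolding sublinear_on_def by blast
qed

text \<open>One construction for three purposes: shifting a functional along a vector, bounding a
  chain of functionals from below, and passing to the quotient by a subspace. \<open>add\<close> and
  \<open>scale\<close> say that the family is directed enough for its pointwise infimum to be
  sublinear.\<close>

lemma sublinear_INF:
  assumes add: "\<And>i j x y. i \<in> I \<Longrightarrow> j \<in> I \<Longrightarrow> x \<in> X \<Longrightarrow> y \<in> X \<Longrightarrow> \<exists>k\<in>I. h k (x + y) \<le> h i x + h j y"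
    and scale: "\<And>i x r. i \<in> I \<Longrightarrow> x \<in> X \<Longrightarrow> r > 0 \<Longrightarrow> \<exists>k\<in>I. h k (s r x) \<le> r * h i x"
    and zero: "\<And>i. i \<in> I \<Longrightarrow> 0 \<le> h i 0" "\<exists>i\<in>I. h i 0 \<le> 0"
  shows "\<exists>q. sublinear_on s X q \<and> (\<forall>x. x \<notin> X \<longrightarrow> q x = 0) \<and> (\<forall>x\<in>X. \<forall>i\<in>I. q x \<le> h i x) \<and>
    (\<forall>x\<in>X. \<forall>c. (\<forall>i\<in>I. c \<le> h i x) \<longrightarrow> c \<le> q x)"
proof -
  define q where "q x = (if x \<in> X then INF i\<in>I. h i x else 0)" for x
  obtain j where j: "j \<in> I" "h j 0 \<le> 0" using zero(2) by blast
  \<comment> \<open>The infimum over \<open>I\<close> is finite: a fixed member evaluated at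
    \<open>- x\<close> bounds all the others from below.\<close>
  have lower: "- h j (- x) \<le> h i x" if i: "i \<in> I" and x: "x \<in> X" for i x
  proof -
    obtain k where "k \<in> I" "h k (x + - x) \<le> h i x + h j (- x)"
      using add[OF i j(1) x subspace_neg[OF X x]] by blast
    then show ?thesis using zero(1)[of k] by simp
  qed
  have le: "q x \<le> h i x" if "i \<in> I" "x \<in> X" for i x
    unfolding q_def using that lower[OF _ that(2)] by (auto intro!: cINF_lower bdd_belowI2)
  have ge: "c \<le> q x" if "x \<in> X" "\<And>i. i \<in> I \<Longrightarrow> c \<le> h i x" for c x
    unfolding q_def using that j(1) by (auto intro!: cINF_greatest)
  have "sublinear_on s X q"
  proof (rule sublinear_onI)
    fix x y assume x: "x \<in> X" and y: "y \<in> X"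
    have "q (x + y) - q y \<le> q x"
    proof (rule ge[OF x])
      fix i assume i: "i \<in> I"
      have "q (x + y) - h i x \<le> q y"
      proof (rule ge[OF y])
        fix j assume "j \<in> I"
        then obtain k where "k \<in> I" "h k (x + y) \<le> h i x + h j y" using add i x y by blast
        then show "q (x + y) - h i x \<le> h j y" using le[of k "x + y"] subspace_add[OF X x y] by simp
      qed
      then show "q (x + y) - q y \<le> h i x" by simp
    qed
    then show "q (x + y) \<le> q x + q y" by simp
  next
    show "q 0 = 0"
    proof (rule antisym)
      show "q 0 \<le> 0" using le[OF j(1) subspace_0[OF X]] j(2) by simp
      show "0 \<le> q 0" by (rule ge[OF subspace_0[OF X] zero(1)])
    qed
  next
    fix x and r :: real assume x: "x \<in> X" and r: "r > 0"
    have "q (s r x) / r \<le> q x"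
    proof (rule ge[OF x])
      fix i assume "i \<in> I"
      then obtain k where "k \<in> I" "h k (s r x) \<le> r * h i x" using scale x r by blast
      then show "q (s r x) / r \<le> h i x"
        using le[of k "s r x"] subspace_scale[OF X x] r by (simp add: field_simps)
    qed
    then show "q (s r x) \<le> r * q x" using r by (simp add: field_simps)
  qed
  then show ?thesis using le ge by (intro exI[of _ q]) (auto simp: q_def)
qed

text \<open>A minimal sublinear functional agrees with all its shifts, hence is additive. A linear
  functional below the shift of \<open>q\<close> along \<open>v\<close> takes the value \<open>q v\<close> at \<open>v\<close>.\<close>

lemma sublinear_shift:
  assumes q: "sublinear_on s X q" and v: "v \<in> X"
  shows "\<exists>q'. sublinear_on s X q' \<and> (\<forall>x. x \<notin> X \<longrightarrow> q' x = 0) \<and>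
    (\<forall>x\<in>X. \<forall>t\<ge>0. q' x \<le> q (x + s t v) - t * q v)"
proof -
  have q_add: "q (x + y) \<le> q x + q y" if "x \<in> X" "y \<in> X" for x y
    using q that unfolding sublinear_on_def by blast
  have q_scale: "q (s r x) = r * q x" if "x \<in> X" "r \<ge> 0" for x r
    using q that unfolding sublinear_on_def by blast
  have tv: "x + s t v \<in> X" if "x \<in> X" for x t
    using that v X by (intro subspace_add subspace_scale)
  let ?h = "\<lambda>t x. q (x + s t v) - t * q v"
  have "\<exists>q'. sublinear_on s X q' \<and> (\<forall>x. x \<notin> X \<longrightarrow> q' x = 0) \<and> (\<forall>x\<in>X. \<forall>t\<in>{0..}. q' x \<le> ?h t x) \<and>
    (\<forall>x\<in>X. \<forall>c. (\<forall>t\<in>{0..}. c \<le> ?h t x) \<longrightarrow> c \<le> q' x)"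
  proof (rule sublinear_INF)
    fix t u :: real and x y assume "t \<in> {0..}" "u \<in> {0..}" and xy: "x \<in> X" "y \<in> X"
    moreover have "(x + y) + s (t + u) v = (x + s t v) + (y + s u v)" by (simp add: scale_left_distrib)
    ultimately show "\<exists>k\<in>{0..}. ?h k (x + y) \<le> ?h t x + ?h u y"
      using q_add[OF tv[OF xy(1)] tv[OF xy(2)], of t u]
      by (intro bexI[of _ "t + u"]) (auto simp: algebra_simps)
  next
    fix t r :: real and x assume "t \<in> {0..}" "x \<in> X" "r > 0"
    moreover have "s r x + s (r * t) v = s r (x + s t v)" by (simp add: scale_right_distrib)
    ultimately show "\<exists>k\<in>{0..}. ?h k (s r x) \<le> r * ?h t x"
      using q_scale[OF tv, of x r t] by (intro bexI[of _ "r * t"]) (auto simp: algebra_simps)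
  qed (auto simp: q_scale[OF v])
  then show ?thesis by auto
qed

theorem hahn_banach_sublinear:
  assumes q: "sublinear_on s X q"
  shows "\<exists>f. linear_on s X f \<and> (\<forall>x\<in>X. f x \<le> q x)"
proof -
  \<comment> \<open>Demanding the value 0 off \<open>X\<close> makes the order of whole functions
    coincide with the order on \<open>X\<close>, so that minimality yields an equality of
    functions.\<close>
  let ?A = "{p. sublinear_on s X p \<and> (\<forall>x\<in>X. p x \<le> q x) \<and> (\<forall>x. x \<notin> X \<longrightarrow> p x = 0)}"
  have "\<exists>m\<in>?A. \<forall>a\<in>?A. a \<le> m \<longrightarrow> a = m"
  proof (rule Zorn_minimal)
    have "(\<lambda>x. if x \<in> X then q x else 0) \<in> ?A"
      using q X by (auto simp: sublinear_on_def subspace_add subspace_scale)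
    then show "?A \<noteq> {}" by blast
    fix C assume C: "C \<noteq> {}" "C \<subseteq> ?A" and tot: "\<forall>a\<in>C. \<forall>b\<in>C. a \<le> b \<or> b \<le> a"
    have C_sub: "sublinear_on s X p" if "p \<in> C" for p using C that by auto
    have "\<exists>u. sublinear_on s X u \<and> (\<forall>x. x \<notin> X \<longrightarrow> u x = 0) \<and> (\<forall>x\<in>X. \<forall>p\<in>C. u x \<le> p x) \<and>
      (\<forall>x\<in>X. \<forall>c. (\<forall>p\<in>C. c \<le> p x) \<longrightarrow> c \<le> u x)"
    proof (rule sublinear_INF)
      fix p1 p2 x y assume p12: "p1 \<in> C" "p2 \<in> C" and xy: "x \<in> X" "y \<in> X"
      obtain p where p: "p \<in> C" "p \<le> p1" "p \<le> p2"
        using tot p12 by blast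
      have "p (x + y) \<le> p x + p y" using C_sub[OF p(1)] xy unfolding sublinear_on_def by blast
      also have "\<dots> \<le> p1 x + p2 y" using p by (intro add_mono) (auto simp: le_fun_def)
      finally show "\<exists>k\<in>C. k (x + y) \<le> p1 x + p2 y" using p(1) by blast
    next
      fix p x and r :: real assume p: "p \<in> C" "x \<in> X" "r > 0"
      then have "p (s r x) = r * p x" using C_sub[OF p(1)] unfolding sublinear_on_def by auto
      then show "\<exists>k\<in>C. k (s r x) \<le> r * p x" using p(1) by (intro bexI[of _ p]) auto
    next
      show "0 \<le> p 0" if "p \<in> C" for p using sublinear_zero[OF C_sub[OF that]] by simp
      obtain p where "p \<in> C" using C(1) by blast
      then show "\<exists>p\<in>C. p 0 \<le> 0" using sublinear_zero[OF C_sub[of p]] by (intro bexI[of _ p]) simp_all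
    qed
    then obtain u where u: "sublinear_on s X u" "\<And>x. x \<notin> X \<Longrightarrow> u x = 0"
      "\<And>x p. x \<in> X \<Longrightarrow> p \<in> C \<Longrightarrow> u x \<le> p x" by blast
    have "u \<le> p" if p: "p \<in> C" for p
    proof (rule le_funI)
      fix x
      show "u x \<le> p x" using u(2,3)[of x] C p by (cases "x \<in> X") auto
    qed
    moreover have "u x \<le> q x" if x: "x \<in> X" for x
    proof -
      obtain p where p: "p \<in> C" using C(1) by blast
      then have "p x \<le> q x" using C(2) x by auto
      then show ?thesis using u(3)[OF x p] by simp
    qed
    ultimately show "\<exists>u\<in>?A. \<forall>a\<in>C. u \<le> a" using u(1,2) by blast
  qed
  then obtain f where f: "sublinear_on s X f" "\<And>x. x \<in> X \<Longrightarrow> f x \<le> q x"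
      "\<And>x. x \<notin> X \<Longrightarrow> f x = 0"
    and min: "\<And>p. p \<in> ?A \<Longrightarrow> p \<le> f \<Longrightarrow> p = f"
    by auto
  have super: "f x + f y \<le> f (x + y)" if x: "x \<in> X" and y: "y \<in> X" for x y
  proof -
    obtain p where p: "sublinear_on s X p" "\<And>x. x \<notin> X \<Longrightarrow> p x = 0"
      "\<And>x t. x \<in> X \<Longrightarrow> t \<ge> 0 \<Longrightarrow> p x \<le> f (x + s t y) - t * f y"
      using sublinear_shift[OF f(1) y] by blast
    note p_le = p(3)
    have p_f: "p x \<le> f x" if "x \<in> X" for x
      using p_le[OF that, of 0] by simp
    have "p = f"
    proof (rule min)
      have "p x \<le> q x" if "x \<in> X" for x using p_f[OF that] f(2)[OF that] by simp
      then show "p \<in> ?A" using p by simp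
      show "p \<le> f"
      proof (rule le_funI)
        fix x
        show "p x \<le> f x" using p_f[of x] p(2)[of x] f(3)[of x] by (cases "x \<in> X") auto
      qed
    qed
    then show ?thesis using p_le[OF x, of 1] by simp
  qed
  have add: "f (x + y) = f x + f y" if "x \<in> X" "y \<in> X" for x y
    using super[OF that] f(1) that unfolding sublinear_on_def by (meson antisym)
  have neg: "f (- x) = - f x" if "x \<in> X" for x
    using add[OF that subspace_neg[OF X that]] sublinear_zero[OF f(1)] by simp
  have "f (s r x) = r * f x" if x: "x \<in> X" for r x
  proof (cases "r \<ge> 0")
    case True
    then show ?thesis using f(1) x unfolding sublinear_on_def by blast
  next
    case False
    then have "- r \<ge> 0" by simp
    then have "f (s (- r) x) = - r * f x" using f(1) x unfolding sublinear_on_def by blast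
    moreover have "f (- s (- r) x) = - f (s (- r) x)" using x X by (intro neg subspace_scale)
    ultimately show ?thesis by simp
  qed
  then show ?thesis using add f(2) unfolding linear_on_def by blast
qed

theorem hahn_banach_at:
  assumes q: "sublinear_on s X q" and v: "v \<in> X"
  shows "\<exists>f. linear_on s X f \<and> (\<forall>x\<in>X. f x \<le> q x) \<and> f v = q v"
proof -
  obtain q' where q': "sublinear_on s X q'" and
    le: "\<And>x t. x \<in> X \<Longrightarrow> t \<ge> 0 \<Longrightarrow> q' x \<le> q (x + s t v) - t * q v"
    using sublinear_shift[OF q v] by blast
  obtain f where f: "linear_on s X f" "\<forall>x\<in>X. f x \<le> q' x"
    using hahn_banach_sublinear[OF q'] by blast
  have fq: "f x \<le> q x" if "x \<in> X" for x
    using f(2) le[OF that, of 0] that by fastforce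
  have mv: "- v \<in> X" using v X by (rule subspace_neg[rotated])
  have "f (- v) \<le> - q v"
    using f(2) mv le[OF mv, of 1] sublinear_zero[OF q] by fastforce
  moreover have "f (- v) = - f v"
    using f(1) v unfolding linear_on_def by (metis mult_minus1 scale_minus_left scale_one)
  ultimately show ?thesis using fq[OF v] f(1) fq by (intro exI[of _ f]) auto
qed

text \<open>The gauge \<open>p\<close> is replaced by the quotient gauge, the infimum of
  \<open>p (x + w)\<close> over \<open>w\<close> in \<open>W\<close>. It is at least
  \<open>c\<close> at \<open>v\<close>, where \<open>f\<close> attains it, and at most 0 on
  \<open>W\<close>; since \<open>W\<close> contains \<open>- w\<close> together with
  \<open>w\<close>, a linear functional below it vanishes on \<open>W\<close>.\<close>

theorem hahn_banach_separation:
  assumes p: "sublinear_on s X p" and nonneg: "\<And>x. x \<in> X \<Longrightarrow> 0 \<le> p x"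
    and W: "subspace W" "W \<subseteq> X" and v: "v \<in> X" and c: "\<And>w. w \<in> W \<Longrightarrow> c \<le> p (v + w)"
  shows "\<exists>f. linear_on s X f \<and> (\<forall>x\<in>X. f x \<le> p x) \<and> (\<forall>w\<in>W. f w = 0) \<and> c \<le> f v"
proof -
  have W0: "0 \<in> W" using W(1) by (rule subspace_0)
  have XW: "x + w \<in> X" if "x \<in> X" "w \<in> W" for x w
    using that W X by (auto intro: subspace_add)
  have "\<exists>q. sublinear_on s X q \<and> (\<forall>x. x \<notin> X \<longrightarrow> q x = 0) \<and> (\<forall>x\<in>X. \<forall>w\<in>W. q x \<le> p (x + w)) \<and>
    (\<forall>x\<in>X. \<forall>c. (\<forall>w\<in>W. c \<le> p (x + w)) \<longrightarrow> c \<le> q x)"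
  proof (rule sublinear_INF)
    fix w w' x y assume ww: "w \<in> W" "w' \<in> W" and xy: "x \<in> X" "y \<in> X"
    have "p ((x + y) + (w + w')) = p ((x + w) + (y + w'))" by (simp add: ac_simps)
    also have "\<dots> \<le> p (x + w) + p (y + w')"
      using p XW ww xy unfolding sublinear_on_def by blast
    finally show "\<exists>k\<in>W. p (x + y + k) \<le> p (x + w) + p (y + w')"
      using subspace_add[OF W(1) ww] by blast
  next
    fix w x and r :: real assume w: "w \<in> W" "x \<in> X" "r > 0"
    have "p (s r x + s r w) = r * p (x + w)"
      using p XW[OF w(2,1)] w(3) unfolding sublinear_on_def by (metis less_imp_le scale_right_distrib)
    then show "\<exists>k\<in>W. p (s r x + k) \<le> r * p (x + w)"
      using subspace_scale[OF W(1) w(1)] by (metis order_refl)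
  qed (use nonneg W(2) W0 sublinear_zero[OF p] in \<open>auto intro: bexI[of _ 0]\<close>)
  then obtain q where q: "sublinear_on s X q" and q_le: "\<And>x w. x \<in> X \<Longrightarrow> w \<in> W \<Longrightarrow> q x \<le> p (x + w)"
    and q_ge: "\<And>x c. x \<in> X \<Longrightarrow> (\<And>w. w \<in> W \<Longrightarrow> c \<le> p (x + w)) \<Longrightarrow> c \<le> q x" by blast
  from hahn_banach_at[OF q v] obtain f where
    f: "linear_on s X f" "\<And>x. x \<in> X \<Longrightarrow> f x \<le> q x" "f v = q v" by blast
  have fp: "f x \<le> p x" if "x \<in> X" for x
    using f(2)[OF that] q_le[OF that W0] by simp
  have f_nonpos: "f w \<le> 0" if w: "w \<in> W" for w
  proof -
    have "q w \<le> p (w + - w)" using w W by (intro q_le subspace_neg) auto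
    then show ?thesis using f(2)[of w] w W(2) sublinear_zero[OF p] by auto
  qed
  have "f w = 0" if w: "w \<in> W" for w
  proof -
    have "f (- w) = - f w"
      using f(1) w W(2) unfolding linear_on_def by (metis mult_minus1 scale_minus_left scale_one subsetD)
    then show ?thesis using f_nonpos[OF w] f_nonpos[of "- w"] w W subspace_neg by fastforce
  qed
  then show ?thesis using f(1,3) fp q_ge[OF v c] by (intro exI[of _ f]) auto
qed

end

text \<open>A real functional \<open>f\<close> is the real part of \<open>x \<mapsto> f x - i f (i x)\<close>.\<close>

lemma scalar_functional_of_real_part:
  fixes s :: "'k::real_or_complex \<Rightarrow> 'v::ab_group_add \<Rightarrow> 'v"
  assumes "module s" "module.subspace s X" "linear_on (\<lambda>r. s (of_real r)) X f"
    and f_le: "\<And>x. x \<in> X \<Longrightarrow> f x \<le> p x" and p: "\<And>c x. x \<in> X \<Longrightarrow> norm c = 1 \<Longrightarrow> p (s c x) = p x"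
  shows "\<exists>\<phi>. (\<forall>x\<in>X. \<forall>y\<in>X. \<phi> (x + y) = \<phi> x + \<phi> y) \<and> (\<forall>c. \<forall>x\<in>X. \<phi> (s c x) = c * \<phi> x) \<and>
    (\<forall>x\<in>X. norm (\<phi> x) \<le> p x) \<and> (\<forall>x\<in>X. scalar_Re (\<phi> x) = f x)"
proof -
  interpret module s by fact
  have sX: "s c x \<in> X" if "x \<in> X" for c x using assms(2) that by (rule subspace_scale)
  have f_add: "f (x + y) = f x + f y" if "x \<in> X" "y \<in> X" for x y
    using assms(3) that by (auto simp: linear_on_def)
  have f_scale: "f (s (of_real r) x) = r * f x" if "x \<in> X" for x r
    using assms(3) that by (auto simp: linear_on_def)
  \<comment> \<open>Rotating \<open>x\<close> by a unimodular scalar makes \<open>\<phi> x\<close>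
    real and nonnegative, so its modulus is a value of the real functional \<open>f\<close>.\<close>
  have bound: "norm (\<phi> x) \<le> p x"
    if "x \<in> X" "\<And>c. \<phi> (s c x) = c * \<phi> x" "\<And>c. scalar_Re (\<phi> (s c x)) = f (s c x)" for \<phi> :: "'v \<Rightarrow> 'k" and x
  proof -
    obtain c where c: "norm c = 1" "c * \<phi> x = of_real (norm (\<phi> x))"
      by (rule scalar_phase)
    have "norm (\<phi> x) = scalar_Re (\<phi> (s c x))" using c that by (simp add: scalar_Re_of_real)
    also have "\<dots> = f (s c x)" using that by simp
    also have "\<dots> \<le> p (s c x)" using f_le sX that by blast
    also have "\<dots> = p x" using p that c by blast
    finally show ?thesis .
  qed
  show ?thesis
  proof (cases rule: scalar_cases[where 'k='k])
    case real
    define \<phi> :: "'v \<Rightarrow> 'k" where "\<phi> x = of_real (f x)" for x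
    have "\<phi> (s c x) = c * \<phi> x" if "x \<in> X" for c x
    proof -
      obtain a where "c = of_real a" using real by blast
      then show ?thesis using f_scale[OF that] by (simp add: \<phi>_def)
    qed
    moreover have "\<phi> (x + y) = \<phi> x + \<phi> y" if "x \<in> X" "y \<in> X" for x y
      using f_add that by (simp add: \<phi>_def)
    moreover have re: "scalar_Re (\<phi> x) = f x" for x by (simp add: \<phi>_def scalar_Re_of_real)
    moreover have "norm (\<phi> x) \<le> p x" if "x \<in> X" for x
      using that calculation by (intro bound re) auto
    ultimately show ?thesis by (intro exI[of _ \<phi>]) auto
  next
    case (complex i)
    have re: "scalar_Re (of_real a - i * of_real b) = a" for a b
      using complex(4)[of a "- b"] by (simp add: mult.commute)
    define \<phi> :: "'v \<Rightarrow> 'k" where "\<phi> x = of_real (f x) - i * of_real (f (s i x))" for x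
    have add: "\<phi> (x + y) = \<phi> x + \<phi> y" if "x \<in> X" "y \<in> X" for x y
      using f_add that sX by (simp add: \<phi>_def scale_right_distrib algebra_simps)
    have scale: "\<phi> (s c x) = c * \<phi> x" if x: "x \<in> X" for c x
    proof -
      obtain a b where c: "c = of_real a + of_real b * i" using complex(2) by blast
      have "s c x = s (of_real a) x + s (of_real b) (s i x)"
        unfolding c by (simp add: scale_left_distrib)
      then have 1: "f (s c x) = a * f x + b * f (s i x)"
        using f_add f_scale sX x by (simp del: scale_scale)
      have ic: "i * c = of_real a * i + of_real (- b)"
      proof -
        have "i * c = of_real a * i + of_real b * (i * i)" unfolding c by (simp add: algebra_simps)
        then show ?thesis using complex(1) by simp
      qed
      have "s i (s c x) = s (i * c) x" by simp
      also have "\<dots> = s (of_real a) (s i x) + s (of_real (- b)) x"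
        unfolding ic by (simp only: scale_left_distrib scale_scale)
      finally have 2: "f (s i (s c x)) = a * f (s i x) - b * f x"
        using f_add[OF sX[OF sX[OF x]] sX[OF x]] f_scale sX x by (simp del: of_real_minus scale_scale)
      have ii: "i * (i * z) = - z" for z by (metis complex(1) mult.assoc mult_minus1)
      show ?thesis unfolding \<phi>_def 1 2 unfolding c by (simp add: algebra_simps ii)
    qed
    have \<phi>_Re: "scalar_Re (\<phi> x) = f x" for x by (simp add: \<phi>_def re)
    have "norm (\<phi> x) \<le> p x" if "x \<in> X" for x
      using that scale by (intro bound \<phi>_Re) auto
    then show ?thesis using add scale \<phi>_Re by (intro exI[of _ \<phi>]) auto
  qed
qed


section \<open>Functionals on a normed carrier\<close>

locale normed_carrier = module s
  for s :: "'k::real_or_complex \<Rightarrow> 'v::ab_group_add \<Rightarrow> 'v" +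
  fixes X :: "'v set" and N :: "'v \<Rightarrow> real"
  assumes X: "subspace X"
    and N_nonneg: "x \<in> X \<Longrightarrow> 0 \<le> N x"
    and N_triangle: "x \<in> X \<Longrightarrow> y \<in> X \<Longrightarrow> N (x + y) \<le> N x + N y"
    and N_scale: "x \<in> X \<Longrightarrow> N (s c x) = norm c * N x"

lemma normed_carrierI:
  assumes "module s" "module.subspace s X" and nonneg: "\<And>x. x \<in> X \<Longrightarrow> 0 \<le> N x"
    and triangle: "\<And>x y. x \<in> X \<Longrightarrow> y \<in> X \<Longrightarrow> N (x + y) \<le> N x + N y"
    and le: "\<And>c x. x \<in> X \<Longrightarrow> N (s c x) \<le> norm c * N x"
  shows "normed_carrier s X N"
proof -
  interpret module s by fact
  show ?thesis
  proof
    fix c x assume x: "x \<in> X"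
    show "N (s c x) = norm c * N x"
    proof (cases "c = 0")
      case True
      then show ?thesis using le[OF x, of 0] nonneg[OF subspace_0[OF assms(2)]] by simp
    next
      case False
      have "N x \<le> norm (inverse c) * N (s c x)"
        using le[OF subspace_scale[OF assms(2) x], of "inverse c" c] False by simp
      then have "norm c * N x \<le> norm c * (norm (inverse c) * N (s c x))"
        by (intro mult_left_mono) auto
      also have "\<dots> = N (s c x)" using False by (simp add: norm_inverse)
      finally show ?thesis using le[OF x, of c] by simp
    qed
  qed (use assms in auto)
qed

context normed_carrier
begin

abbreviation "dual \<equiv> dual_space s X N"
abbreviation "dn \<equiv> dual_norm X N"

lemma X_closed [simp]:
  "0 \<in> X" "x \<in> X \<Longrightarrow> y \<in> X \<Longrightarrow> x + y \<in> X" "x \<in> X \<Longrightarrow> y \<in> X \<Longrightarrow> x - y \<in> X"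
  "x \<in> X \<Longrightarrow> s c x \<in> X" "x \<in> X \<Longrightarrow> - x \<in> X"
  using X by (auto intro: subspace_0 subspace_add subspace_diff subspace_scale subspace_neg)

lemma N_zero [simp]: "N 0 = 0"
  using N_scale[of 0 0] by simp

lemma N_minus: "x \<in> X \<Longrightarrow> N (- x) = N x"
  using N_scale[of x "- 1"] by simp

lemma dual_add: "\<phi> \<in> dual \<Longrightarrow> x \<in> X \<Longrightarrow> y \<in> X \<Longrightarrow> \<phi> (x + y) = \<phi> x + \<phi> y"
  and dual_scale: "\<phi> \<in> dual \<Longrightarrow> x \<in> X \<Longrightarrow> \<phi> (s c x) = c * \<phi> x"
  and dual_off: "\<phi> \<in> dual \<Longrightarrow> x \<notin> X \<Longrightarrow> \<phi> x = 0"
  by (auto simp: dual_space_def)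

lemma dual_zero: "\<phi> \<in> dual \<Longrightarrow> \<phi> 0 = 0"
  using dual_scale[of \<phi> 0 0] by simp

lemma dual_minus: "\<phi> \<in> dual \<Longrightarrow> x \<in> X \<Longrightarrow> \<phi> (- x) = - \<phi> x"
  using dual_scale[of \<phi> x "-1"] by simp

lemma dual_diff: "\<phi> \<in> dual \<Longrightarrow> x \<in> X \<Longrightarrow> y \<in> X \<Longrightarrow> \<phi> (x - y) = \<phi> x - \<phi> y"
  using dual_add[of \<phi> x "- y"] by (simp add: dual_minus)

lemma dualI:
  assumes "\<And>x y. x \<in> X \<Longrightarrow> y \<in> X \<Longrightarrow> \<phi> (x + y) = \<phi> x + \<phi> y"
    and "\<And>c x. x \<in> X \<Longrightarrow> \<phi> (s c x) = c * \<phi> x"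
    and "\<And>x. x \<in> X \<Longrightarrow> norm (\<phi> x) \<le> C * N x" and "\<And>x. x \<notin> X \<Longrightarrow> \<phi> x = 0"
  shows "\<phi> \<in> dual"
  using assms unfolding dual_space_def by blast

text \<open>\<open>N\<close> is only a seminorm here. If \<open>N x = 0\<close>, all multiples of
  \<open>x\<close> lie in the unit ball, and their values stay below \<open>C\<close> only if
  \<open>\<phi> x = 0\<close>.\<close>

lemma bound_from_ball:
  fixes \<phi> :: "'v \<Rightarrow> 'k"
  assumes "\<And>c x. x \<in> X \<Longrightarrow> \<phi> (s c x) = c * \<phi> x"
    and ball: "\<And>x. x \<in> X \<Longrightarrow> N x \<le> 1 \<Longrightarrow> norm (\<phi> x) \<le> C" and x: "x \<in> X"
  shows "norm (\<phi> x) \<le> C * N x"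
proof (cases "N x = 0")
  case True
  have "r * norm (\<phi> x) \<le> C" if "r \<ge> 0" for r
    using ball[of "s (of_real r) x"] assms(1)[OF x] x True that by (simp add: N_scale norm_mult)
  from this[of 0] this[of "(C + 1) / norm (\<phi> x)"] have "norm (\<phi> x) = 0"
    by (cases "norm (\<phi> x) = 0") auto
  then show ?thesis using True by simp
next
  case False
  then have pos: "N x > 0" using N_nonneg[OF x] by simp
  have "norm (\<phi> (s (of_real (1 / N x)) x)) \<le> C"
    using ball[of "s (of_real (1 / N x)) x"] x pos by (simp add: N_scale norm_divide)
  then show ?thesis using assms(1)[OF x] pos by (simp add: norm_mult norm_divide field_simps)
qed

lemma dn_bdd_above:
  assumes "\<phi> \<in> dual"
  shows "bdd_above ((\<lambda>x. norm (\<phi> x)) ` {x\<in>X. N x \<le> 1})"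
proof -
  obtain C where C: "\<And>x. x \<in> X \<Longrightarrow> norm (\<phi> x) \<le> C * N x"
    using assms unfolding dual_space_def by blast
  have "norm (\<phi> x) \<le> \<bar>C\<bar>" if "x \<in> X" "N x \<le> 1" for x
  proof -
    have "C * N x \<le> \<bar>C\<bar> * 1" using that N_nonneg[of x] by (intro mult_mono) auto
    then show ?thesis using C[OF that(1)] by simp
  qed
  then show ?thesis by (intro bdd_aboveI2) auto
qed

lemma dn_ball: "\<phi> \<in> dual \<Longrightarrow> x \<in> X \<Longrightarrow> N x \<le> 1 \<Longrightarrow> norm (\<phi> x) \<le> dn \<phi>"
  unfolding dual_norm_def by (rule cSUP_upper[OF _ dn_bdd_above]) auto

lemma dn_bound: "\<phi> \<in> dual \<Longrightarrow> x \<in> X \<Longrightarrow> norm (\<phi> x) \<le> dn \<phi> * N x"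
  by (rule bound_from_ball) (auto simp: dual_scale dn_ball)

lemma dn_nonneg: "\<phi> \<in> dual \<Longrightarrow> 0 \<le> dn \<phi>"
  using dn_ball[of \<phi> 0] dual_zero[of \<phi>] by simp

lemma dn_le:
  assumes "\<And>x. x \<in> X \<Longrightarrow> N x \<le> 1 \<Longrightarrow> norm (\<phi> x) \<le> C"
  shows "dn \<phi> \<le> C"
proof -
  have "0 \<in> {x\<in>X. N x \<le> 1}" by simp
  then show ?thesis unfolding dual_norm_def using assms by (intro cSUP_least) blast+
qed

lemma dn_approx:
  assumes "\<phi> \<in> dual" "e > 0"
  obtains x where "x \<in> X" "N x \<le> 1" "\<phi> x = of_real (norm (\<phi> x))" "dn \<phi> - e < norm (\<phi> x)"
proof -
  have "0 \<in> {x\<in>X. N x \<le> 1}" by simp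
  then have "{x\<in>X. N x \<le> 1} \<noteq> {}" by blast
  then have "\<exists>x\<in>{x\<in>X. N x \<le> 1}. dn \<phi> - e < norm (\<phi> x)"
    using less_cSUP_iff[OF _ dn_bdd_above[OF assms(1)], of "dn \<phi> - e"] assms(2)
    unfolding dual_norm_def by simp
  then obtain x where x: "x \<in> X" "N x \<le> 1" "dn \<phi> - e < norm (\<phi> x)" by blast
  obtain c :: 'k where c: "norm c = 1" "c * \<phi> x = of_real (norm (\<phi> x))"
    by (rule scalar_phase)
  show ?thesis
    using that[of "s c x"] x c dual_scale[OF assms(1) x(1), of c] by (simp add: N_scale)
qed

text \<open>Both functionals are nearly normed at points where their values are real and
  nonnegative, so the two values add up without cancellation. The two points are independent of each
  other, which is what an L-decomposition needs.\<close>

lemma dn_sum_le: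
  assumes \<phi>: "\<phi> \<in> dual" and \<psi>: "\<psi> \<in> dual"
    and le: "\<And>x y. x \<in> X \<Longrightarrow> N x \<le> 1 \<Longrightarrow> y \<in> X \<Longrightarrow> N y \<le> 1 \<Longrightarrow> norm (\<phi> x + \<psi> y) \<le> C"
  shows "dn \<phi> + dn \<psi> \<le> C"
proof (rule field_le_epsilon)
  fix e :: real assume "e > 0"
  then have e: "e / 2 > 0" by simp
  obtain x where x: "x \<in> X" "N x \<le> 1" "\<phi> x = of_real (norm (\<phi> x))" "dn \<phi> - e / 2 < norm (\<phi> x)"
    using dn_approx[OF \<phi> e] .
  obtain y where y: "y \<in> X" "N y \<le> 1" "\<psi> y = of_real (norm (\<psi> y))" "dn \<psi> - e / 2 < norm (\<psi> y)"
    using dn_approx[OF \<psi> e] .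
  have "norm (\<phi> x + \<psi> y) = \<bar>norm (\<phi> x) + norm (\<psi> y)\<bar>"
    using x(3) y(3) by (metis norm_of_real of_real_add)
  then show "dn \<phi> + dn \<psi> \<le> C + e" using le[of x y] x y by linarith
qed

lemma dual_plus [simp]:
  assumes "\<phi> \<in> dual" "\<psi> \<in> dual"
  shows "\<phi> + \<psi> \<in> dual"
proof (rule dualI)
  show "norm ((\<phi> + \<psi>) x) \<le> (dn \<phi> + dn \<psi>) * N x" if "x \<in> X" for x
    using dn_bound[OF assms(1) that] dn_bound[OF assms(2) that] norm_triangle_ineq[of "\<phi> x" "\<psi> x"]
    by (simp add: algebra_simps)
qed (use assms in \<open>auto simp: dual_add dual_scale dual_off algebra_simps\<close>)

lemma dual_fun_scale [simp]:
  assumes "\<phi> \<in> dual"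
  shows "fun_scale (*) c \<phi> \<in> dual"
proof (rule dualI)
  show "norm (fun_scale (*) c \<phi> x) \<le> (norm c * dn \<phi>) * N x" if "x \<in> X" for x
    using mult_left_mono[OF dn_bound[OF assms that], of "norm c"]
    by (simp add: fun_scale_def norm_mult mult.assoc)
qed (use assms in \<open>auto simp: dual_add dual_scale dual_off fun_scale_def algebra_simps\<close>)

lemma dual_uminus: "- \<phi> = fun_scale (*) (- 1) (\<phi> :: 'v \<Rightarrow> 'k)"
  by (simp add: fun_scale_def fun_eq_iff)

lemma dual_neg [simp]: "\<phi> \<in> dual \<Longrightarrow> - \<phi> \<in> dual"
  unfolding dual_uminus by (rule dual_fun_scale)

lemma dual_minus_fun [simp]: "\<phi> \<in> dual \<Longrightarrow> \<psi> \<in> dual \<Longrightarrow> \<phi> - \<psi> \<in> dual"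
  using dual_plus[of \<phi> "- \<psi>"] by simp

lemma dual_0 [simp]: "0 \<in> dual"
  by (rule dualI[where C=0]) auto

lemma dn_add_le: "\<phi> \<in> dual \<Longrightarrow> \<psi> \<in> dual \<Longrightarrow> dn (\<phi> + \<psi>) \<le> dn \<phi> + dn \<psi>"
  by (intro dn_le) (auto intro!: norm_triangle_le add_mono dn_ball)

lemma dn_eq_0D:
  assumes "\<phi> \<in> dual" "dn \<phi> \<le> 0"
  shows "\<phi> = 0"
proof
  fix x
  have "dn \<phi> = 0" using assms dn_nonneg by fastforce
  then show "\<phi> x = 0 x"
    using dn_bound[OF assms(1), of x] dual_off[OF assms(1), of x] by (cases "x \<in> X") auto
qed

lemma dual_ext:
  "\<phi> \<in> dual \<Longrightarrow> \<psi> \<in> dual \<Longrightarrow> (\<And>x. x \<in> X \<Longrightarrow> \<phi> x = \<psi> x) \<Longrightarrow> \<phi> = \<psi>"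
  by (metis dual_off ext)


section \<open>A criterion for M-ideals\<close>

end

text \<open>Used for both families of the criterion below. The bound 2 is the mixed estimate of that
  criterion with \<open>e = 1\<close> and one of the two vectors equal to 0.\<close>

locale limit_family = normed_carrier s X N
  for s :: "'k::real_or_complex \<Rightarrow> 'v::ab_group_add \<Rightarrow> 'v" and X N +
  fixes U :: "'i filter" and D :: "'i \<Rightarrow> 'v \<Rightarrow> 'v"
  assumes U: "ultrafilter U"
    and D_add: "x \<in> X \<Longrightarrow> y \<in> X \<Longrightarrow> D i (x + y) = D i x + D i y"
    and D_scale: "x \<in> X \<Longrightarrow> D i (s c x) = s c (D i x)"
    and D_X: "x \<in> X \<Longrightarrow> eventually (\<lambda>i. D i x \<in> X) U"
    and D_bound: "x \<in> X \<Longrightarrow> N x \<le> 1 \<Longrightarrow> eventually (\<lambda>i. N (D i x) \<le> 2) U"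
begin

definition L :: "('v \<Rightarrow> 'k) \<Rightarrow> 'v \<Rightarrow> 'k" where
  "L \<phi> x = (if x \<in> X then Lim U (\<lambda>i. \<phi> (D i x)) else 0)"

lemma
  shows lim: "\<And>\<phi> x. \<phi> \<in> dual \<Longrightarrow> x \<in> X \<Longrightarrow> ((\<lambda>i. \<phi> (D i x)) \<longlongrightarrow> L \<phi> x) U"
    and L_eq: "\<And>\<phi> x l. \<phi> \<in> dual \<Longrightarrow> x \<in> X \<Longrightarrow> ((\<lambda>i. \<phi> (D i x)) \<longlongrightarrow> l) U \<Longrightarrow> L \<phi> x = l"
    and L_dual: "\<And>\<phi>. \<phi> \<in> dual \<Longrightarrow> L \<phi> \<in> dual"
    and L_add: "\<And>\<phi> \<psi>. \<phi> \<in> dual \<Longrightarrow> \<psi> \<in> dual \<Longrightarrow> L (\<phi> + \<psi>) = L \<phi> + L \<psi>"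
    and L_scale: "\<And>c \<phi>. \<phi> \<in> dual \<Longrightarrow> L (fun_scale (*) c \<phi>) = fun_scale (*) c (L \<phi>)"
    and L_diff: "\<And>\<phi> \<psi>. \<phi> \<in> dual \<Longrightarrow> \<psi> \<in> dual \<Longrightarrow> L (\<phi> - \<psi>) = L \<phi> - L \<psi>"
proof -
  have U_bot: "U \<noteq> bot" using U by (simp add: ultrafilter_def)
  show lim: "((\<lambda>i. \<phi> (D i x)) \<longlongrightarrow> L \<phi> x) U" if \<phi>: "\<phi> \<in> dual" and x: "x \<in> X" for \<phi> x
  proof -
    \<comment> \<open>The summand 1 keeps the factor finite where the seminorm vanishes, and still
      puts the multiple into the unit ball.\<close>
    define r where "r = 1 / (N x + 1)"
    have r: "r > 0" using N_nonneg[OF x] by (simp add: r_def)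
    have "N (s (of_real r) x) \<le> 1"
      using N_nonneg[OF x] by (simp add: N_scale[OF x] r_def field_simps del: of_real_divide)
    then have "eventually (\<lambda>i. N (D i (s (of_real r) x)) \<le> 2) U"
      using D_bound x by simp
    with D_X[OF x] have "eventually (\<lambda>i. \<phi> (D i x) \<in> cball 0 (dn \<phi> * (2 / r))) U"
    proof eventually_elim
      case (elim i)
      then have "N (D i x) \<le> 2 / r"
        using r by (simp add: D_scale[OF x] N_scale field_simps)
      then have "dn \<phi> * N (D i x) \<le> dn \<phi> * (2 / r)"
        by (intro mult_left_mono dn_nonneg \<phi>)
      then show ?case using dn_bound[OF \<phi> elim(1)] by simp
    qed
    then obtain l where "((\<lambda>i. \<phi> (D i x)) \<longlongrightarrow> l) U"
      using ultrafilter_tendsto_compact[OF U compact_cball_scalar] by metis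
    moreover from this have "Lim U (\<lambda>i. \<phi> (D i x)) = l" by (rule tendsto_Lim[OF U_bot])
    ultimately show ?thesis using x by (simp add: L_def)
  qed
  show eq: "L \<phi> x = l" if "\<phi> \<in> dual" "x \<in> X" "((\<lambda>i. \<phi> (D i x)) \<longlongrightarrow> l) U" for \<phi> x l
    using tendsto_unique[OF U_bot lim[OF that(1,2)] that(3)] .
  have scale: "L \<phi> (s c x) = c * L \<phi> x" if \<phi>: "\<phi> \<in> dual" and x: "x \<in> X" for \<phi> c x
  proof -
    have "eventually (\<lambda>i. c * \<phi> (D i x) = \<phi> (D i (s c x))) U"
      using D_X[OF x] by eventually_elim (simp add: D_scale x dual_scale[OF \<phi>])
    then show ?thesis
      using x by (intro eq \<phi> Lim_transform_eventually[OF tendsto_mult_left[OF lim]]) auto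
  qed
  show dual: "L \<phi> \<in> dual" if \<phi>: "\<phi> \<in> dual" for \<phi>
  proof (rule dualI)
    fix x y assume x: "x \<in> X" and y: "y \<in> X"
    have "eventually (\<lambda>i. \<phi> (D i x) + \<phi> (D i y) = \<phi> (D i (x + y))) U"
      using D_X[OF x] D_X[OF y] by eventually_elim (simp add: D_add x y dual_add[OF \<phi>])
    then show "L \<phi> (x + y) = L \<phi> x + L \<phi> y"
      using x y by (intro eq \<phi> Lim_transform_eventually[OF tendsto_add[OF lim lim]]) auto
  next
    fix x assume x: "x \<in> X"
    show "norm (L \<phi> x) \<le> dn \<phi> * 2 * N x"
    proof (rule bound_from_ball[OF scale[OF \<phi>] _ x])
      fix y assume y: "y \<in> X" "N y \<le> 1"
      have "eventually (\<lambda>i. norm (\<phi> (D i y)) \<le> dn \<phi> * 2) U"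
        using D_X[OF y(1)] D_bound[OF y]
      proof eventually_elim
        case (elim i)
        have "dn \<phi> * N (D i y) \<le> dn \<phi> * 2" using elim(2) by (intro mult_left_mono dn_nonneg \<phi>)
        then show ?case using dn_bound[OF \<phi> elim(1)] by simp
      qed
      then show "norm (L \<phi> y) \<le> dn \<phi> * 2"
        by (rule tendsto_upperbound[OF tendsto_norm[OF lim[OF \<phi> y(1)]] _ U_bot])
    qed
  qed (rule scale[OF \<phi>], assumption, simp add: L_def)
  show "L (\<phi> + \<psi>) = L \<phi> + L \<psi>" if "\<phi> \<in> dual" "\<psi> \<in> dual" for \<phi> \<psi>
    using that by (auto intro!: dual_ext dual_plus dual eq tendsto_add lim)
  show "L (\<phi> - \<psi>) = L \<phi> - L \<psi>" if "\<phi> \<in> dual" "\<psi> \<in> dual" for \<phi> \<psi>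
    using that by (auto intro!: dual_ext dual_minus_fun dual eq tendsto_diff lim)
  show "L (fun_scale (*) c \<phi>) = fun_scale (*) c (L \<phi>)" if \<phi>: "\<phi> \<in> dual" for c \<phi>
  proof -
    have "L (fun_scale (*) c \<phi>) x = fun_scale (*) c (L \<phi>) x" if "x \<in> X" for x
      using tendsto_mult_left[OF lim[OF \<phi> that], of c] that \<phi>
      by (intro eq dual_fun_scale) (auto simp: fun_scale_def)
    then show ?thesis using \<phi> by (intro dual_ext dual dual_fun_scale) auto
  qed
qed

end

context normed_carrier
begin

text \<open>The \<open>L\<close>-projection is \<open>\<pi> \<phi> = lim \<phi> \<circ> A\<^sub>i\<close>, its complement is \<open>\<rho> \<phi> = lim \<phi> \<circ> B\<^sub>i\<close>. The mixed
  estimate gives \<open>\<parallel>\<pi> \<phi>\<parallel> + \<parallel>\<rho> \<phi>\<parallel> \<le> \<parallel>\<phi>\<parallel>\<close>. Applied to \<open>\<pi> \<phi>\<close>, which \<open>\<pi>\<close> fixes, it shows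
  \<open>\<rho> (\<pi> \<phi>) = 0\<close>, and since \<open>\<rho>\<close> fixes the functionals that vanish on \<open>J\<close>, \<open>\<pi> + \<rho>\<close> is the identity.\<close>

theorem M_ideal_criterion:
  fixes U :: "'i filter" and A B :: "'i \<Rightarrow> 'v \<Rightarrow> 'v"
  assumes J: "closed_subspace_of s X N J" and U: "ultrafilter U"
    and A_add: "\<And>i x y. x \<in> X \<Longrightarrow> y \<in> X \<Longrightarrow> A i (x + y) = A i x + A i y"
    and A_scale: "\<And>i c x. x \<in> X \<Longrightarrow> A i (s c x) = s c (A i x)"
    and B_add: "\<And>i x y. x \<in> X \<Longrightarrow> y \<in> X \<Longrightarrow> B i (x + y) = B i x + B i y"
    and B_scale: "\<And>i c x. x \<in> X \<Longrightarrow> B i (s c x) = s c (B i x)"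
    and ev: "eventually (\<lambda>i. \<forall>x\<in>X. A i x \<in> J \<and> B i x \<in> X \<and> x - B i x \<in> J) U"
    and A_lim: "\<And>x. x \<in> J \<Longrightarrow> ((\<lambda>i. N (x - A i x)) \<longlongrightarrow> 0) U"
    and B_lim: "\<And>x. x \<in> J \<Longrightarrow> ((\<lambda>i. N (B i x)) \<longlongrightarrow> 0) U"
    and mixed: "\<And>x y e. x \<in> X \<Longrightarrow> y \<in> X \<Longrightarrow> N x \<le> 1 \<Longrightarrow> N y \<le> 1 \<Longrightarrow> e > 0 \<Longrightarrow>
      eventually (\<lambda>b. eventually (\<lambda>a. N (A b x + B a y) \<le> 1 + e) U) U"
  shows "M_ideal s X N J"
proof -
  have JX: "J \<subseteq> X" using J by (simp add: closed_subspace_of_def)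
  have U_bot: "U \<noteq> bot" using U by (simp add: ultrafilter_def)
  have A_X: "eventually (\<lambda>i. A i x \<in> X) U" if "x \<in> X" for x
    using ev by eventually_elim (use that JX in auto)
  have B_X: "eventually (\<lambda>i. B i x \<in> X) U" if "x \<in> X" for x
    using ev by eventually_elim (use that in auto)
  have A0: "A i 0 = 0" for i using A_scale[of 0 i 0] by simp
  have B0: "B i 0 = 0" for i using B_scale[of 0 i 0] by simp
  \<comment> \<open>With \<open>y = 0\<close> the inner statement does not depend on
    \<open>a\<close>, so the mixed estimate bounds \<open>A\<close> alone; \<open>x = 0\<close>
    bounds \<open>B\<close> in the same way.\<close>
  have A_bound: "eventually (\<lambda>i. N (A i x) \<le> 2) U" if "x \<in> X" "N x \<le> 1" for x
    using mixed[OF that(1) X_closed(1) that(2), of 1] U_bot by (simp add: B0)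
  have B_bound: "eventually (\<lambda>i. N (B i x) \<le> 2) U" if "x \<in> X" "N x \<le> 1" for x
    using mixed[OF X_closed(1) that(1) _ that(2), of 1] U_bot by (simp add: A0)
  interpret A: limit_family s X N U A by unfold_locales (fact U A_add A_scale A_X A_bound)+
  interpret B: limit_family s X N U B by unfold_locales (fact U B_add B_scale B_X B_bound)+
  define \<pi> \<rho> where "\<pi> = A.L" and "\<rho> = B.L"
  note \<pi> = A.lim[folded \<pi>_def] and \<pi>_eq = A.L_eq[folded \<pi>_def]
    and \<pi>_dual = A.L_dual[folded \<pi>_def] and \<pi>_add = A.L_add[folded \<pi>_def]
    and \<pi>_scale = A.L_scale[folded \<pi>_def] and \<pi>_diff = A.L_diff[folded \<pi>_def]
  note \<rho> = B.lim[folded \<rho>_def] and \<rho>_eq = B.L_eq[folded \<rho>_def]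
    and \<rho>_dual = B.L_dual[folded \<rho>_def] and \<rho>_diff = B.L_diff[folded \<rho>_def]
  have sum_bound: "norm (\<pi> \<phi> x + \<rho> \<phi> y) \<le> dn \<phi>"
    if \<phi>: "\<phi> \<in> dual" and x: "x \<in> X" "N x \<le> 1" and y: "y \<in> X" "N y \<le> 1" for \<phi> x y
  proof (rule field_le_epsilon)
    fix e :: real assume e: "e > 0"
    define d where "d = e / (dn \<phi> + 1)"
    have d: "d > 0" using e dn_nonneg[OF \<phi>] by (simp add: d_def)
    \<comment> \<open>The limit over \<open>a\<close> is taken for fixed \<open>b\<close> and turns
      \<open>\<phi> (B a y)\<close> into \<open>\<rho> \<phi> y\<close>; only then does the limit
      over \<open>b\<close> produce \<open>\<pi> \<phi> x\<close>.\<close>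
    have "eventually (\<lambda>b. norm (\<phi> (A b x) + \<rho> \<phi> y) \<le> dn \<phi> * (1 + d)) U"
      using mixed[OF x(1) y(1) x(2) y(2) d] A_X[OF x(1)]
    proof eventually_elim
      case (elim b)
      have "eventually (\<lambda>a. norm (\<phi> (A b x) + \<phi> (B a y)) \<le> dn \<phi> * (1 + d)) U"
        using elim(1) B_X[OF y(1)]
      proof eventually_elim
        case (elim a)
        have "norm (\<phi> (A b x + B a y)) \<le> dn \<phi> * N (A b x + B a y)"
          using \<open>A b x \<in> X\<close> elim(2) by (intro dn_bound \<phi>) simp
        also have "\<dots> \<le> dn \<phi> * (1 + d)"
          using elim(1) by (intro mult_left_mono dn_nonneg \<phi>)
        finally show ?case using \<open>A b x \<in> X\<close> elim(2) by (simp add: dual_add \<phi>)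
      qed
      then show ?case
        by (rule tendsto_upperbound[OF tendsto_norm[OF tendsto_add[OF tendsto_const \<rho>[OF \<phi> y(1)]]] _ U_bot])
    qed
    then have "norm (\<pi> \<phi> x + \<rho> \<phi> y) \<le> dn \<phi> * (1 + d)"
      by (rule tendsto_upperbound[OF tendsto_norm[OF tendsto_add[OF \<pi>[OF \<phi> x(1)] tendsto_const]] _ U_bot])
    also have "dn \<phi> * d \<le> e"
      using e dn_nonneg[OF \<phi>] by (simp add: d_def field_simps)
    then have "dn \<phi> * (1 + d) \<le> dn \<phi> + e" by (simp add: algebra_simps)
    finally show "norm (\<pi> \<phi> x + \<rho> \<phi> y) \<le> dn \<phi> + e" .
  qed
  have dn_sum: "dn (\<pi> \<phi>) + dn (\<rho> \<phi>) \<le> dn \<phi>" if "\<phi> \<in> dual" for \<phi>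
    using that by (intro dn_sum_le \<pi>_dual \<rho>_dual sum_bound)
  have small: "((\<lambda>i. \<phi> (D i)) \<longlongrightarrow> 0) U"
    if \<phi>: "\<phi> \<in> dual" and "eventually (\<lambda>i. D i \<in> X) U" "((\<lambda>i. N (D i)) \<longlongrightarrow> 0) U" for \<phi> D
  proof (rule Lim_null_comparison)
    show "eventually (\<lambda>i. norm (\<phi> (D i)) \<le> dn \<phi> * N (D i)) U"
      using that(2) by eventually_elim (rule dn_bound[OF \<phi>])
    show "((\<lambda>i. dn \<phi> * N (D i)) \<longlongrightarrow> 0) U"
      using tendsto_mult_left[OF that(3)] by simp
  qed
  have \<pi>_J: "\<pi> \<phi> x = \<phi> x" if \<phi>: "\<phi> \<in> dual" and x: "x \<in> J" for \<phi> x
  proof -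
    have xX: "x \<in> X" using x JX by blast
    have D: "eventually (\<lambda>i. x - A i x \<in> X) U"
      using A_X[OF xX] by eventually_elim (simp add: xX)
    have "eventually (\<lambda>i. \<phi> x - \<phi> (x - A i x) = \<phi> (A i x)) U"
      using A_X[OF xX] by eventually_elim (simp add: xX dual_diff[OF \<phi>])
    moreover have "((\<lambda>i. \<phi> x - \<phi> (x - A i x)) \<longlongrightarrow> \<phi> x - 0) U"
      by (intro tendsto_diff tendsto_const small \<phi> D A_lim x)
    ultimately have "((\<lambda>i. \<phi> (A i x)) \<longlongrightarrow> \<phi> x - 0) U"
      by (rule Lim_transform_eventually[rotated])
    then show ?thesis using \<pi>_eq[OF \<phi> xX] by simp
  qed
  have \<pi>_ann: "\<pi> \<phi> = 0" and \<rho>_ann: "\<rho> \<phi> = \<phi>" if \<phi>: "\<phi> \<in> dual" and ann: "\<And>x. x \<in> J \<Longrightarrow> \<phi> x = 0" for \<phi>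
  proof -
    have "\<pi> \<phi> x = 0" if x: "x \<in> X" for x
    proof (rule \<pi>_eq[OF \<phi> x])
      have "eventually (\<lambda>i. 0 = \<phi> (A i x)) U"
        using ev by eventually_elim (use x ann in auto)
      then show "((\<lambda>i. \<phi> (A i x)) \<longlongrightarrow> 0) U" by (rule Lim_transform_eventually[OF tendsto_const])
    qed
    then show "\<pi> \<phi> = 0" using \<phi> by (intro dual_ext \<pi>_dual) auto
    have "\<rho> \<phi> x = \<phi> x" if x: "x \<in> X" for x
    proof (rule \<rho>_eq[OF \<phi> x])
      have "eventually (\<lambda>i. \<phi> x = \<phi> (B i x)) U"
        using ev
      proof eventually_elim
        case (elim i)
        then have "B i x \<in> X" "\<phi> (x - B i x) = 0" using ann x by auto
        then show ?case using dual_diff[OF \<phi> x] by simp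
      qed
      then show "((\<lambda>i. \<phi> (B i x)) \<longlongrightarrow> \<phi> x) U" by (rule Lim_transform_eventually[OF tendsto_const])
    qed
    then show "\<rho> \<phi> = \<phi>" using \<phi> by (intro dual_ext \<rho>_dual) auto
  qed
  have idem: "\<pi> (\<pi> \<phi>) = \<pi> \<phi>" and \<rho>_compl: "\<rho> \<phi> = \<phi> - \<pi> \<phi>" if \<phi>: "\<phi> \<in> dual" for \<phi>
  proof -
    have d: "\<phi> - \<pi> \<phi> \<in> dual" using \<phi> \<pi>_dual by simp
    have ann: "\<And>x. x \<in> J \<Longrightarrow> (\<phi> - \<pi> \<phi>) x = 0" using \<pi>_J[OF \<phi>] by simp
    have fixed: "\<pi> (\<phi> - \<pi> \<phi>) = 0" "\<rho> (\<phi> - \<pi> \<phi>) = \<phi> - \<pi> \<phi>"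
      by (rule \<pi>_ann[OF d], erule ann) (rule \<rho>_ann[OF d], erule ann)
    show idem: "\<pi> (\<pi> \<phi>) = \<pi> \<phi>"
      using fixed(1) \<pi>_diff[OF \<phi> \<pi>_dual[OF \<phi>]] by (metis right_minus_eq)
    have "dn (\<rho> (\<pi> \<phi>)) \<le> 0"
      using dn_sum[OF \<pi>_dual[OF \<phi>]] unfolding idem by simp
    then have "\<rho> (\<pi> \<phi>) = 0" by (intro dn_eq_0D \<rho>_dual \<pi>_dual \<phi>)
    moreover have "\<rho> (\<phi> - \<pi> \<phi>) = \<rho> \<phi> - \<rho> (\<pi> \<phi>)" by (intro \<rho>_diff \<pi>_dual \<phi>)
    ultimately show "\<rho> \<phi> = \<phi> - \<pi> \<phi>" using fixed(2) by (metis diff_zero)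
  qed
  have norm_eq: "dn \<phi> = dn (\<pi> \<phi>) + dn (\<phi> - \<pi> \<phi>)" if \<phi>: "\<phi> \<in> dual" for \<phi>
  proof (rule antisym)
    show "dn (\<pi> \<phi>) + dn (\<phi> - \<pi> \<phi>) \<le> dn \<phi>" using dn_sum[OF \<phi>] \<rho>_compl[OF \<phi>] by simp
    show "dn \<phi> \<le> dn (\<pi> \<phi>) + dn (\<phi> - \<pi> \<phi>)"
      using dn_add_le[of "\<pi> \<phi>" "\<phi> - \<pi> \<phi>"] \<phi> \<pi>_dual by simp
  qed
  have ker: "{\<phi>\<in>dual. \<pi> \<phi> = 0} = annihilator s X N J"
  proof (intro equalityI subsetI)
    fix \<phi> assume \<phi>: "\<phi> \<in> {\<phi>\<in>dual. \<pi> \<phi> = 0}"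
    then have "\<phi> x = 0" if "x \<in> J" for x using \<pi>_J[of \<phi> x] that by simp
    with \<phi> show "\<phi> \<in> annihilator s X N J" by (simp add: annihilator_def)
  qed (auto simp: annihilator_def intro!: \<pi>_ann)
  show ?thesis
    unfolding M_ideal_def
    by (intro conjI ballI allI exI[of _ \<pi>] J ker \<pi>_dual \<pi>_add \<pi>_scale idem norm_eq)
qed

end


section \<open>Approximating an element from an M-ideal\<close>

lemma sum_fun_apply: "(\<Sum>i\<in>I. f i) x = (\<Sum>i\<in>I. f i x)"
  by (induction I rule: infinite_finite_induct) auto

locale M_projection = normed_carrier s X N
  for s :: "'k::real_or_complex \<Rightarrow> 'v::ab_group_add \<Rightarrow> 'v" and X N +
  fixes J :: "'v set" and \<pi> :: "('v \<Rightarrow> 'k) \<Rightarrow> 'v \<Rightarrow> 'k"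
  assumes J: "J \<subseteq> X" "subspace J"
    and \<pi>_dual: "\<phi> \<in> dual \<Longrightarrow> \<pi> \<phi> \<in> dual"
    and \<pi>_add: "\<phi> \<in> dual \<Longrightarrow> \<psi> \<in> dual \<Longrightarrow> \<pi> (\<phi> + \<psi>) = \<pi> \<phi> + \<pi> \<psi>"
    and \<pi>_ann: "\<phi> \<in> dual \<Longrightarrow> (\<And>x. x \<in> J \<Longrightarrow> \<phi> x = 0) \<Longrightarrow> \<pi> \<phi> = 0"
    and \<pi>_J: "\<phi> \<in> dual \<Longrightarrow> x \<in> J \<Longrightarrow> \<pi> \<phi> x = \<phi> x"
    and \<pi>_norm: "\<phi> \<in> dual \<Longrightarrow> dn \<phi> = dn (\<pi> \<phi>) + dn (\<phi> - \<pi> \<phi>)"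

text \<open>Idempotence puts \<open>\<phi> - \<pi> \<phi>\<close> into the kernel, that is, into the
  annihilator of \<open>J\<close>; so \<open>\<pi> \<phi>\<close> and \<open>\<phi>\<close> agree on
  \<open>J\<close>.\<close>

lemma (in normed_carrier) M_projection_of_M_ideal:
  assumes "M_ideal s X N J"
  obtains \<pi> where "M_projection s X N J \<pi>"
proof -
  obtain \<pi> where \<pi>: "\<And>\<phi>. \<phi> \<in> dual \<Longrightarrow> \<pi> \<phi> \<in> dual"
    "\<And>\<phi> \<psi>. \<phi> \<in> dual \<Longrightarrow> \<psi> \<in> dual \<Longrightarrow> \<pi> (\<phi> + \<psi>) = \<pi> \<phi> + \<pi> \<psi>"
    "\<And>c \<phi>. \<phi> \<in> dual \<Longrightarrow> \<pi> (fun_scale (*) c \<phi>) = fun_scale (*) c (\<pi> \<phi>)"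
    "\<And>\<phi>. \<phi> \<in> dual \<Longrightarrow> \<pi> (\<pi> \<phi>) = \<pi> \<phi>"
    "{\<phi>\<in>dual. \<pi> \<phi> = 0} = annihilator s X N J"
    "\<And>\<phi>. \<phi> \<in> dual \<Longrightarrow> dn \<phi> = dn (\<pi> \<phi>) + dn (\<phi> - \<pi> \<phi>)"
    using assms unfolding M_ideal_def by blast
  have "\<pi> (\<phi> - \<pi> \<phi>) = 0" if "\<phi> \<in> dual" for \<phi>
    using \<pi>(2)[of \<phi> "- \<pi> \<phi>"] \<pi>(3)[of "\<pi> \<phi>" "- 1"] \<pi>(1,4) that by (simp add: dual_uminus[symmetric])
  then have ann: "\<phi> - \<pi> \<phi> \<in> annihilator s X N J" if "\<phi> \<in> dual" for \<phi>
    using that \<pi>(1) unfolding \<pi>(5)[symmetric] by simp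
  show ?thesis
  proof (rule that, unfold_locales)
    show "J \<subseteq> X" "subspace J" using assms by (auto simp: M_ideal_def closed_subspace_of_def)
    show "\<pi> \<phi> = 0" if "\<phi> \<in> dual" "\<And>x. x \<in> J \<Longrightarrow> \<phi> x = 0" for \<phi>
    proof -
      have "\<phi> \<in> {\<phi>\<in>dual. \<pi> \<phi> = 0}" unfolding \<pi>(5) annihilator_def using that by blast
      then show ?thesis by simp
    qed
    show "\<pi> \<phi> x = \<phi> x" if "\<phi> \<in> dual" "x \<in> J" for \<phi> x
      using ann[OF that(1)] that(2) by (simp add: annihilator_def)
  qed (fact \<pi>)+
qed

section \<open>Norm constraints that elements of an M-ideal satisfy simultaneously\<close>

context M_projection
begin

definition pull :: "('v \<Rightarrow> 'k) \<Rightarrow> ('v \<Rightarrow> 'v) \<Rightarrow> 'v \<Rightarrow> 'k" where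
  "pull \<phi> \<Phi> = (\<lambda>x. if x \<in> X then \<phi> (\<Phi> x) else 0)"

definition bounded_map :: "('v \<Rightarrow> 'v) \<Rightarrow> bool" where
  "bounded_map \<Phi> \<longleftrightarrow> (\<forall>x\<in>X. \<Phi> x \<in> X) \<and> (\<forall>x\<in>X. \<forall>y\<in>X. \<Phi> (x + y) = \<Phi> x + \<Phi> y) \<and>
    (\<forall>c. \<forall>x\<in>X. \<Phi> (s c x) = s c (\<Phi> x)) \<and> (\<exists>C. \<forall>x\<in>X. N (\<Phi> x) \<le> C * N x)"

lemma pull_dual:
  assumes \<phi>: "\<phi> \<in> dual" and \<Phi>: "bounded_map \<Phi>"
  shows "pull \<phi> \<Phi> \<in> dual"
proof -
  obtain C where C: "\<And>x. x \<in> X \<Longrightarrow> N (\<Phi> x) \<le> C * N x"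
    using \<Phi> unfolding bounded_map_def by blast
  show ?thesis
  proof (rule dualI)
    fix x assume x: "x \<in> X"
    have "norm (\<phi> (\<Phi> x)) \<le> dn \<phi> * N (\<Phi> x)"
      using \<Phi> x by (intro dn_bound \<phi>) (auto simp: bounded_map_def)
    also have "\<dots> \<le> dn \<phi> * (C * N x)" using C[OF x] by (intro mult_left_mono dn_nonneg \<phi>)
    finally show "norm (pull \<phi> \<Phi> x) \<le> (dn \<phi> * C) * N x" using x by (simp add: pull_def mult.assoc)
  qed (use \<phi> \<Phi> in \<open>auto simp: pull_def bounded_map_def dual_add dual_scale\<close>)
qed

lemma \<pi>_sum:
  assumes "\<And>i. i \<in> I \<Longrightarrow> \<phi> i \<in> dual"
  shows "sum \<phi> I \<in> dual" "\<pi> (sum \<phi> I) = (\<Sum>i\<in>I. \<pi> (\<phi> i))"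
proof -
  have "sum \<phi> I \<in> dual \<and> \<pi> (sum \<phi> I) = (\<Sum>i\<in>I. \<pi> (\<phi> i))"
    using assms
  proof (induction I rule: infinite_finite_induct)
    case (insert i I)
    then have "\<phi> i \<in> dual" "sum \<phi> I \<in> dual" "\<pi> (sum \<phi> I) = (\<Sum>i\<in>I. \<pi> (\<phi> i))" by blast+
    with insert.hyps show ?case by (metis sum.insert \<pi>_add dual_plus)
  qed (auto simp: \<pi>_ann[of 0])
  then show "sum \<phi> I \<in> dual" "\<pi> (sum \<phi> I) = (\<Sum>i\<in>I. \<pi> (\<phi> i))" by auto
qed

text \<open>If no \<open>K\<close> satisfies the constraints, Hahn--Banach in the \<open>\<ell>\<^sup>\<infinity>\<close>-sum of copies of \<open>X\<close> separates
  the family \<open>a\<close> from the subspace of the families \<open>\<Phi>\<^sub>i K\<close> by functionals \<open>\<phi>\<^sub>i\<close> with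
  \<open>\<Sum> r\<^sub>i \<parallel>\<phi>\<^sub>i\<parallel> \<le> 1\<close>, \<open>\<Sum> \<phi>\<^sub>i \<circ> \<Phi>\<^sub>i = 0\<close> on \<open>J\<close> and \<open>1 \<le> Re (\<Sum> \<phi>\<^sub>i a\<^sub>i)\<close>. Subtracting
  \<open>0 = \<Sum> \<pi> (\<phi>\<^sub>i \<circ> \<Phi>\<^sub>i) v\<close> bounds the last sum by \<open>\<Sum> \<rho>\<^sub>i \<parallel>\<phi>\<^sub>i\<parallel>\<close>, which is smaller than \<open>1\<close>.\<close>

lemma finite_constraints:
  fixes a :: "'i \<Rightarrow> 'v" and r \<rho> :: "'i \<Rightarrow> real"
  assumes I: "finite I" and v: "v \<in> X"
    and a: "\<And>i. i \<in> I \<Longrightarrow> a i \<in> X" and \<Phi>: "\<And>i. i \<in> I \<Longrightarrow> bounded_map (\<Phi> i)"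
    and \<rho>: "\<And>i. i \<in> I \<Longrightarrow> 0 \<le> \<rho> i" "\<And>i. i \<in> I \<Longrightarrow> \<rho> i < r i"
    and le: "\<And>i \<phi>. i \<in> I \<Longrightarrow> \<phi> \<in> dual \<Longrightarrow> norm (\<phi> (a i) - \<pi> (pull \<phi> (\<Phi> i)) v) \<le> \<rho> i * dn \<phi>"
  shows "\<exists>K\<in>J. \<forall>i\<in>I. N (a i - \<Phi> i K) \<le> r i"
proof (cases "I = {}")
  case True
  then show ?thesis using subspace_0[OF J(2)] by blast
next
  case I_ne: False
  have r: "r i > 0" if "i \<in> I" for i using \<rho>[OF that] by simp
  show ?thesis
  proof (rule ccontr)
    assume contra: "\<not> ?thesis"
    let ?s = "\<lambda>r. s (of_real r)"
    interpret R: module ?s by (rule module_real_scale) unfold_locales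
    define S :: "real \<Rightarrow> ('i \<Rightarrow> 'v) \<Rightarrow> 'i \<Rightarrow> 'v" where "S = fun_scale ?s"
    have S: "S c T i = s (of_real c) (T i)" for c T i by (simp add: S_def fun_scale_def)
    interpret P: module S unfolding S_def by (rule module_fun_scale) unfold_locales
    define XX :: "('i \<Rightarrow> 'v) set" where "XX = {T. \<forall>i. T i \<in> X}"
    have XX: "P.subspace XX" by (rule P.subspaceI) (auto simp: XX_def S)
    interpret P: real_carrier S XX by unfold_locales (rule XX)
    \<comment> \<open>The radii become weights, so that all constraints together say that
      \<open>p\<close> is at most 1 at a single family.\<close>
    define p where "p T = Max ((\<lambda>i. N (T i) / r i) ` I)" for T
    have p_le: "p T \<le> c" if "\<And>i. i \<in> I \<Longrightarrow> N (T i) / r i \<le> c" for T c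
      unfolding p_def using that I I_ne by auto
    have p_ge: "N (T i) / r i \<le> p T" if "i \<in> I" for T i
      unfolding p_def using that I by auto
    have p_nonneg: "0 \<le> p T" if "T \<in> XX" for T
    proof -
      obtain i where i: "i \<in> I" using I_ne by blast
      have "0 \<le> N (T i) / r i" using that r[OF i] N_nonneg by (auto simp: XX_def)
      then show ?thesis using p_ge[OF i, of T] by simp
    qed
    have p_sub: "sublinear_on S XX p"
      unfolding sublinear_on_def
    proof (intro conjI ballI allI impI)
      fix T T' assume T: "T \<in> XX" "T' \<in> XX"
      show "p (T + T') \<le> p T + p T'"
      proof (rule p_le)
        fix i assume i: "i \<in> I"
        have "N ((T + T') i) / r i \<le> (N (T i) + N (T' i)) / r i"
          using N_triangle[of "T i" "T' i"] T r[OF i] by (intro divide_right_mono) (auto simp: XX_def)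
        also have "\<dots> \<le> p T + p T'" using p_ge[OF i, of T] p_ge[OF i, of T'] by (simp add: add_divide_distrib)
        finally show "N ((T + T') i) / r i \<le> p T + p T'" .
      qed
    next
      fix c :: real and T assume c: "0 \<le> c" and T: "T \<in> XX"
      have "(\<lambda>i. N (S c T i) / r i) ` I = (\<lambda>x. c * x) ` (\<lambda>i. N (T i) / r i) ` I"
        using T c by (auto simp: S N_scale XX_def image_image)
      then show "p (S c T) = c * p T"
        unfolding p_def using mono_Max_commute[of "\<lambda>x. c * x" "(\<lambda>i. N (T i) / r i) ` I"] I I_ne c
        by (simp add: mono_def mult_left_mono)
    qed
    \<comment> \<open>Members of \<open>XX\<close> are families over the whole index type. Clearing
      the entries off \<open>I\<close> makes a family the finite sum of its single
      components.\<close>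
    define restr :: "('i \<Rightarrow> 'v) \<Rightarrow> 'i \<Rightarrow> 'v" where "restr T i = (if i \<in> I then T i else 0)" for T i
    define W where "W = (\<lambda>K. restr (\<lambda>i. \<Phi> i K)) ` J"
    have \<Phi>_X: "\<Phi> i x \<in> X" if "i \<in> I" "x \<in> X" for i x
      using \<Phi>[OF that(1)] that(2) by (auto simp: bounded_map_def)
    have \<Phi>': "\<Phi> i (x + y) = \<Phi> i x + \<Phi> i y" "\<Phi> i (s c x) = s c (\<Phi> i x)"
      if "i \<in> I" "x \<in> X" "y \<in> X" for i x y c
      using \<Phi>[OF that(1)] that(2,3) by (auto simp: bounded_map_def)
    have JX: "K \<in> X" if "K \<in> J" for K using that J by blast
    have \<Phi>0: "\<Phi> i 0 = 0" if "i \<in> I" for i using \<Phi>'(2)[OF that, of 0 0 0] by simp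
    have W_XX: "W \<subseteq> XX" using \<Phi>_X JX by (auto simp: W_def XX_def restr_def)
    have W: "P.subspace W"
    proof (rule P.subspaceI)
      show "0 \<in> W"
        unfolding W_def using subspace_0[OF J(2)] \<Phi>0
        by (intro image_eqI[of _ _ 0]) (auto simp: restr_def fun_eq_iff)
    next
      fix T T' assume "T \<in> W" "T' \<in> W"
      then obtain K K' where "K \<in> J" "K' \<in> J" "T = restr (\<lambda>i. \<Phi> i K)" "T' = restr (\<lambda>i. \<Phi> i K')"
        unfolding W_def by blast
      then show "T + T' \<in> W"
        unfolding W_def using subspace_add[OF J(2)] \<Phi>'(1) JX
        by (intro image_eqI[of _ _ "K + K'"]) (auto simp: restr_def fun_eq_iff)
    next
      fix T c assume "T \<in> W"
      then obtain K where "K \<in> J" "T = restr (\<lambda>i. \<Phi> i K)"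
        unfolding W_def by blast
      then show "S c T \<in> W"
        unfolding W_def using subspace_scale[OF J(2)] \<Phi>'(2)[OF _ JX JX]
        by (intro image_eqI[of _ _ "s (of_real c) K"]) (auto simp: restr_def fun_eq_iff S)
    qed
    have aX: "restr a \<in> XX" using a by (auto simp: XX_def restr_def)
    have "1 \<le> p (restr a + w)" if w: "w \<in> W" for w
    proof -
      obtain K where K: "K \<in> J" "w = restr (\<lambda>i. \<Phi> i K)" using w unfolding W_def by blast
      \<comment> \<open>The separation theorem adds elements of \<open>W\<close>, whereas the
        constraints subtract \<open>\<Phi> i K\<close>.\<close>
      have mK: "- K \<in> J" using subspace_neg[OF J(2) K(1)] .
      then obtain i where i: "i \<in> I" "r i < N (a i - \<Phi> i (- K))"
        using contra by (metis not_le)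
      have "\<Phi> i (- K) = - \<Phi> i K"
        using \<Phi>'(2)[OF i(1) JX[OF K(1)] JX[OF K(1)], of "- 1"] by simp
      then have "1 < N ((restr a + w) i) / r i"
        using i r[OF i(1)] K(2) by (simp add: restr_def)
      then show ?thesis using p_ge[OF i(1), of "restr a + w"] by simp
    qed
    from P.hahn_banach_separation[OF p_sub p_nonneg W W_XX aX this]
    obtain f where f: "linear_on S XX f" "\<And>T. T \<in> XX \<Longrightarrow> f T \<le> p T" "\<And>w. w \<in> W \<Longrightarrow> f w = 0"
      "1 \<le> f (restr a)" by blast
    define single :: "'i \<Rightarrow> 'v \<Rightarrow> 'i \<Rightarrow> 'v" where "single i x j = (if j = i then x else 0)" for i x j
    have single_XX: "single i x \<in> XX" if "x \<in> X" for i x using that by (auto simp: single_def XX_def)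
    have f_add: "f (T + T') = f T + f T'" if "T \<in> XX" "T' \<in> XX" for T T'
      using f(1) that by (auto simp: linear_on_def)
    have f_scale: "f (S c T) = c * f T" if "T \<in> XX" for T c
      using f(1) that by (auto simp: linear_on_def)
    have "\<exists>\<phi>. \<phi> \<in> dual \<and> (\<forall>x\<in>X. scalar_Re (\<phi> x) = f (single i x))" if i: "i \<in> I" for i
    proof -
      have "\<exists>\<phi>. (\<forall>x\<in>X. \<forall>y\<in>X. \<phi> (x + y) = \<phi> x + \<phi> y) \<and> (\<forall>c. \<forall>x\<in>X. \<phi> (s c x) = c * \<phi> x) \<and>
        (\<forall>x\<in>X. norm (\<phi> x) \<le> N x / r i) \<and> (\<forall>x\<in>X. scalar_Re (\<phi> x) = f (single i x))"
      proof (rule scalar_functional_of_real_part)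
        show "module s" by unfold_locales
        show "module.subspace s X" by (rule X)
        show "linear_on ?s X (\<lambda>x. f (single i x))"
          unfolding linear_on_def
        proof (intro conjI ballI allI)
          fix x y assume xy: "x \<in> X" "y \<in> X"
          have "single i (x + y) = single i x + single i y" by (auto simp: single_def fun_eq_iff)
          then show "f (single i (x + y)) = f (single i x) + f (single i y)"
            using f_add single_XX xy by simp
        next
          fix c x assume x: "x \<in> X"
          have "single i (s (of_real c) x) = S c (single i x)" by (auto simp: single_def S fun_eq_iff)
          then show "f (single i (s (of_real c) x)) = c * f (single i x)"
            using f_scale single_XX x by simp
        qed
        fix x assume x: "x \<in> X"
        have "p (single i x) \<le> N x / r i"
          using r[OF i] N_nonneg[OF x] by (intro p_le) (auto simp: single_def)
        then show "f (single i x) \<le> N x / r i" using f(2)[OF single_XX[OF x], of i] by simp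
        show "N (s c x) / r i = N x / r i" if "norm c = 1" for c
          using that x by (simp add: N_scale)
      qed
      then obtain \<phi> where \<phi>: "\<forall>x\<in>X. \<forall>y\<in>X. \<phi> (x + y) = \<phi> x + \<phi> y" "\<forall>c. \<forall>x\<in>X. \<phi> (s c x) = c * \<phi> x"
        "\<forall>x\<in>X. norm (\<phi> x) \<le> N x / r i" "\<forall>x\<in>X. scalar_Re (\<phi> x) = f (single i x)" by blast
      have "(\<lambda>x. if x \<in> X then \<phi> x else 0) \<in> dual"
        by (rule dualI[where C="1 / r i"]) (use \<phi> in auto)
      then show ?thesis using \<phi>(4) by (intro exI[of _ "\<lambda>x. if x \<in> X then \<phi> x else 0"]) auto
    qed
    then obtain \<phi> where \<phi>: "\<And>i. i \<in> I \<Longrightarrow> \<phi> i \<in> dual"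
      "\<And>i x. i \<in> I \<Longrightarrow> x \<in> X \<Longrightarrow> scalar_Re (\<phi> i x) = f (single i x)"
      by metis
    have f0: "f 0 = 0" using f_scale[of 0 0] P.subspace_0[OF XX] by simp
    have f_sum: "f (restr T) = (\<Sum>i\<in>I. scalar_Re (\<phi> i (T i)))" if T: "\<And>i. i \<in> I \<Longrightarrow> T i \<in> X" for T
    proof -
      have *: "f (\<Sum>i\<in>I'. single i (T i)) = (\<Sum>i\<in>I'. f (single i (T i))) \<and> (\<Sum>i\<in>I'. single i (T i)) \<in> XX"
        if "I' \<subseteq> I" for I'
        using finite_subset[OF that I] that
      proof (induction I')
        case empty
        show ?case using f0 P.subspace_0[OF XX] by (simp only: sum.empty simp_thms)
      next
        case (insert j I')
        then have "single j (T j) \<in> XX" "(\<Sum>i\<in>I'. single i (T i)) \<in> XX"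
          using T by (auto intro: single_XX)
        then show ?case
          using insert f_add P.subspace_add[OF XX] by (simp only: sum.insert simp_thms insert_subset)
      qed
      have "restr T = (\<Sum>i\<in>I. single i (T i))"
        using I by (auto simp: fun_eq_iff sum_fun_apply restr_def single_def)
      then show ?thesis using * \<phi>(2) T by simp
    qed
    \<comment> \<open>The dual of a weighted sup norm is the weighted sum of the dual norms. The
      test family has components \<open>r i\<close> times a vector that nearly norms
      \<open>\<phi> i\<close>, hence gauge at most 1; the total defect is \<open>e\<close>.\<close>
    have "(\<Sum>i\<in>I. r i * dn (\<phi> i)) \<le> 1"
    proof (rule field_le_epsilon)
      fix e :: real assume e: "e > 0"
      have sum_r: "sum r I > 0" using I I_ne r by (intro sum_pos) auto
      then have "e / sum r I > 0" using e by simp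
      then have "\<exists>x. x \<in> X \<and> N x \<le> 1 \<and> \<phi> i x = of_real (norm (\<phi> i x)) \<and> dn (\<phi> i) - e / sum r I < norm (\<phi> i x)"
        if "i \<in> I" for i
        using dn_approx[OF \<phi>(1)[OF that]] by metis
      then obtain x where x: "\<And>i. i \<in> I \<Longrightarrow> x i \<in> X" "\<And>i. i \<in> I \<Longrightarrow> N (x i) \<le> 1"
        "\<And>i. i \<in> I \<Longrightarrow> \<phi> i (x i) = of_real (norm (\<phi> i (x i)))"
        "\<And>i. i \<in> I \<Longrightarrow> dn (\<phi> i) - e / sum r I < norm (\<phi> i (x i))" by metis
      define T where "T i = s (of_real (r i)) (x i)" for i
      have TX: "T i \<in> X" if "i \<in> I" for i using x that by (simp add: T_def)
      have "(\<Sum>i\<in>I. r i * norm (\<phi> i (x i))) = (\<Sum>i\<in>I. scalar_Re (\<phi> i (T i)))"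
      proof (rule sum.cong)
        fix i assume i: "i \<in> I"
        have "\<phi> i (T i) = of_real (r i * norm (\<phi> i (x i)))"
          using dual_scale[OF \<phi>(1)[OF i] x(1)[OF i]] x(3)[OF i] by (simp add: T_def)
        then show "r i * norm (\<phi> i (x i)) = scalar_Re (\<phi> i (T i))"
          by (simp only: scalar_Re_of_real)
      qed simp
      also have "\<dots> = f (restr T)" using f_sum TX by simp
      also have "\<dots> \<le> p (restr T)" using TX by (intro f(2)) (auto simp: XX_def restr_def)
      also have "\<dots> \<le> 1"
      proof (rule p_le)
        fix i assume i: "i \<in> I"
        have "N (restr T i) = r i * N (x i)"
          using i x(1)[OF i] r[OF i] by (simp add: restr_def T_def N_scale)
        then show "N (restr T i) / r i \<le> 1" using x(2)[OF i] r[OF i] by simp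
      qed
      finally have 1: "(\<Sum>i\<in>I. r i * norm (\<phi> i (x i))) \<le> 1" .
      have "(\<Sum>i\<in>I. r i * dn (\<phi> i)) \<le> (\<Sum>i\<in>I. r i * norm (\<phi> i (x i)) + r i * (e / sum r I))"
      proof (rule sum_mono)
        fix i assume i: "i \<in> I"
        show "r i * dn (\<phi> i) \<le> r i * norm (\<phi> i (x i)) + r i * (e / sum r I)"
          using x(4)[OF i] r[OF i] unfolding distrib_left[symmetric] by (intro mult_left_mono) auto
      qed
      also have "\<dots> = (\<Sum>i\<in>I. r i * norm (\<phi> i (x i))) + sum r I * (e / sum r I)"
        by (simp only: sum.distrib sum_distrib_right)
      also have "\<dots> = (\<Sum>i\<in>I. r i * norm (\<phi> i (x i))) + e"
        using sum_r by simp
      finally show "(\<Sum>i\<in>I. r i * dn (\<phi> i)) \<le> 1 + e" using 1 by simp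
    qed
    define \<psi> where "\<psi> i = pull (\<phi> i) (\<Phi> i)" for i
    have \<psi>: "\<psi> i \<in> dual" if "i \<in> I" for i unfolding \<psi>_def using that by (intro pull_dual \<phi> \<Phi>)
    have "\<pi> (sum \<psi> I) = 0"
    proof (rule \<pi>_ann)
      show sum_dual: "sum \<psi> I \<in> dual" using \<psi> by (rule \<pi>_sum)
      fix K assume K: "K \<in> J"
      \<comment> \<open>\<open>f\<close> controls real parts only. As \<open>J\<close> is closed
        under scalars, the real part also vanishes at a rotated \<open>K\<close>, where it equals
        the modulus.\<close>
      have re: "scalar_Re (sum \<psi> I K) = 0" if K: "K \<in> J" for K
      proof -
        have "scalar_Re (sum \<psi> I K) = (\<Sum>i\<in>I. scalar_Re (\<phi> i (\<Phi> i K)))"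
          using JX[OF K] by (simp add: sum_fun_apply scalar_Re_sum \<psi>_def pull_def)
        also have "\<dots> = f (restr (\<lambda>i. \<Phi> i K))" using JX[OF K] \<Phi>_X by (intro f_sum[symmetric])
        also have "\<dots> = 0" using K by (intro f(3)) (auto simp: W_def)
        finally show ?thesis .
      qed
      obtain c where c: "c * sum \<psi> I K = of_real (norm (sum \<psi> I K))" by (rule scalar_phase)
      have "scalar_Re (sum \<psi> I (s c K)) = 0" using K by (intro re subspace_scale J)
      then show "sum \<psi> I K = 0"
        using c dual_scale[OF sum_dual JX[OF K], of c] by (simp add: scalar_Re_of_real)
    qed
    then have \<psi>_0: "(\<Sum>i\<in>I. \<pi> (\<psi> i) v) = 0"
      using \<pi>_sum(2)[of I \<psi>] \<psi> by (metis sum_fun_apply zero_fun_apply)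
    have "1 \<le> (\<Sum>i\<in>I. scalar_Re (\<phi> i (a i)))" using f(4) f_sum[OF a] by simp
    also have "\<dots> = scalar_Re (\<Sum>i\<in>I. \<phi> i (a i) - \<pi> (\<psi> i) v)"
      by (simp add: sum_subtractf \<psi>_0 scalar_Re_sum)
    also have "\<dots> \<le> (\<Sum>i\<in>I. norm (\<phi> i (a i) - \<pi> (\<psi> i) v))"
      by (rule order_trans[OF scalar_Re_le_norm norm_sum])
    also have "\<dots> \<le> (\<Sum>i\<in>I. \<rho> i * dn (\<phi> i))"
      unfolding \<psi>_def by (intro sum_mono le \<phi>)
    finally have 1: "1 \<le> (\<Sum>i\<in>I. \<rho> i * dn (\<phi> i))" .
    \<comment> \<open>The slack \<open>\<rho> i < r i\<close> now forces every
      \<open>\<phi> i\<close> to have norm 0, against the lower bound 1.\<close>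
    have "(\<Sum>i\<in>I. (r i - \<rho> i) * dn (\<phi> i)) \<le> 0"
      using 1 \<open>(\<Sum>i\<in>I. r i * dn (\<phi> i)) \<le> 1\<close> by (simp add: left_diff_distrib sum_subtractf)
    moreover have terms: "(r i - \<rho> i) * dn (\<phi> i) \<ge> 0" if "i \<in> I" for i
      using \<rho>(2)[OF that] dn_nonneg[OF \<phi>(1)[OF that]] by simp
    ultimately have "(\<Sum>i\<in>I. (r i - \<rho> i) * dn (\<phi> i)) = 0"
      by (intro antisym sum_nonneg)
    then have "(r i - \<rho> i) * dn (\<phi> i) = 0" if "i \<in> I" for i
      using sum_nonneg_eq_0_iff[OF I terms] that by simp
    then have "dn (\<phi> i) = 0" if "i \<in> I" for i using \<rho>(2)[OF that] that by fastforce
    then show False using 1 by simp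
  qed
qed

text \<open>\<open>\<Psi>\<close> is absorbed by \<open>J\<close> if it factors through almost norm-decreasing maps into \<open>J\<close>. Then the
  functionals \<open>\<phi> \<circ> \<Psi>\<close> are determined in norm by \<open>J\<close>, so \<open>\<pi>\<close> fixes them.\<close>

definition absorbed :: "('v \<Rightarrow> 'v) \<Rightarrow> bool" where
  "absorbed \<Psi> \<longleftrightarrow> bounded_map \<Psi> \<and>
    (\<forall>x\<in>X. \<forall>\<eta>>0. \<exists>y\<in>J. \<Psi> y = \<Psi> x \<and> N y \<le> (1 + \<eta>) * N x)"

lemma \<pi>_absorbed:
  assumes \<Psi>: "absorbed \<Psi>" and \<phi>: "\<phi> \<in> dual"
  shows "\<pi> (pull \<phi> \<Psi>) = pull \<phi> \<Psi>"
proof -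
  define \<psi> where "\<psi> = pull \<phi> \<Psi>"
  have \<psi>: "\<psi> \<in> dual" unfolding \<psi>_def using \<Psi> by (intro pull_dual \<phi>) (simp add: absorbed_def)
  have "dn \<psi> \<le> dn (\<pi> \<psi>)"
  proof (rule dn_le)
    fix x assume x: "x \<in> X" "N x \<le> 1"
    have "norm (\<psi> x) \<le> dn (\<pi> \<psi>) * (1 + \<eta>)" if \<eta>: "\<eta> > 0" for \<eta>
    proof -
      obtain y where y: "y \<in> J" "\<Psi> y = \<Psi> x" "N y \<le> (1 + \<eta>) * N x"
        using \<Psi> x(1) \<eta> unfolding absorbed_def by blast
      have yX: "y \<in> X" using y(1) J by blast
      have "\<psi> x = \<pi> \<psi> y" using \<pi>_J[OF \<psi> y(1)] y(2) x(1) yX by (simp add: \<psi>_def pull_def)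
      then have "norm (\<psi> x) \<le> dn (\<pi> \<psi>) * N y" using dn_bound[OF \<pi>_dual[OF \<psi>] yX] by simp
      also have "N y \<le> 1 + \<eta>"
      proof -
        have "(1 + \<eta>) * N x \<le> (1 + \<eta>) * 1" using x(2) \<eta> by (intro mult_left_mono) auto
        then show ?thesis using order_trans[OF y(3)] by simp
      qed
      then have "dn (\<pi> \<psi>) * N y \<le> dn (\<pi> \<psi>) * (1 + \<eta>)"
        by (intro mult_left_mono dn_nonneg \<pi>_dual \<psi>)
      finally show ?thesis .
    qed
    then have *: "norm (\<psi> x) \<le> dn (\<pi> \<psi>) + dn (\<pi> \<psi>) * \<eta>" if "\<eta> > 0" for \<eta>
      using that by (simp add: algebra_simps)
    show "norm (\<psi> x) \<le> dn (\<pi> \<psi>)"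
    proof (rule field_le_epsilon)
      fix e :: real assume e: "e > 0"
      define d where "d = e / (dn (\<pi> \<psi>) + 1)"
      have "d > 0" "dn (\<pi> \<psi>) * d \<le> e"
        using e dn_nonneg[OF \<pi>_dual[OF \<psi>]] by (auto simp: d_def field_simps)
      then show "norm (\<psi> x) \<le> dn (\<pi> \<psi>) + e" using *[of d] by simp
    qed
  qed
  then have "dn (\<psi> - \<pi> \<psi>) \<le> 0" using \<pi>_norm[OF \<psi>] by simp
  then have "\<psi> - \<pi> \<psi> = 0" using \<psi> \<pi>_dual by (intro dn_eq_0D) simp_all
  then show ?thesis by (simp add: \<psi>_def)
qed

text \<open>The triple stands for the constraint \<open>N (a - \<Phi> K) \<le> r\<close> on
  \<open>K\<close>. The number \<open>\<pi> (pull \<phi> \<Phi>) v\<close> is the value at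
  \<open>\<phi>\<close> of the second adjoint of \<open>\<Phi>\<close> applied to the bidual element
  that sends \<open>\<phi>\<close> to \<open>\<pi> \<phi> v\<close>; so the condition says that this
  element meets the constraint with the smaller radius \<open>\<rho>\<close>.\<close>

definition admissible :: "'v \<Rightarrow> 'v \<times> ('v \<Rightarrow> 'v) \<times> real \<Rightarrow> bool" where
  "admissible v = (\<lambda>(a, \<Phi>, r). a \<in> X \<and> bounded_map \<Phi> \<and>
    (\<exists>\<rho>\<ge>0. \<rho> < r \<and> (\<forall>\<phi>\<in>dual. norm (\<phi> a - \<pi> (pull \<phi> \<Phi>) v) \<le> \<rho> * dn \<phi>)))"

text \<open>Encodes \<open>N K \<le> 1 + e\<close>; the bidual element satisfies it because
  \<open>\<pi>\<close> is a contraction.\<close>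

lemma admissible_norm:
  assumes v: "v \<in> X" "N v \<le> 1" and e: "e > 0"
  shows "admissible v (0, uminus, 1 + e)"
proof -
  have "norm (\<phi> 0 - \<pi> (pull \<phi> uminus) v) \<le> 1 * dn \<phi>" if \<phi>: "\<phi> \<in> dual" for \<phi>
  proof -
    have "pull \<phi> uminus = - \<phi>"
      using dual_minus[OF \<phi>] dual_off[OF \<phi>] by (auto simp: pull_def fun_eq_iff)
    moreover have "dn (- \<phi>) = dn \<phi>" by (simp add: dual_norm_def)
    moreover have "dn (\<pi> (- \<phi>)) \<le> dn (- \<phi>)"
      using \<pi>_norm[of "- \<phi>"] dn_nonneg[of "- \<phi> - \<pi> (- \<phi>)"] \<phi> by (simp add: \<pi>_dual)
    moreover have "norm (\<pi> (- \<phi>) v) \<le> dn (\<pi> (- \<phi>))"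
      using \<phi> v by (intro dn_ball \<pi>_dual) auto
    ultimately show ?thesis by (simp add: dual_zero[OF \<phi>])
  qed
  moreover have "bounded_map uminus"
    unfolding bounded_map_def by (auto simp: N_minus intro!: exI[of _ 1])
  ultimately show ?thesis
    unfolding admissible_def using e by (auto intro!: exI[of _ 1])
qed

text \<open>The L-decomposition at work: \<open>\<pi> \<phi>\<close> acts on \<open>S\<close> and
  \<open>\<phi> - \<pi> \<phi>\<close> on \<open>v\<close>, and since their norms add up to that of
  \<open>\<phi>\<close>, the larger of \<open>N S\<close> and 1 suffices instead of the sum.\<close>

lemma admissible_shift:
  assumes v: "v \<in> X" "N v \<le> 1" and S: "S \<in> J" and e: "e > 0"
  shows "admissible v (S + v, \<lambda>x. x, max 1 (N S) + e)"
proof -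
  have SX: "S \<in> X" using S J by blast
  have "norm (\<phi> (S + v) - \<pi> (pull \<phi> (\<lambda>x. x)) v) \<le> max 1 (N S) * dn \<phi>" if \<phi>: "\<phi> \<in> dual" for \<phi>
  proof -
    have "pull \<phi> (\<lambda>x. x) = \<phi>"
      using dual_off[OF \<phi>] by (auto simp: pull_def fun_eq_iff)
    then have "\<phi> (S + v) - \<pi> (pull \<phi> (\<lambda>x. x)) v = \<pi> \<phi> S + (\<phi> - \<pi> \<phi>) v"
      using \<pi>_J[OF \<phi> S] dual_add[OF \<phi> SX v(1)] by simp
    also have "norm \<dots> \<le> dn (\<pi> \<phi>) * N S + dn (\<phi> - \<pi> \<phi>) * N v"
      using \<phi> SX v by (intro norm_triangle_le add_mono dn_bound dual_minus_fun \<pi>_dual)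
    also have "\<dots> \<le> dn (\<pi> \<phi>) * max 1 (N S) + dn (\<phi> - \<pi> \<phi>) * max 1 (N S)"
      using \<phi> v by (intro add_mono mult_left_mono dn_nonneg dual_minus_fun \<pi>_dual) auto
    also have "\<dots> = max 1 (N S) * dn \<phi>"
      using \<pi>_norm[OF \<phi>] by (metis distrib_right mult.commute)
    finally show ?thesis .
  qed
  moreover have "bounded_map (\<lambda>x. x)"
    unfolding bounded_map_def by (auto intro!: exI[of _ 1])
  ultimately show ?thesis
    unfolding admissible_def using e v SX by (auto intro!: exI[of _ "max 1 (N S)"])
qed

text \<open>Here the bidual element satisfies the constraint exactly, with
  \<open>\<rho> = 0\<close>, because \<open>\<pi>\<close> fixes the functionals that factor through
  \<open>\<Psi>\<close>.\<close>

lemma admissible_absorbed: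
  assumes v: "v \<in> X" and \<Psi>: "absorbed \<Psi>" and e: "e > 0"
  shows "admissible v (\<Psi> v, \<Psi>, e)"
  unfolding admissible_def using \<pi>_absorbed[OF \<Psi>] \<Psi> e v
  by (auto simp: absorbed_def bounded_map_def pull_def intro!: exI[of _ 0])

text \<open>The solution sets of the admissible constraints generate a filter, which is proper
  because any finitely many of them have a common solution in \<open>J\<close>.\<close>

theorem M_ideal_approximation:
  assumes v: "v \<in> X" "N v \<le> 1"
  obtains G where "G \<noteq> bot" "eventually (\<lambda>K. K \<in> J) G"
    "\<And>e. e > 0 \<Longrightarrow> eventually (\<lambda>K. N K \<le> 1 + e) G"
    "\<And>S e. S \<in> J \<Longrightarrow> e > 0 \<Longrightarrow> eventually (\<lambda>K. N (S + v - K) \<le> max 1 (N S) + e) G"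
    "\<And>\<Psi> e. absorbed \<Psi> \<Longrightarrow> e > 0 \<Longrightarrow> eventually (\<lambda>K. N (\<Psi> (v - K)) \<le> e) G"
proof -
  define C where "C = (\<lambda>(a, \<Phi>, r). {K\<in>J. N (a - \<Phi> K) \<le> r})"
  define G where "G = (INF t\<in>Collect (admissible v). principal (C t))"
  have "G \<noteq> bot"
    unfolding G_def
  proof (rule INF_filter_not_bot)
    fix I assume I: "I \<subseteq> Collect (admissible v)" "finite I"
    have "\<forall>t\<in>I. \<exists>\<rho>\<ge>0. \<rho> < snd (snd t) \<and> (\<forall>\<phi>\<in>dual. norm (\<phi> (fst t) - \<pi> (pull \<phi> (fst (snd t))) v) \<le> \<rho> * dn \<phi>)"
      using I(1) unfolding admissible_def by fastforce
    then obtain \<rho> where \<rho>: "\<forall>t\<in>I. 0 \<le> \<rho> t \<and> \<rho> t < snd (snd t) \<and>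
        (\<forall>\<phi>\<in>dual. norm (\<phi> (fst t) - \<pi> (pull \<phi> (fst (snd t))) v) \<le> \<rho> t * dn \<phi>)"
      by metis
    have "\<exists>K\<in>J. \<forall>t\<in>I. N (fst t - fst (snd t) K) \<le> snd (snd t)"
    proof (rule finite_constraints[OF I(2) v(1)])
      show "fst t \<in> X" "bounded_map (fst (snd t))" if "t \<in> I" for t
        using that I(1) by (auto simp: admissible_def)
      show "0 \<le> \<rho> t" "\<rho> t < snd (snd t)" if "t \<in> I" for t using \<rho> that by blast+
      show "norm (\<phi> (fst t) - \<pi> (pull \<phi> (fst (snd t))) v) \<le> \<rho> t * dn \<phi>"
        if "t \<in> I" "\<phi> \<in> dual" for t \<phi> using \<rho> that by blast
    qed
    then obtain K where "K \<in> J" "\<And>t. t \<in> I \<Longrightarrow> K \<in> C t"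
      by (auto simp: C_def split: prod.splits) (metis fst_conv snd_conv)
    then have "K \<in> (\<Inter>t\<in>I. C t)" by blast
    then show "(INF t\<in>I. principal (C t)) \<noteq> bot"
      unfolding INF_principal_finite[OF I(2)] principal_eq_bot_iff by blast
  qed
  moreover have ev: "eventually (\<lambda>K. K \<in> C t) G" if "admissible v t" for t
    unfolding G_def by (rule eventually_INF1[of t]) (use that in \<open>auto simp: eventually_principal\<close>)
  have "eventually (\<lambda>K. K \<in> J) G"
    using ev[OF admissible_norm[OF v zero_less_one]] by eventually_elim (simp add: C_def)
  moreover have "eventually (\<lambda>K. N K \<le> 1 + e) G" if "e > 0" for e
    using ev[OF admissible_norm[OF v that]] by eventually_elim (simp add: C_def)
  moreover have "eventually (\<lambda>K. N (S + v - K) \<le> max 1 (N S) + e) G" if "S \<in> J" "e > 0" for S e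
    using ev[OF admissible_shift[OF v that]] by eventually_elim (simp add: C_def)
  moreover have "eventually (\<lambda>K. N (\<Psi> (v - K)) \<le> e) G" if \<Psi>: "absorbed \<Psi>" and "e > 0" for \<Psi> e
    using ev[OF admissible_absorbed[OF v(1) that]]
  proof eventually_elim
    case (elim K)
    then have K: "K \<in> X" using J by (auto simp: C_def)
    have add: "\<Psi> (x + y) = \<Psi> x + \<Psi> y" if "x \<in> X" "y \<in> X" for x y
      using \<Psi> that by (auto simp: absorbed_def bounded_map_def)
    have "\<Psi> (v - K) = \<Psi> v - \<Psi> K"
      using add[of "v - K" K] v(1) K by (simp add: algebra_simps)
    then show ?case using elim by (simp add: C_def)
  qed
  ultimately show ?thesis using that by blast
qed

end


section \<open>Weak convergence and operators on a Banach space\<close>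

lemma weakly_converges_filtermap:
  "weakly_converges s (filtermap z G) x \<longleftrightarrow> (\<forall>f\<in>dual_space s UNIV norm. ((\<lambda>i. f (z i)) \<longlongrightarrow> f x) G)"
  by (simp add: weakly_converges_def filterlim_filtermap)

lemma tendsto_zero_norm_less:
  fixes g :: "'i \<Rightarrow> 'a::real_normed_vector"
  shows "(g \<longlongrightarrow> 0) G \<Longrightarrow> e > 0 \<Longrightarrow> eventually (\<lambda>i. norm (g i) < e) G"
  unfolding tendsto_iff by simp

lemma norm_diff_diff_add_le:
  fixes a b c d :: "'a::real_normed_vector"
  shows "norm (a - b - c + d) \<le> norm a + norm b + norm c + norm d"
  using norm_triangle_ineq[of "a - b - c" d] norm_triangle_ineq4[of "a - b" c]
    norm_triangle_ineq4[of a b] by linarith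

context banach_over
begin

lemma normed_carrier_UNIV: "normed_carrier scale UNIV norm"
  by unfold_locales (auto simp: norm_triangle_ineq norm_scale)

sublocale E: normed_carrier scale UNIV norm
  by (rule normed_carrier_UNIV)

lemma continuous_scale_left: "continuous_on UNIV (\<lambda>c. scale c e)"
proof -
  have "bounded_linear (\<lambda>c. scale c e)"
  proof (rule bounded_linear_intro)
    show "scale (r *\<^sub>R c) e = r *\<^sub>R scale c e" for r c
      by (metis scale_of_real scale_scale scaleR_conv_of_real)
  qed (auto simp: scale_left_distrib norm_scale)
  then show ?thesis by (rule linear_continuous_on)
qed

lemma bounded_linear_scale: "bounded_linear (scale c)"
proof (rule bounded_linear_intro)
  show "scale c (r *\<^sub>R x) = r *\<^sub>R scale c x" for r x
    by (metis scale_of_real scale_left_commute)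
  show "norm (scale c x) \<le> norm x * norm c" for x by (simp add: norm_scale)
qed (rule scale_right_distrib)

lemma dual_scaleR: "f \<in> E.dual \<Longrightarrow> f (r *\<^sub>R x) = r *\<^sub>R f x"
  using E.dual_scale[of f x "of_real r"] by (simp add: scale_of_real scaleR_conv_of_real)

lemma bounded_linear_dual:
  assumes "f \<in> E.dual"
  shows "bounded_linear f"
  by (rule bounded_linear_intro[where K="E.dn f"])
    (use assms E.dn_bound[OF assms] in \<open>auto simp: E.dual_add dual_scaleR mult.commute\<close>)

lemma dualI:
  assumes "\<And>x y. f (x + y) = f x + f y" "\<And>c x. f (scale c x) = c * f x"
    and "\<And>x. norm (f x) \<le> C * norm x"
  shows "f \<in> E.dual"
  using assms by (intro E.dualI) auto

lemma norming_functional: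
  obtains f where "f \<in> E.dual" "f u = of_real (norm u)" "\<And>x. norm (f x) \<le> norm x"
proof -
  let ?s = "\<lambda>r. scale (of_real r)"
  interpret R: module ?s by (rule module_real_scale) unfold_locales
  interpret R: real_carrier ?s UNIV by unfold_locales (rule R.subspace_UNIV)
  have "sublinear_on ?s UNIV norm"
    by (auto simp: sublinear_on_def norm_triangle_ineq norm_scale)
  from R.hahn_banach_at[OF this UNIV_I, of u] obtain f where
    f: "linear_on ?s UNIV f" "\<And>x. f x \<le> norm x" "f u = norm u" by blast
  have "\<exists>\<phi>. (\<forall>x\<in>UNIV. \<forall>y\<in>UNIV. \<phi> (x + y) = \<phi> x + \<phi> y) \<and> (\<forall>c. \<forall>x\<in>UNIV. \<phi> (scale c x) = c * \<phi> x) \<and>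
    (\<forall>x\<in>UNIV. norm (\<phi> x) \<le> norm x) \<and> (\<forall>x\<in>UNIV. scalar_Re (\<phi> x) = f x)"
    by (rule scalar_functional_of_real_part[OF module_axioms subspace_UNIV f(1)])
      (auto simp: f(2) norm_scale)
  then obtain \<phi> where \<phi>: "\<And>x y. \<phi> (x + y) = \<phi> x + \<phi> y" "\<And>c x. \<phi> (scale c x) = c * \<phi> x"
    "\<And>x. norm (\<phi> x) \<le> norm x" "\<And>x. scalar_Re (\<phi> x) = f x" by auto
  obtain c where c: "norm c = 1" "c * \<phi> u = of_real (norm (\<phi> u))" by (rule scalar_phase)
  have "norm u \<le> norm (\<phi> u)" using scalar_Re_le_norm[of "\<phi> u"] \<phi>(4)[of u] f(3) by simp
  then have "norm (\<phi> u) = norm u" using \<phi>(3)[of u] by simp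
  moreover have "(\<lambda>x. c * \<phi> x) \<in> E.dual"
    using c(1) \<phi> by (intro dualI[where C=1]) (auto simp: norm_mult algebra_simps)
  ultimately show ?thesis
    using that[of "\<lambda>x. c * \<phi> x"] c \<phi>(3) by (simp add: norm_mult)
qed

lemma eq_0_if_dual_0:
  assumes "\<And>f. f \<in> E.dual \<Longrightarrow> f w = 0"
  shows "w = 0"
  using norming_functional[of w] assms by (metis norm_eq_zero of_real_eq_0_iff)

section \<open>Bounded and compact operators, and compact approximations of the identity\<close>

abbreviation "ops \<equiv> bounded_operators scale"
abbreviation "cops \<equiv> compact_operators scale"

lemma opsI:
  assumes "\<And>x y. T (x + y) = T x + T y" "\<And>c x. T (scale c x) = scale c (T x)"
    and "\<And>x. norm (T x) \<le> C * norm x"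
  shows "T \<in> ops"
proof -
  have "bounded_linear T"
  proof (rule bounded_linear_intro)
    show "T (r *\<^sub>R x) = r *\<^sub>R T x" for r x using assms(2)[of "of_real r"] by (simp add: scale_of_real)
    show "norm (T x) \<le> norm x * C" for x using assms(3) by (simp add: mult.commute)
  qed (rule assms)
  then show ?thesis
    using assms vector_space_axioms by (simp add: bounded_operators_def Vector_Spaces.linear_iff)
qed

lemma ops_bounded_linear: "T \<in> ops \<Longrightarrow> bounded_linear T"
  and ops_add: "T \<in> ops \<Longrightarrow> T (x + y) = T x + T y"
  and ops_scale: "T \<in> ops \<Longrightarrow> T (scale c x) = scale c (T x)"
  by (auto simp: bounded_operators_def Vector_Spaces.linear_iff)

lemma ops_0: "T \<in> ops \<Longrightarrow> T 0 = 0"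
  using ops_scale[of T 0 0] by simp

lemma ops_diff: "T \<in> ops \<Longrightarrow> T (x - y) = T x - T y"
  using ops_add[of T "x - y" y] by simp

lemma ops_bound: "T \<in> ops \<Longrightarrow> norm (T x) \<le> onorm T * norm x"
  by (intro onorm ops_bounded_linear)

lemma onorm_nonneg: "T \<in> ops \<Longrightarrow> 0 \<le> onorm T"
  by (intro onorm_pos_le ops_bounded_linear)

lemma comp_ops: "T \<in> cops \<Longrightarrow> T \<in> ops"
  by (simp add: compact_operators_def)

lemma id_ops: "(\<lambda>x. x) \<in> ops"
  by (rule opsI[where C=1]) auto

lemma comp_dual: "f \<in> E.dual \<Longrightarrow> T \<in> ops \<Longrightarrow> (\<lambda>x. f (T x)) \<in> E.dual"
proof (rule dualI)
  fix x assume f: "f \<in> E.dual" and T: "T \<in> ops"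
  have "norm (f (T x)) \<le> E.dn f * norm (T x)" using E.dn_bound[OF f] by simp
  also have "\<dots> \<le> E.dn f * (onorm T * norm x)"
    by (intro mult_left_mono ops_bound T E.dn_nonneg f)
  finally show "norm (f (T x)) \<le> (E.dn f * onorm T) * norm x" by (simp add: mult.assoc)
qed (auto simp: ops_add ops_scale E.dual_add E.dual_scale)

lemma normed_carrier_ops: "normed_carrier (fun_scale scale) ops onorm"
proof (rule normed_carrierI)
  show F: "module (fun_scale scale :: _ \<Rightarrow> ('a \<Rightarrow> 'a) \<Rightarrow> _)"
    by (rule module_fun_scale) unfold_locales
  have scale_le: "norm (fun_scale scale c T x) \<le> (norm c * onorm T) * norm x" if "T \<in> ops" for c T x
    using mult_left_mono[OF ops_bound[OF that, of x], of "norm c"]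
    by (simp add: fun_scale_def norm_scale mult.assoc)
  show "module.subspace (fun_scale scale) ops"
  proof (rule module.subspaceI[OF F])
    show "(0 :: 'a \<Rightarrow> 'a) \<in> ops" by (rule opsI[where C=0]) auto
    show "T + S \<in> ops" if "T \<in> ops" "S \<in> ops" for T S
    proof (rule opsI)
      show "norm ((T + S) x) \<le> (onorm T + onorm S) * norm x" for x
        using ops_bound[OF that(1), of x] ops_bound[OF that(2), of x]
          norm_triangle_ineq[of "T x" "S x"] by (simp add: distrib_right)
    qed (use that in \<open>auto simp: ops_add ops_scale scale_right_distrib\<close>)
    show "fun_scale scale c T \<in> ops" if "T \<in> ops" for c T
      by (rule opsI[OF _ _ scale_le[OF that]])
        (use that in \<open>auto simp: ops_add ops_scale fun_scale_def scale_right_distrib mult.commute\<close>)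
  qed
  show "onorm (T + S) \<le> onorm T + onorm S" if "T \<in> ops" "S \<in> ops" for T S
    using onorm_triangle[OF that[THEN ops_bounded_linear]] by (simp add: plus_fun_def)
  show "onorm (fun_scale scale c T) \<le> norm c * onorm T" if "T \<in> ops" for c T
    by (rule onorm_bound[OF _ scale_le[OF that]]) (simp add: onorm_nonneg that)
qed (rule onorm_nonneg)

lemma rank_one_compact:
  assumes f: "f \<in> E.dual"
  shows "(\<lambda>x. scale (f x) e) \<in> cops"
proof -
  let ?T = "\<lambda>x. scale (f x) e"
  have "?T \<in> ops"
  proof (rule opsI)
    show "norm (?T x) \<le> (E.dn f * norm e) * norm x" for x
      using mult_right_mono[OF E.dn_bound[OF f, of x], of "norm e"]
      by (simp add: norm_scale mult_ac)
  qed (use f in \<open>auto simp: E.dual_add E.dual_scale scale_left_distrib\<close>)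
  moreover have "compact (closure (?T ` cball 0 1))"
  proof -
    let ?S = "(\<lambda>c. scale c e) ` cball 0 (E.dn f)"
    have S: "compact ?S"
      by (intro compact_continuous_image compact_cball_scalar
          continuous_on_subset[OF continuous_scale_left]) auto
    have "?T ` cball 0 1 \<subseteq> ?S"
      using E.dn_ball[OF f] by auto
    then have "closure (?T ` cball 0 1) \<subseteq> ?S"
      by (intro closure_minimal compact_imp_closed S)
    then show ?thesis
      using compact_Int_closed[OF S closed_closure] by (metis inf.absorb2)
  qed
  ultimately show ?thesis by (simp add: compact_operators_def)
qed

lemma compact_ultra_limit:
  assumes U: "ultrafilter U" and T: "T \<in> cops" and z: "eventually (\<lambda>i. norm (z i) \<le> C) U"
  obtains u where "((\<lambda>i. T (z i)) \<longlongrightarrow> u) U"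
proof -
  define D where "D = max C 1"
  have D: "D > 0" by (simp add: D_def)
  let ?K = "(\<lambda>x. D *\<^sub>R x) ` closure (T ` cball 0 1)"
  have "compact ?K"
    using T by (intro compact_scaling) (simp add: compact_operators_def)
  moreover have "eventually (\<lambda>i. T (z i) \<in> ?K) U"
    using z
  proof eventually_elim
    case (elim i)
    have "inverse D *\<^sub>R z i \<in> cball 0 1"
      using elim D by (simp add: D_def field_simps)
    then have "T (inverse D *\<^sub>R z i) \<in> closure (T ` cball 0 1)"
      by (intro closure_subset[THEN subsetD] imageI)
    moreover have "T (z i) = D *\<^sub>R T (inverse D *\<^sub>R z i)"
      using ops_scale[OF comp_ops[OF T], of "of_real (inverse D)"] D
      by (simp only: scale_of_real) simp
    ultimately show ?case by blast
  qed
  ultimately show ?thesis using ultrafilter_tendsto_compact[OF U] that by metis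
qed

text \<open>Along every finer ultrafilter the images have a norm limit. Each functional composed
  with \<open>T\<close> is again a functional, so all functionals vanish at that limit.\<close>

lemma compact_weakly_null:
  assumes T: "T \<in> cops" and z: "eventually (\<lambda>i. norm (z i) \<le> C) G"
    and weak: "weakly_converges scale (filtermap z G) 0"
  shows "((\<lambda>i. T (z i)) \<longlongrightarrow> 0) G"
proof (rule tendsto_zero_if_ultrafilters)
  fix U assume U: "ultrafilter U" "U \<le> G"
  obtain w where w: "((\<lambda>i. T (z i)) \<longlongrightarrow> w) U"
    using compact_ultra_limit[OF U(1) T] z U(2) by (meson filter_leD)
  have "f w = 0" if f: "f \<in> E.dual" for f
  proof (rule tendsto_unique)
    show "U \<noteq> bot" using U by (simp add: ultrafilter_def)
    show "((\<lambda>i. f (T (z i))) \<longlongrightarrow> f w) U"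
      using bounded_linear.tendsto[OF bounded_linear_dual[OF f] w] .
    have "((\<lambda>i. f (T (z i))) \<longlongrightarrow> f (T 0)) G"
      using bspec[OF weak[unfolded weakly_converges_filtermap] comp_dual[OF f comp_ops[OF T]]] by simp
    then show "((\<lambda>i. f (T (z i))) \<longlongrightarrow> 0) U"
      using U(2) by (simp add: ops_0[OF comp_ops[OF T]] E.dual_zero[OF f] tendsto_mono)
  qed
  then have "w = 0" by (rule eq_0_if_dual_0)
  with w show "((\<lambda>i. T (z i)) \<longlongrightarrow> 0) U" by simp
qed

text \<open>The last three clauses are the M-ideal inequality for \<open>S + Id - K\<close>, the
  norm convergence of K* f to f, and strong convergence to the identity. The norms of the operators
  and functionals in the first two are spelled out pointwise, the form in which they are applied to
  vectors.\<close>

definition approximating :: "('a \<Rightarrow> 'a) filter \<Rightarrow> bool" where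
  "approximating G \<longleftrightarrow> G \<noteq> bot \<and> eventually (\<lambda>K. K \<in> cops) G \<and>
    (\<forall>e>0. eventually (\<lambda>K. onorm K \<le> 1 + e) G) \<and>
    (\<forall>S\<in>cops. \<forall>e>0. eventually (\<lambda>K. \<forall>x. norm (S x + x - K x) \<le> (max 1 (onorm S) + e) * norm x) G) \<and>
    (\<forall>f\<in>E.dual. \<forall>e>0. eventually (\<lambda>K. \<forall>x. norm (f (x - K x)) \<le> e * norm x) G) \<and>
    (\<forall>u. \<forall>e>0. eventually (\<lambda>K. norm (u - K u) \<le> e) G)"

lemma approximatingD:
  assumes "approximating G"
  shows "G \<noteq> bot" "eventually (\<lambda>K. K \<in> cops) G"
    "e > 0 \<Longrightarrow> eventually (\<lambda>K. onorm K \<le> 1 + e) G"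
    "S \<in> cops \<Longrightarrow> e > 0 \<Longrightarrow>
      eventually (\<lambda>K. \<forall>x. norm (S x + x - K x) \<le> (max 1 (onorm S) + e) * norm x) G"
    "f \<in> E.dual \<Longrightarrow> e > 0 \<Longrightarrow> eventually (\<lambda>K. \<forall>x. norm (f (x - K x)) \<le> e * norm x) G"
    "e > 0 \<Longrightarrow> eventually (\<lambda>K. norm (u - K u) \<le> e) G"
  using assms unfolding approximating_def by blast+

lemma approximating_mono: "approximating G \<Longrightarrow> U \<le> G \<Longrightarrow> U \<noteq> bot \<Longrightarrow> approximating U"
  unfolding approximating_def by (meson filter_leD)

text \<open>The approximation theorem is applied to the identity operator. Both strong convergences
  come from absorbed maps: multiplying by a rank-one projection on the left tests
  \<open>f o (Id - K)\<close>, multiplying on the right tests \<open>(Id - K) u\<close>.\<close>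

theorem approximating_exists:
  assumes M: "M_ideal (fun_scale scale) ops onorm cops"
  shows "\<exists>G. approximating G"
proof -
  interpret O: normed_carrier "fun_scale scale" ops onorm by (rule normed_carrier_ops)
  obtain \<pi> where "M_projection (fun_scale scale) ops onorm cops \<pi>"
    using O.M_projection_of_M_ideal[OF M] .
  then interpret M_projection "fun_scale scale" ops onorm cops \<pi> .
  obtain G where G: "G \<noteq> bot" "eventually (\<lambda>K. K \<in> cops) G"
    "\<And>e. e > 0 \<Longrightarrow> eventually (\<lambda>K. onorm K \<le> 1 + e) G"
    "\<And>S e. S \<in> cops \<Longrightarrow> e > 0 \<Longrightarrow> eventually (\<lambda>K. onorm (S + (\<lambda>x. x) - K) \<le> max 1 (onorm S) + e) G"
    "\<And>\<Psi> e. absorbed \<Psi> \<Longrightarrow> e > 0 \<Longrightarrow> eventually (\<lambda>K. onorm (\<Psi> ((\<lambda>x. x) - K)) \<le> e) G"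
    using M_ideal_approximation[OF id_ops onorm_id_le] by blast
  have opsK: "eventually (\<lambda>K. K \<in> ops) G" using G(2) by eventually_elim (rule comp_ops)
  have diff_ops: "(\<lambda>x. x) - K \<in> ops" if "K \<in> ops" for K
    using that id_ops by (intro O.X_closed)
  have bounded_map: "bounded_map (\<lambda>T x. S (T (R x)))" if S: "S \<in> ops" and R: "R \<in> ops" for S R
    unfolding bounded_map_def
  proof (intro conjI ballI allI exI[of _ "onorm S * onorm R"])
    have *: "norm (S (T (R x))) \<le> (onorm S * onorm R * onorm T) * norm x" if T: "T \<in> ops" for T x
    proof -
      have "norm (S (T (R x))) \<le> onorm S * norm (T (R x))" by (rule ops_bound[OF S])
      also have "\<dots> \<le> onorm S * (onorm T * norm (R x))"
        by (rule mult_left_mono[OF ops_bound[OF T] onorm_nonneg[OF S]])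
      also have "\<dots> \<le> onorm S * (onorm T * (onorm R * norm x))"
        by (intro mult_left_mono ops_bound[OF R] onorm_nonneg[OF T] onorm_nonneg[OF S])
      finally show ?thesis by (simp add: mult_ac)
    qed
    fix T assume T: "T \<in> ops"
    show "(\<lambda>x. S (T (R x))) \<in> ops"
      by (rule opsI[OF _ _ *[OF T]]) (use S R T in \<open>auto simp: ops_add ops_scale\<close>)
    show "onorm (\<lambda>x. S (T (R x))) \<le> onorm S * onorm R * onorm T"
      using *[OF T] by (intro onorm_bound) (auto simp: onorm_nonneg S R T)
  qed (use S in \<open>auto simp: ops_add ops_scale fun_scale_def fun_eq_iff\<close>)
  have left: "absorbed (\<lambda>T x. scale (f (T x)) e)" if f: "f \<in> E.dual" and fe: "f e = 1" for f e
    unfolding absorbed_def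
  proof (intro conjI ballI allI impI)
    show "bounded_map (\<lambda>T x. scale (f (T x)) e)"
      by (rule bounded_map[OF comp_ops[OF rank_one_compact[OF f]] id_ops])
    fix T and \<eta> :: real assume T: "T \<in> ops" and \<eta>: "\<eta> > 0"
    have dn_pos: "E.dn f > 0"
      using E.dn_bound[OF f, of e] fe E.dn_nonneg[OF f] by (cases "E.dn f = 0") auto
    then have "E.dn f - E.dn f / (1 + \<eta>) > 0" using \<eta> by (simp add: field_simps)
    from E.dn_approx[OF f this] obtain x where
      x: "norm x \<le> 1" "E.dn f / (1 + \<eta>) < norm (f x)" by auto
    have fx: "norm (f x) > 0" using x(2) dn_pos \<eta> by (smt (verit) divide_pos_pos)
    \<comment> \<open>\<open>e\<close> may be much longer than 1 / |f|. The vector \<open>e'\<close>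
      also satisfies \<open>f e' = 1\<close>, but its length is within the factor
      \<open>1 + \<eta>\<close> of that minimum, so the rank-one operator built with it has norm at
      most \<open>(1 + \<eta>) * onorm T\<close> and the same image.\<close>
    define e' where "e' = scale (inverse (f x)) x"
    have fe': "f e' = 1" using fx by (simp add: e'_def E.dual_scale[OF f])
    have "E.dn f < (1 + \<eta>) * norm (f x)" using x(2) \<eta> by (simp add: field_simps)
    then have e'_norm: "E.dn f * norm e' \<le> 1 + \<eta>"
    proof -
      have "E.dn f * norm x \<le> ((1 + \<eta>) * norm (f x)) * 1"
        using x(1) \<open>E.dn f < _\<close> dn_pos \<eta> by (intro mult_mono) auto
      then have "E.dn f * norm x / norm (f x) \<le> 1 + \<eta>"
        using fx by (simp only: pos_divide_le_eq mult_1_right)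
      then show ?thesis by (simp add: e'_def norm_scale norm_inverse divide_inverse mult_ac)
    qed
    have "(\<lambda>x. scale (f (T x)) e') \<in> cops" by (rule rank_one_compact[OF comp_dual[OF f T]])
    moreover have "(\<lambda>x. scale (f (scale (f (T x)) e')) e) = (\<lambda>x. scale (f (T x)) e)"
      by (simp add: E.dual_scale[OF f] fe')
    moreover have "onorm (\<lambda>x. scale (f (T x)) e') \<le> (1 + \<eta>) * onorm T"
    proof (rule onorm_bound)
      fix x
      have "norm (scale (f (T x)) e') \<le> (E.dn f * norm (T x)) * norm e'"
        using E.dn_bound[OF f, of "T x"] by (simp add: norm_scale mult_right_mono)
      also have "\<dots> = (E.dn f * norm e') * norm (T x)" by simp
      also have "\<dots> \<le> (1 + \<eta>) * (onorm T * norm x)"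
        using e'_norm \<eta> ops_bound[OF T] by (intro mult_mono) auto
      finally show "norm (scale (f (T x)) e') \<le> (1 + \<eta>) * onorm T * norm x" by (simp add: mult.assoc)
    qed (use \<eta> onorm_nonneg[OF T] in simp)
    ultimately show "\<exists>y\<in>cops. (\<lambda>x. scale (f (y x)) e) = (\<lambda>x. scale (f (T x)) e) \<and> onorm y \<le> (1 + \<eta>) * onorm T"
      by (intro bexI[of _ "\<lambda>x. scale (f (T x)) e'"] conjI)
  qed
  \<comment> \<open>By \<open>gn\<close> the projection onto the span of \<open>u\<close> has norm
    at most 1, so composing \<open>T\<close> with it gives a compact operator of no larger norm,
    which a second composition does not change.\<close>
  have right: "absorbed (\<lambda>T x. T (scale (g x) u))"
    if g: "g \<in> E.dual" and gu: "g u = 1" and gn: "\<And>x. norm (g x) * norm u \<le> norm x" for g u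
    unfolding absorbed_def
  proof (intro conjI ballI allI impI)
    show "bounded_map (\<lambda>T x. T (scale (g x) u))"
      by (rule bounded_map[OF id_ops comp_ops[OF rank_one_compact[OF g]]])
    fix T and \<eta> :: real assume T: "T \<in> ops" and \<eta>: "\<eta> > 0"
    have eq: "(\<lambda>x. T (scale (g x) u)) = (\<lambda>x. scale (g x) (T u))" using ops_scale[OF T] by simp
    have "(\<lambda>x. T (scale (g x) u)) \<in> cops" unfolding eq by (rule rank_one_compact[OF g])
    moreover have "(\<lambda>x. T (scale (g (scale (g x) u)) u)) = (\<lambda>x. T (scale (g x) u))"
      by (simp only: E.dual_scale[OF g UNIV_I] gu mult_1_right)
    moreover have "onorm (\<lambda>x. T (scale (g x) u)) \<le> (1 + \<eta>) * onorm T"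
    proof (rule onorm_bound)
      fix x
      have "norm (T (scale (g x) u)) \<le> onorm T * norm (scale (g x) u)" by (rule ops_bound[OF T])
      also have "\<dots> \<le> onorm T * norm x"
        using gn[of x] by (intro mult_left_mono onorm_nonneg T) (simp add: norm_scale)
      also have "\<dots> \<le> (1 + \<eta>) * onorm T * norm x"
        using \<eta> onorm_nonneg[OF T] by (intro mult_right_mono) (auto simp: algebra_simps)
      finally show "norm (T (scale (g x) u)) \<le> (1 + \<eta>) * onorm T * norm x" .
    qed (use \<eta> onorm_nonneg[OF T] in simp)
    ultimately show "\<exists>y\<in>cops. (\<lambda>x. y (scale (g x) u)) = (\<lambda>x. T (scale (g x) u)) \<and> onorm y \<le> (1 + \<eta>) * onorm T"
      by (intro bexI[of _ "\<lambda>x. T (scale (g x) u)"] conjI)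
  qed
  have "eventually (\<lambda>K. \<forall>x. norm (S x + x - K x) \<le> (max 1 (onorm S) + e) * norm x) G"
    if S: "S \<in> cops" and e: "e > 0" for S e
    using G(4)[OF that] opsK
  proof eventually_elim
    case (elim K)
    have "S + (\<lambda>x. x) - K \<in> ops" using elim(2) comp_ops[OF S] id_ops by (intro O.X_closed)
    then have "norm ((S + (\<lambda>x. x) - K) x) \<le> onorm (S + (\<lambda>x. x) - K) * norm x" for x
      by (rule ops_bound)
    also have "onorm (S + (\<lambda>x. x) - K) * norm x \<le> (max 1 (onorm S) + e) * norm x" for x
      using elim(1) by (intro mult_right_mono) auto
    finally show ?case by simp
  qed
  moreover have "eventually (\<lambda>K. \<forall>x. norm (f (x - K x)) \<le> e * norm x) G"
    if f: "f \<in> E.dual" and e: "e > 0" for f e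
  proof (cases "\<forall>x. f x = 0")
    case True
    then show ?thesis using e by simp
  next
    case False
    then obtain x0 where x0: "f x0 \<noteq> 0" by blast
    define e0 where "e0 = scale (inverse (f x0)) x0"
    have fe0: "f e0 = 1" using x0 by (simp add: e0_def E.dual_scale[OF f])
    define d where "d = e / (E.dn f + 1)"
    have d: "d > 0" "E.dn f * d \<le> e"
      using e E.dn_nonneg[OF f] by (auto simp: d_def field_simps)
    show ?thesis
      using G(5)[OF left[OF f fe0] d(1)] opsK
    proof eventually_elim
      case (elim K)
      let ?R = "\<lambda>x. scale (f (((\<lambda>x. x) - K) x)) e0"
      have R: "?R \<in> ops" by (rule comp_ops[OF rank_one_compact[OF comp_dual[OF f diff_ops[OF elim(2)]]]])
      show ?case
      proof
        fix x
        have "f (x - K x) = f (?R x)" by (simp add: E.dual_scale[OF f] fe0)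
        also have "norm \<dots> \<le> E.dn f * norm (?R x)" using E.dn_bound[OF f] by simp
        also have "\<dots> \<le> E.dn f * (onorm ?R * norm x)" by (intro mult_left_mono ops_bound R E.dn_nonneg f)
        also have "\<dots> \<le> E.dn f * (d * norm x)"
          using elim(1) by (intro mult_left_mono mult_right_mono E.dn_nonneg f) auto
        also have "\<dots> \<le> e * norm x" using mult_right_mono[OF d(2), of "norm x"] by (simp add: mult.assoc)
        finally show "norm (f (x - K x)) \<le> e * norm x" .
      qed
    qed
  qed
  moreover have "eventually (\<lambda>K. norm (u - K u) \<le> e) G" if e: "e > 0" for u e
  proof (cases "u = 0")
    case True
    show ?thesis using opsK by eventually_elim (use True e in \<open>simp add: ops_0\<close>)
  next
    case False
    obtain f where f: "f \<in> E.dual" "f u = of_real (norm u)" "\<And>x. norm (f x) \<le> norm x"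
      using norming_functional[of u] by blast
    define g where "g = (\<lambda>x. of_real (inverse (norm u)) * f x)"
    have g: "g \<in> E.dual"
      using f(1) E.dual_fun_scale[OF f(1), of "of_real (inverse (norm u))"]
      by (simp add: g_def fun_scale_def)
    have gu: "g u = 1" using False f(2) by (simp add: g_def)
    have gn: "norm (g x) * norm u \<le> norm x" for x
      using False f(3)[of x] unfolding g_def norm_mult norm_of_real by (simp add: field_simps)
    have d: "e / norm u > 0" using e False by simp
    show ?thesis
      using G(5)[OF right[OF g gu gn] d] opsK
    proof eventually_elim
      case (elim K)
      let ?R = "\<lambda>x. ((\<lambda>x. x) - K) (scale (g x) u)"
      have "?R \<in> ops"
        using bounded_map[OF id_ops comp_ops[OF rank_one_compact[OF g, of u]]] diff_ops[OF elim(2)]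
        unfolding bounded_map_def by blast
      then have "norm (?R u) \<le> onorm ?R * norm u" by (rule ops_bound)
      also have "\<dots> \<le> (e / norm u) * norm u" using elim(1) by (intro mult_right_mono) auto
      finally show ?case using False gu by simp
    qed
  qed
  ultimately show ?thesis using G(1-3) unfolding approximating_def by blast
qed

text \<open>The operator \<open>S + Id - K\<close>, with \<open>S\<close> of rank one and \<open>S u = x\<close>, maps \<open>u + z\<close> close to \<open>x + z\<close>.\<close>

theorem property_M_of_M_ideal:
  assumes M: "M_ideal (fun_scale scale) ops onorm cops"
    and le: "norm x \<le> norm u" and z: "eventually (\<lambda>i. norm (z i) \<le> C) G"
    and weak: "weakly_converges scale (filtermap z G) 0"
    and c: "eventually (\<lambda>i. norm (u + z i) \<le> c) G" and e: "e > 0"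
  shows "eventually (\<lambda>i. norm (x + z i) \<le> c + e) G"
proof (cases "u = 0")
  case True
  then have "x = 0" using le by simp
  show ?thesis using c by eventually_elim (use True \<open>x = 0\<close> e in simp)
next
  case False
  obtain H where H: "approximating H" using approximating_exists[OF M] by blast
  obtain f where f: "f \<in> E.dual" "f u = of_real (norm u)" "\<And>x. norm (f x) \<le> norm x"
    using norming_functional[of u] by blast
  define S where "S = (\<lambda>y. scale (f y) (scale (of_real (inverse (norm u))) x))"
  have S: "S \<in> cops" unfolding S_def by (rule rank_one_compact[OF f(1)])
  have Su: "S u = x" using False f(2) by (simp add: S_def scale_of_real)
  have "onorm S \<le> 1"
  proof (rule onorm_bound)
    fix y
    have "norm (S y) = norm (f y) * (norm x / norm u)"
      unfolding S_def norm_scale norm_of_real by (simp add: divide_inverse mult_ac)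
    also have "\<dots> \<le> norm y * 1" using f(3) le False by (intro mult_mono) auto
    finally show "norm (S y) \<le> 1 * norm y" by simp
  qed simp
  \<comment> \<open>Error budget: the factor \<open>1 + d\<close> costs
    \<open>d * \<bar>c\<bar>\<close> and \<open>u - K u\<close> costs \<open>d\<close>, together
    \<open>e / 2\<close>; the terms \<open>S (z i)\<close> and \<open>K (z i)\<close> get
    \<open>e / 4\<close> each.\<close>
  define a where "a = \<bar>c\<bar> + 1"
  define d where "d = e / (2 * a)"
  have a: "a > 0" by (simp add: a_def)
  then have d: "d > 0" using e by (simp add: d_def)
  have "d * a = e / 2" using a by (simp add: d_def)
  then have d': "d * \<bar>c\<bar> + d = e / 2" by (simp add: a_def algebra_simps)
  have "eventually (\<lambda>K. K \<in> cops \<and> (\<forall>x. norm (S x + x - K x) \<le> (max 1 (onorm S) + d) * norm x) \<and>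
      norm (u - K u) \<le> d) H"
    using approximatingD(2,4,6)[OF H] S d by (auto intro!: eventually_conj)
  then obtain K where K: "K \<in> cops" "\<And>x. norm (S x + x - K x) \<le> (max 1 (onorm S) + d) * norm x"
      "norm (u - K u) \<le> d"
    using eventually_happens'[OF approximatingD(1)[OF H]] by blast
  have "eventually (\<lambda>i. norm (S (z i)) < e / 4) G" "eventually (\<lambda>i. norm (K (z i)) < e / 4) G"
    using e by (intro tendsto_zero_norm_less compact_weakly_null[OF S z weak]
        compact_weakly_null[OF K(1) z weak]; simp)+
  with c show ?thesis
  proof eventually_elim
    case (elim i)
    have c0: "c \<ge> 0" using elim(1) norm_ge_zero order_trans by blast
    have "x + z i = (S (u + z i) + (u + z i) - K (u + z i)) - (u - K u) - S (z i) + K (z i)"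
      using Su by (simp add: ops_add[OF comp_ops[OF S]] ops_add[OF comp_ops[OF K(1)]])
    also have "norm \<dots> \<le> norm (S (u + z i) + (u + z i) - K (u + z i)) + norm (u - K u)
        + norm (S (z i)) + norm (K (z i))"
      by (rule norm_diff_diff_add_le)
    also have "norm (S (u + z i) + (u + z i) - K (u + z i)) \<le> (1 + d) * norm (u + z i)"
      using K(2)[of "u + z i"] unfolding max_absorb1[OF \<open>onorm S \<le> 1\<close>] .
    also have "(1 + d) * norm (u + z i) \<le> (1 + d) * c" using elim(1) d by (intro mult_left_mono) auto
    also have "\<dots> = c + d * \<bar>c\<bar>" using c0 by (simp add: algebra_simps)
    finally show ?case using K(3) elim(2,3) d' by linarith
  qed
qed

end


section \<open>Homogeneous polynomials\<close>

text \<open>A class of functions that is closed under linear combinations contains the coefficients of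
  a polynomial in \<open>t\<close> if it contains all its values: \<open>g (2 t) - 2\<^sup>n g t\<close> has smaller degree.\<close>

lemma coefficients_in_class:
  fixes r :: "nat \<Rightarrow> 'x \<Rightarrow> 'b::real_vector"
  assumes add: "\<And>f g. Q f \<Longrightarrow> Q g \<Longrightarrow> Q (\<lambda>x. f x + g x)"
    and scale: "\<And>c f. Q f \<Longrightarrow> Q (\<lambda>x. c *\<^sub>R f x)"
    and val: "\<And>t. Q (\<lambda>x. \<Sum>k\<le>n. t ^ k *\<^sub>R r k x)" and k: "k \<le> n"
  shows "Q (r k)"
  using val k
proof (induction n arbitrary: r k)
  case 0
  then show ?case using "0.prems"(1)[of 1] by simp
next
  case (Suc n)
  have diff: "Q (\<lambda>x. f x - g x)" if "Q f" "Q g" for f g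
    using add[OF that(1) scale[OF that(2), of "-1"]] by simp
  have low: "Q (r k)" if "k \<le> n" for k
  proof -
    \<comment> \<open>This factor vanishes at the top degree \<open>Suc n\<close> and at no lower
      degree, so the lower coefficients can be recovered by division.\<close>
    define c :: "nat \<Rightarrow> real" where "c k = 2 ^ k - 2 ^ Suc n" for k
    have "Q (\<lambda>x. c k *\<^sub>R r k x)"
    proof (rule Suc.IH[of "\<lambda>k x. c k *\<^sub>R r k x", OF _ that])
      fix t :: real
      have "(\<Sum>k\<le>n. t ^ k *\<^sub>R c k *\<^sub>R r k x) =
          (\<Sum>k\<le>Suc n. (2 * t) ^ k *\<^sub>R r k x) - 2 ^ Suc n *\<^sub>R (\<Sum>k\<le>Suc n. t ^ k *\<^sub>R r k x)" for x
      proof -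
        have "(\<Sum>k\<le>Suc n. (2 * t) ^ k *\<^sub>R r k x) - 2 ^ Suc n *\<^sub>R (\<Sum>k\<le>Suc n. t ^ k *\<^sub>R r k x) =
            (\<Sum>k\<le>Suc n. t ^ k *\<^sub>R c k *\<^sub>R r k x)"
          unfolding scaleR_sum_right sum_subtractf[symmetric] c_def
          by (intro sum.cong) (auto simp: power_mult_distrib algebra_simps)
        then show ?thesis by (simp add: c_def)
      qed
      then show "Q (\<lambda>x. \<Sum>k\<le>n. t ^ k *\<^sub>R c k *\<^sub>R r k x)"
        using diff[OF Suc.prems(1)[of "2 * t"] scale[OF Suc.prems(1)[of t], of "2 ^ Suc n"]] by simp
    qed
    from scale[OF this, of "inverse (c k)"] show ?thesis
    proof -
      have "(2::real) ^ k < 2 ^ Suc n" using that by (intro power_strict_increasing) auto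
      then have "c k \<noteq> 0" by (simp add: c_def)
      then show ?thesis using \<open>Q (\<lambda>x. inverse (c k) *\<^sub>R c k *\<^sub>R r k x)\<close> by simp
    qed
  qed
  have zero: "Q (\<lambda>x. 0)" using scale[OF low[OF le0], of 0] by simp
  have sum: "Q (\<lambda>x. \<Sum>k\<in>I. r k x)" if "finite I" "I \<subseteq> {..n}" for I
    using that by (induction I) (auto intro: zero add low)
  show ?case
  proof (cases "k \<le> n")
    case False
    then have "k = Suc n" using Suc.prems(2) by simp
    moreover have "r (Suc n) x = (\<Sum>k\<le>Suc n. 1 ^ k *\<^sub>R r k x) - (\<Sum>k\<in>{..n}. r k x)" for x
      by simp
    ultimately show ?thesis
      using diff[OF Suc.prems(1)[of 1] sum[of "{..n}"]] by simp
  qed (rule low)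
qed

text \<open>The selection picks a point that violates the bound wherever there is one. Uniform
  estimates on the ball are thereby reduced to families of vectors, to which weak convergence
  applies.\<close>

lemma eventually_ball_of_selections:
  fixes h :: "'i \<Rightarrow> 'a::real_normed_vector \<Rightarrow> 'b::real_normed_vector"
  assumes "\<And>x. (\<And>i. norm (x i) \<le> 1) \<Longrightarrow> eventually (\<lambda>i. norm (h i (x i)) \<le> e) G"
  shows "eventually (\<lambda>i. \<forall>x\<in>cball 0 1. norm (h i x) \<le> e) G"
proof -
  define x where "x i = (if \<exists>y\<in>cball 0 1. \<not> norm (h i y) \<le> e
    then SOME y. y \<in> cball 0 1 \<and> \<not> norm (h i y) \<le> e else 0)" for i
  have x: "x i \<in> cball 0 1 \<and> \<not> norm (h i (x i)) \<le> e" if "\<exists>y\<in>cball 0 1. \<not> norm (h i y) \<le> e" for i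
  proof -
    have "\<exists>y. y \<in> cball 0 1 \<and> \<not> norm (h i y) \<le> e" using that by blast
    from someI_ex[OF this] show ?thesis unfolding x_def if_P[OF that] .
  qed
  have "norm (x i) \<le> 1" for i
  proof (cases "\<exists>y\<in>cball 0 1. \<not> norm (h i y) \<le> e")
    case True
    then show ?thesis using x by simp
  next
    case False
    then show ?thesis unfolding x_def by simp
  qed
  from assms[OF this] show ?thesis
    by eventually_elim (use x in blast)
qed

locale polynomial_spaces = E: banach_over sE + F: banach_over sF
  for sE :: "'k::real_or_complex \<Rightarrow> 'a::banach \<Rightarrow> 'a" and sF :: "'k \<Rightarrow> 'b::banach \<Rightarrow> 'b"
begin

abbreviation "hom \<equiv> hom_polys sE sF"
abbreviation "wc \<equiv> weakly_cont_polys sE sF"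

section \<open>Multilinear maps and their values on the diagonal\<close>

lemma multilinearI:
  assumes "\<And>x y. (\<And>i. i < n \<Longrightarrow> x i = y i) \<Longrightarrow> A x = A y"
    and "\<And>x i y z. i < n \<Longrightarrow> A (x(i := y + z)) = A (x(i := y)) + A (x(i := z))"
    and "\<And>x i c y. i < n \<Longrightarrow> A (x(i := sE c y)) = sF c (A (x(i := y)))"
  shows "multilinear sE sF n A"
  unfolding multilinear_def Vector_Spaces.linear_iff
  using assms E.vector_space_axioms F.vector_space_axioms by blast

lemma multilinearD:
  assumes "multilinear sE sF n A"
  shows "(\<And>i. i < n \<Longrightarrow> x i = y i) \<Longrightarrow> A x = A y"
    and "i < n \<Longrightarrow> A (x(i := u + v)) = A (x(i := u)) + A (x(i := v))"
    and "i < n \<Longrightarrow> A (x(i := sE c u)) = sF c (A (x(i := u)))"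
  using assms unfolding multilinear_def Vector_Spaces.linear_iff by blast+

lemma multilinear_diag_scale:
  assumes A: "multilinear sE sF n A"
  shows "A (\<lambda>i. sE c (x i)) = sF (c ^ n) (A x)"
proof -
  have "A (\<lambda>i. if i < m then sE c (x i) else x i) = sF (c ^ m) (A x)" if "m \<le> n" for m
    using that
  proof (induction m)
    case (Suc m)
    let ?w = "\<lambda>i. if i < m then sE c (x i) else x i"
    have "(\<lambda>i. if i < Suc m then sE c (x i) else x i) = ?w(m := sE c (x m))"
      by (auto simp: fun_eq_iff less_Suc_eq)
    moreover have "?w(m := x m) = ?w" by auto
    ultimately show ?case
      using multilinearD(3)[OF A, of m ?w c "x m"] Suc by simp
  qed simp
  from this[of n] have "sF (c ^ n) (A x) = A (\<lambda>i. if i < n then sE c (x i) else x i)" by simp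
  also have "\<dots> = A (\<lambda>i. sE c (x i))" by (rule multilinearD(1)[OF A]) simp
  finally show ?thesis by simp
qed

text \<open>The slots are expanded one at a time. Keeping the filling \<open>z\<close> of the
  remaining slots arbitrary allows the induction hypothesis to be used with \<open>x\<close> and
  with \<open>y\<close> in the next slot.\<close>

lemma multilinear_diag_add:
  assumes A: "multilinear sE sF n A"
  shows "A (\<lambda>i. x + y) = (\<Sum>S\<in>Pow {..<n}. A (\<lambda>i. if i \<in> S then x else y))"
proof -
  have "A (\<lambda>i. if i < m then x + y else z i) =
      (\<Sum>S\<in>Pow {..<m}. A (\<lambda>i. if i < m then if i \<in> S then x else y else z i))" if "m \<le> n" for m z
    using that
  proof (induction m arbitrary: z)
    case (Suc m)
    let ?w = "\<lambda>i. if i < m then x + y else z i"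
    let ?v = "\<lambda>S z i. if i < m then if i \<in> S then x else y else z i"
    have "(\<lambda>i. if i < Suc m then x + y else z i) = ?w(m := x + y)"
      by (auto simp: fun_eq_iff less_Suc_eq)
    then have "A (\<lambda>i. if i < Suc m then x + y else z i) = A (?w(m := x)) + A (?w(m := y))"
      using multilinearD(2)[OF A, of m ?w x y] Suc.prems by simp
    also have "?w(m := x) = (\<lambda>i. if i < m then x + y else (z(m := x)) i)" by auto
    also have "?w(m := y) = (\<lambda>i. if i < m then x + y else (z(m := y)) i)" by auto
    also have "A (\<lambda>i. if i < m then x + y else (z(m := x)) i) = (\<Sum>S\<in>Pow {..<m}. A (?v S (z(m := x))))"
      using Suc by simp
    also have "A (\<lambda>i. if i < m then x + y else (z(m := y)) i) = (\<Sum>S\<in>Pow {..<m}. A (?v S (z(m := y))))"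
      using Suc by simp
    also have "(\<Sum>S\<in>Pow {..<m}. A (?v S (z(m := x)))) + (\<Sum>S\<in>Pow {..<m}. A (?v S (z(m := y)))) =
        (\<Sum>S\<in>Pow {..<Suc m}. A (\<lambda>i. if i < Suc m then if i \<in> S then x else y else z i))"
    proof -
      let ?g = "\<lambda>S. A (\<lambda>i. if i < Suc m then if i \<in> S then x else y else z i)"
      have inj: "inj_on (insert m) (Pow {..<m})"
      proof (rule inj_onI)
        fix S T assume "S \<in> Pow {..<m}" "T \<in> Pow {..<m}" "insert m S = insert m T"
        moreover have "m \<notin> S" "m \<notin> T" using calculation by auto
        ultimately show "S = T" by (simp add: insert_ident)
      qed
      have "Pow {..<Suc m} = Pow {..<m} \<union> insert m ` Pow {..<m}"
        by (simp add: lessThan_Suc Pow_insert)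
      moreover have "Pow {..<m} \<inter> insert m ` Pow {..<m} = {}" by auto
      ultimately have "sum ?g (Pow {..<Suc m}) = sum ?g (Pow {..<m}) + sum ?g (insert m ` Pow {..<m})"
        by (simp only: sum.union_disjoint finite_Pow_iff finite_lessThan finite_imageI)
      also have "sum ?g (insert m ` Pow {..<m}) = (\<Sum>S\<in>Pow {..<m}. ?g (insert m S))"
        by (simp add: sum.reindex[OF inj])
      also have "\<dots> = (\<Sum>S\<in>Pow {..<m}. A (?v S (z(m := x))))"
        by (intro sum.cong refl arg_cong[of _ _ A]) (auto simp: fun_eq_iff less_Suc_eq)
      also have "sum ?g (Pow {..<m}) = (\<Sum>S\<in>Pow {..<m}. A (?v S (z(m := y))))"
        by (intro sum.cong refl arg_cong[of _ _ A]) (auto simp: fun_eq_iff less_Suc_eq)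
      finally show ?thesis by (simp add: add.commute)
    qed
    finally show ?case .
  qed simp
  from this[of n "\<lambda>i. x"] have "A (\<lambda>i. if i < n then x + y else x) =
      (\<Sum>S\<in>Pow {..<n}. A (\<lambda>i. if i < n then if i \<in> S then x else y else x))" by simp
  moreover have "A (\<lambda>i. if i < n then x + y else x) = A (\<lambda>i. x + y)"
    by (rule multilinearD(1)[OF A]) simp
  moreover have "A (\<lambda>i. if i < n then if i \<in> S then x else y else x) = A (\<lambda>i. if i \<in> S then x else y)" for S
    by (rule multilinearD(1)[OF A]) simp
  ultimately show ?thesis by simp
qed

lemma multilinear_add:
  assumes A: "multilinear sE sF n A" and B: "multilinear sE sF n B"
  shows "multilinear sE sF n (\<lambda>x. A x + B x)"
proof (rule multilinearI)
  show "A x + B x = A y + B y" if "\<And>i. i < n \<Longrightarrow> x i = y i" for x y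
    using multilinearD(1)[OF A, of x y] multilinearD(1)[OF B, of x y] that by simp
qed (simp_all add: multilinearD(2,3)[OF A] multilinearD(2,3)[OF B] F.scale_right_distrib)

lemma multilinear_zero: "multilinear sE sF n (\<lambda>x. 0)"
  by (rule multilinearI) auto

lemma multilinear_scale:
  assumes A: "multilinear sE sF n A"
  shows "multilinear sE sF n (\<lambda>x. sF c (A x))"
proof (rule multilinearI)
  show "sF c (A x) = sF c (A y)" if "\<And>i. i < n \<Longrightarrow> x i = y i" for x y
    using multilinearD(1)[OF A, of x y] that by simp
qed (simp_all add: multilinearD(2,3)[OF A] F.scale_right_distrib mult.commute)

lemma multilinear_sum:
  "(\<And>S. S \<in> I \<Longrightarrow> multilinear sE sF n (A S)) \<Longrightarrow> multilinear sE sF n (\<lambda>x. \<Sum>S\<in>I. A S x)"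
  by (induction I rule: infinite_finite_induct) (auto intro: multilinear_add multilinear_zero)

text \<open>The slots in \<open>S\<close> stay free and the others are frozen at \<open>y\<close>.
  The renumbering \<open>h\<close> is forced by the convention that a \<open>k\<close>-linear map
  reads the entries below \<open>k\<close>.\<close>

lemma multilinear_partial:
  assumes A: "multilinear sE sF n A" and S: "S \<subseteq> {..<n}" and h: "bij_betw h S {0..<k}"
  shows "multilinear sE sF k (\<lambda>w. A (\<lambda>i. if i \<in> S then w (h i) else y))"
proof -
  have upd: "(\<lambda>i. if i \<in> S then (w(l := v)) (h i) else y) =
      (\<lambda>i. if i \<in> S then w (h i) else y)(the_inv_into S h l := v)"
    and S': "the_inv_into S h l < n" if "l < k" for w l v
  proof -
    have l: "l \<in> h ` S" using h that by (auto simp: bij_betw_def)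
    have inj: "inj_on h S" using h by (auto simp: bij_betw_def)
    have "the_inv_into S h l \<in> S" using the_inv_into_into[OF inj l] by simp
    moreover have "h (the_inv_into S h l) = l" using f_the_inv_into_f[OF inj l] .
    moreover have "h i = l \<longleftrightarrow> i = the_inv_into S h l" if "i \<in> S" for i
      using the_inv_into_f_f[OF inj that] calculation by auto
    ultimately show "(\<lambda>i. if i \<in> S then (w(l := v)) (h i) else y) =
        (\<lambda>i. if i \<in> S then w (h i) else y)(the_inv_into S h l := v)" "the_inv_into S h l < n"
      using S by (auto simp: fun_eq_iff)
  qed
  show ?thesis
  proof (rule multilinearI)
    fix x z :: "nat \<Rightarrow> 'a" assume eq: "\<And>i. i < k \<Longrightarrow> x i = z i"
    have "h i < k" if "i \<in> S" for i using h that by (auto simp: bij_betw_def)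
    then show "A (\<lambda>i. if i \<in> S then x (h i) else y) = A (\<lambda>i. if i \<in> S then z (h i) else y)"
      using eq by (intro multilinearD(1)[OF A]) simp
  qed (simp_all only: upd S' multilinearD(2,3)[OF A])
qed

section \<open>The normed space of continuous homogeneous polynomials\<close>

lemma homI: "continuous_on UNIV P \<Longrightarrow> multilinear sE sF n A \<Longrightarrow> (\<And>x. P x = A (\<lambda>i. x)) \<Longrightarrow> P \<in> hom n"
  unfolding hom_polys_def by blast

lemma hom_continuous: "P \<in> hom n \<Longrightarrow> continuous_on UNIV P"
  by (simp add: hom_polys_def)

lemma hom_multilinear: "P \<in> hom n \<Longrightarrow> \<exists>A. multilinear sE sF n A \<and> (\<forall>x. P x = A (\<lambda>i. x))"
  by (simp add: hom_polys_def)

lemma hom_tendsto: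
  assumes "P \<in> hom n" "(z \<longlongrightarrow> x) G"
  shows "((\<lambda>i. P (z i)) \<longlongrightarrow> P x) G"
proof -
  have "isCont P x" using hom_continuous[OF assms(1)] by (simp add: continuous_on_eq_continuous_at)
  then show ?thesis using assms(2) by (rule isCont_tendsto_compose)
qed

lemma hom_scale:
  assumes "P \<in> hom n"
  shows "P (sE c x) = sF (c ^ n) (P x)"
proof -
  obtain A where A: "multilinear sE sF n A" "\<And>x. P x = A (\<lambda>i. x)" using hom_multilinear[OF assms] by blast
  show ?thesis unfolding A(2) by (rule multilinear_diag_scale[OF A(1)])
qed

lemma hom_scaleR: "P \<in> hom n \<Longrightarrow> P (r *\<^sub>R x) = r ^ n *\<^sub>R P x"
  using hom_scale[of P n "of_real r" x] by (simp add: E.scale_of_real F.scale_of_real flip: of_real_power)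

lemma hom_degree_0: "P \<in> hom 0 \<Longrightarrow> P x = P 0"
  using hom_scale[of P 0 0 x] by simp

lemma hom_zero: "P \<in> hom n \<Longrightarrow> n \<ge> 1 \<Longrightarrow> P 0 = 0"
  using hom_scale[of P n 0 0] by (simp add: power_0_left)

lemma hom_compose:
  assumes P: "P \<in> hom n" and T: "T \<in> E.ops"
  shows "(\<lambda>x. P (T x)) \<in> hom n"
proof -
  obtain A where A: "multilinear sE sF n A" "\<And>x. P x = A (\<lambda>i. x)" using hom_multilinear[OF P] by blast
  have upd: "(\<lambda>j. T ((x(i := y)) j)) = (\<lambda>j. T (x j))(i := T y)" for x i y by auto
  show ?thesis
  proof (rule homI)
    show "continuous_on UNIV (\<lambda>x. P (T x))"
      using continuous_on_compose2[OF hom_continuous[OF P] linear_continuous_on[OF E.ops_bounded_linear[OF T]]]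
      by simp
    show "multilinear sE sF n (\<lambda>x. A (\<lambda>j. T (x j)))"
    proof (rule multilinearI)
      show "A (\<lambda>j. T (x j)) = A (\<lambda>j. T (y j))" if "\<And>i. i < n \<Longrightarrow> x i = y i" for x y
        using that by (intro multilinearD(1)[OF A(1)]) simp
    qed (simp_all only: upd E.ops_add[OF T] E.ops_scale[OF T] multilinearD(2,3)[OF A(1)])
  qed (simp add: A(2))
qed

lemma hom_module: "module (fun_scale sF :: 'k \<Rightarrow> ('a \<Rightarrow> 'b) \<Rightarrow> 'a \<Rightarrow> 'b)"
  by (rule module_fun_scale) unfold_locales

lemma hom_add:
  assumes "P \<in> hom n" "Q \<in> hom n"
  shows "P + Q \<in> hom n"
proof -
  obtain A where A: "multilinear sE sF n A" "\<And>x. P x = A (\<lambda>i. x)" using hom_multilinear[OF assms(1)] by blast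
  obtain B where B: "multilinear sE sF n B" "\<And>x. Q x = B (\<lambda>i. x)" using hom_multilinear[OF assms(2)] by blast
  show ?thesis
    by (rule homI[OF _ multilinear_add[OF A(1) B(1)]])
      (use assms[THEN hom_continuous] A(2) B(2) in \<open>auto simp: plus_fun_def intro: continuous_on_add\<close>)
qed

lemma hom_fun_scale:
  assumes "P \<in> hom n"
  shows "fun_scale sF c P \<in> hom n"
proof -
  obtain A where A: "multilinear sE sF n A" "\<And>x. P x = A (\<lambda>i. x)" using hom_multilinear[OF assms] by blast
  have "continuous_on UNIV (\<lambda>x. sF c (P x))"
    by (rule bounded_linear.continuous_on[OF F.bounded_linear_scale hom_continuous[OF assms]])
  then show ?thesis
    using A(2) by (intro homI[OF _ multilinear_scale[OF A(1)]]) (auto simp: fun_scale_def)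
qed

lemma hom_subspace: "module.subspace (fun_scale sF) (hom n)"
proof -
  interpret module "fun_scale sF :: 'k \<Rightarrow> ('a \<Rightarrow> 'b) \<Rightarrow> 'a \<Rightarrow> 'b" by (rule hom_module)
  show ?thesis
  proof (rule subspaceI)
    show "0 \<in> hom n" by (rule homI[OF _ multilinear_zero]) (simp_all add: zero_fun_def)
  qed (intro hom_add hom_fun_scale; assumption)+
qed

lemma hom_diff: "P \<in> hom n \<Longrightarrow> Q \<in> hom n \<Longrightarrow> P - Q \<in> hom n"
  by (rule module.subspace_diff[OF hom_module hom_subspace])

lemma hom_bdd_above:
  assumes P: "P \<in> hom n"
  shows "bdd_above ((\<lambda>x. norm (P x)) ` cball 0 1)"
proof -
  have "isCont P 0" using hom_continuous[OF P] by (simp add: continuous_on_eq_continuous_at)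
  then obtain d where d: "d > 0" "\<And>x. norm x < d \<Longrightarrow> norm (P x - P 0) < 1"
    unfolding continuous_at_eps_delta dist_norm by (auto dest: spec[where x=1])
  have "norm (P x) \<le> (norm (P 0) + 1) / (d / 2) ^ n" if x: "norm x \<le> 1" for x
  proof -
    have "norm ((d / 2) *\<^sub>R x) \<le> (d / 2) * 1" using x d(1) by (simp add: mult_left_mono)
    then have "norm ((d / 2) *\<^sub>R x) < d" using d(1) by simp
    then have "norm (P ((d / 2) *\<^sub>R x) - P 0) < 1" by (rule d(2))
    then have "norm (P ((d / 2) *\<^sub>R x)) \<le> norm (P 0) + 1"
      using norm_triangle_ineq2[of "P ((d / 2) *\<^sub>R x)" "P 0"] by linarith
    moreover have "norm (P ((d / 2) *\<^sub>R x)) = (d / 2) ^ n * norm (P x)"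
      using d(1) by (simp add: hom_scaleR[OF P])
    ultimately show ?thesis using d(1) by (simp only: pos_le_divide_eq zero_less_power half_gt_zero) (simp add: mult.commute)
  qed
  then show ?thesis by (intro bdd_aboveI2) simp
qed

lemma poly_norm_ball: "P \<in> hom n \<Longrightarrow> norm x \<le> 1 \<Longrightarrow> norm (P x) \<le> poly_norm P"
  unfolding poly_norm_def by (rule cSUP_upper[OF _ hom_bdd_above]) auto

lemma poly_norm_nonneg: "P \<in> hom n \<Longrightarrow> 0 \<le> poly_norm P"
  by (rule order_trans[OF norm_ge_zero poly_norm_ball[of P n 0]]) auto

lemma poly_norm_le: "(\<And>x. norm x \<le> 1 \<Longrightarrow> norm (P x) \<le> C) \<Longrightarrow> poly_norm P \<le> C"
  unfolding poly_norm_def by (rule cSUP_least) auto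

lemma poly_norm_bound:
  assumes P: "P \<in> hom n"
  shows "norm (P x) \<le> poly_norm P * norm x ^ n"
proof (cases "x = 0")
  case True
  then show ?thesis
    using poly_norm_ball[OF P, of 0] hom_zero[OF P] by (cases n) auto
next
  case False
  have "P x = P (norm x *\<^sub>R (inverse (norm x) *\<^sub>R x))" using False by simp
  also have "\<dots> = norm x ^ n *\<^sub>R P (inverse (norm x) *\<^sub>R x)" by (rule hom_scaleR[OF P])
  finally have "norm (P x) = norm x ^ n * norm (P (inverse (norm x) *\<^sub>R x))" by simp
  also have "\<dots> \<le> norm x ^ n * poly_norm P"
    using False by (intro mult_left_mono poly_norm_ball[OF P]) auto
  finally show ?thesis by (simp add: mult.commute)
qed

lemma poly_norm_small:
  assumes "e > 0"
  obtains d where "d > 0" "\<And>P x. P \<in> hom n \<Longrightarrow> poly_norm P < d \<Longrightarrow> norm x \<le> C \<Longrightarrow> norm (P x) \<le> e"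
proof -
  define D where "D = max C 1"
  have D: "D > 0" "C \<le> D" by (auto simp: D_def)
  show ?thesis
  proof (rule that)
    show "e / D ^ n > 0" using assms D by simp
    fix P :: "'a \<Rightarrow> 'b" and x :: 'a
    assume P: "P \<in> hom n" "poly_norm P < e / D ^ n" "norm x \<le> C"
    have "norm (P x) \<le> poly_norm P * norm x ^ n" by (rule poly_norm_bound[OF P(1)])
    also have "\<dots> \<le> e / D ^ n * D ^ n"
      using P D assms by (intro mult_mono power_mono) auto
    finally show "norm (P x) \<le> e" using D by simp
  qed
qed

lemma normed_carrier_hom: "normed_carrier (fun_scale sF) (hom n) poly_norm"
proof (rule normed_carrierI[OF hom_module hom_subspace])
  show "0 \<le> poly_norm P" if "P \<in> hom n" for P using that by (rule poly_norm_nonneg)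
  show "poly_norm (P + Q) \<le> poly_norm P + poly_norm Q" if "P \<in> hom n" "Q \<in> hom n" for P Q
    by (rule poly_norm_le)
      (auto intro!: norm_triangle_le add_mono poly_norm_ball[OF that(1)] poly_norm_ball[OF that(2)])
  show "poly_norm (fun_scale sF c P) \<le> norm c * poly_norm P" if P: "P \<in> hom n" for c P
    by (rule poly_norm_le) (auto simp: fun_scale_def F.norm_scale intro: mult_left_mono poly_norm_ball[OF P])
qed

text \<open>\<open>R k\<close> collects the terms in which exactly \<open>k\<close> slots hold
  \<open>x\<close>; summing over all such sets of slots takes the place of a binomial coefficient
  times a symmetric form.\<close>

theorem hom_expansion:
  assumes P: "P \<in> hom n"
  shows "\<exists>R. (\<forall>k\<le>n. \<forall>y. (\<lambda>x. R k x y) \<in> hom k) \<and> (\<forall>x y. R n x y = P x) \<and>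
    (\<forall>x y. P (x + y) = (\<Sum>k\<le>n. R k x y))"
proof -
  obtain A where A: "multilinear sE sF n A" "\<And>x. P x = A (\<lambda>i. x)" using hom_multilinear[OF P] by blast
  define sub where "sub k = {S \<in> Pow {..<n}. card S = k}" for k
  define R where "R k x y = (\<Sum>S\<in>sub k. A (\<lambda>i. if i \<in> S then x else y))" for k x y
  have fin: "finite S" if "S \<in> Pow {..<n}" for S using that finite_subset by blast
  have R_sum: "P (x + y) = (\<Sum>k\<le>n. R k x y)" for x y
  proof -
    have "Pow {..<n} = (\<Union>k\<le>n. sub k)"
      using card_mono[of "{..<n}"] by (auto simp: sub_def)
    moreover have "sum f (\<Union>k\<le>n. sub k) = (\<Sum>k\<le>n. sum f (sub k))" for f :: "nat set \<Rightarrow> 'b"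
      by (rule sum.UNION_disjoint) (auto simp: sub_def)
    ultimately show ?thesis using multilinear_diag_add[OF A(1), of x y] A(2) by (simp add: R_def)
  qed
  have R_top: "R n x y = P x" for x y
  proof -
    have "sub n = {{..<n}}"
      using card_subset_eq[of "{..<n}"] by (auto simp: sub_def)
    moreover have "A (\<lambda>i. if i \<in> {..<n} then x else y) = A (\<lambda>i. x)"
      by (rule multilinearD(1)[OF A(1)]) simp
    ultimately show ?thesis using A(2) by (simp add: R_def)
  qed
  have R_multi: "\<exists>B. multilinear sE sF k B \<and> (\<forall>x. R k x y = B (\<lambda>i. x))" for k y
  proof -
    have "\<exists>h. bij_betw h S {0..<k}" if "S \<in> sub k" for S
      using ex_bij_betw_finite_nat[of S] that fin by (auto simp: sub_def)
    then obtain h where h: "\<And>S. S \<in> sub k \<Longrightarrow> bij_betw (h S) S {0..<k}" by metis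
    have "multilinear sE sF k (\<lambda>w. \<Sum>S\<in>sub k. A (\<lambda>i. if i \<in> S then w (h S i) else y))"
      by (intro multilinear_sum multilinear_partial[OF A(1) _ h]) (auto simp: sub_def)
    then show ?thesis
      by (intro exI[of _ "\<lambda>w. \<Sum>S\<in>sub k. A (\<lambda>i. if i \<in> S then w (h S i) else y)"]) (simp add: R_def)
  qed
  have R_scale: "R k (t *\<^sub>R x) y = t ^ k *\<^sub>R R k x y" for k t x y
  proof -
    obtain B where B: "multilinear sE sF k B" "\<And>x. R k x y = B (\<lambda>i. x)" using R_multi by blast
    have "R k (sE (of_real t) x) y = sF (of_real t ^ k) (R k x y)"
      unfolding B(2) by (rule multilinear_diag_scale[OF B(1)])
    then show ?thesis by (simp add: E.scale_of_real F.scale_of_real flip: of_real_power)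
  qed
  have "(\<lambda>x. R k x y) \<in> hom k" if k: "k \<le> n" for k y
  proof -
    \<comment> \<open>Only \<open>P\<close> is known to be continuous, not the multilinear map. But
      \<open>R k\<close> is a coefficient in \<open>t\<close> of
      \<open>P (t *\<^sub>R x + y)\<close>, and these functions of \<open>x\<close> are
      continuous.\<close>
    have "continuous_on UNIV (\<lambda>x. R k x y)"
    proof (rule coefficients_in_class[where Q="continuous_on UNIV" and r="\<lambda>k x. R k x y", OF _ _ _ k])
      fix t :: real
      have "continuous_on UNIV (\<lambda>x. P (t *\<^sub>R x + y))"
        by (intro continuous_on_compose2[OF hom_continuous[OF P]] continuous_intros) auto
      then show "continuous_on UNIV (\<lambda>x. \<Sum>k\<le>n. t ^ k *\<^sub>R R k x y)"
        by (simp add: R_sum R_scale)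
    qed (auto intro: continuous_intros)
    moreover obtain B where "multilinear sE sF k B" "\<forall>x. R k x y = B (\<lambda>i. x)" using R_multi by blast
    ultimately show ?thesis by (intro homI) auto
  qed
  then show ?thesis using R_top R_sum by blast
qed

text \<open>The coefficients of the expansion are bounded on products of balls, by the same
  extraction argument as their continuity. In the difference the top coefficient cancels, and each
  of the others carries a positive power of the norm of \<open>d\<close>.\<close>

lemma hom_lipschitz:
  assumes P: "P \<in> hom n"
  shows "\<exists>L. \<forall>b d. norm b \<le> C \<longrightarrow> norm d \<le> 1 \<longrightarrow> norm (P (b + d) - P b) \<le> L * norm d"
proof -
  obtain R where R: "\<And>k y. k \<le> n \<Longrightarrow> (\<lambda>x. R k x y) \<in> hom k" "\<And>x y. R n x y = P x"
    "\<And>x y. P (x + y) = (\<Sum>k\<le>n. R k x y)" using hom_expansion[OF P] by blast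
  define B where "B = cball (0::'a) C \<times> cball (0::'a) 1"
  have R_scale: "R k (t *\<^sub>R x) y = t ^ k *\<^sub>R R k x y" if "k \<le> n" for k t x y
    using hom_scaleR[OF R(1)[OF that]] .
  have "bounded ((\<lambda>p. R k (fst p) (snd p)) ` B)" if k: "k \<le> n" for k
  proof (rule coefficients_in_class[where Q="\<lambda>f. bounded (f ` B)" and r="\<lambda>k p. R k (fst p) (snd p)", OF _ _ _ k])
    fix f g :: "'a \<times> 'a \<Rightarrow> 'b" assume "bounded (f ` B)" "bounded (g ` B)"
    then show "bounded ((\<lambda>x. f x + g x) ` B)" by (rule bounded_plus_comp)
  next
    fix c :: real and f :: "'a \<times> 'a \<Rightarrow> 'b" assume "bounded (f ` B)"
    then show "bounded ((\<lambda>x. c *\<^sub>R f x) ` B)" by (rule bounded_scaleR_comp)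
  next
    fix t :: real
    have "norm (P (t *\<^sub>R x + y)) \<le> poly_norm P * (\<bar>t\<bar> * C + 1) ^ n" if "norm x \<le> C" "norm y \<le> 1" for x y
    proof -
      have "norm (t *\<^sub>R x + y) \<le> \<bar>t\<bar> * C + 1"
        using that by (intro norm_triangle_le add_mono) (auto simp: mult_left_mono)
      then have "poly_norm P * norm (t *\<^sub>R x + y) ^ n \<le> poly_norm P * (\<bar>t\<bar> * C + 1) ^ n"
        by (intro mult_left_mono power_mono poly_norm_nonneg[OF P]) auto
      then show ?thesis using poly_norm_bound[OF P, of "t *\<^sub>R x + y"] by simp
    qed
    then have "bounded ((\<lambda>p. P (t *\<^sub>R fst p + snd p)) ` B)"
      unfolding bounded_iff
      by (intro exI[of _ "poly_norm P * (\<bar>t\<bar> * C + 1) ^ n"]) (auto simp: B_def)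
    then show "bounded ((\<lambda>p. \<Sum>k\<le>n. t ^ k *\<^sub>R R k (fst p) (snd p)) ` B)"
      by (simp add: R(3) R_scale)
  qed
  then have "\<forall>k\<in>{..n}. \<exists>M. \<forall>p\<in>B. norm (R k (fst p) (snd p)) \<le> M" by (simp add: bounded_iff)
  then obtain M where M: "\<And>k p. k \<le> n \<Longrightarrow> p \<in> B \<Longrightarrow> norm (R k (fst p) (snd p)) \<le> M k"
    by (metis atMost_iff)
  show ?thesis
  proof (intro exI allI impI)
    fix b d :: 'a assume b: "norm b \<le> C" and d: "norm d \<le> 1"
    show "norm (P (b + d) - P b) \<le> (\<Sum>k<n. M k) * norm d"
    proof (cases "d = 0")
      case True
      then show ?thesis by simp
    next
      case False
      \<comment> \<open>The expansion has been shown homogeneous in its first argument only. Writing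
        \<open>b + d\<close> as \<open>\<tau>\<close> times \<open>b / \<tau> + e\<close> with a
        unit vector \<open>e\<close> moves the scaling there and leaves the powers
        \<open>\<tau> ^ (n - k)\<close>.\<close>
      define \<tau> e where "\<tau> = norm d" and "e = inverse (norm d) *\<^sub>R d"
      have \<tau>: "0 < \<tau>" "\<tau> \<le> 1" using False d by (auto simp: \<tau>_def)
      have "b + d = \<tau> *\<^sub>R (inverse \<tau> *\<^sub>R b + e)"
        using False by (simp add: \<tau>_def e_def scaleR_add_right)
      then have "P (b + d) = \<tau> ^ n *\<^sub>R P (inverse \<tau> *\<^sub>R b + e)" using hom_scaleR[OF P] by simp
      also have "\<dots> = (\<Sum>k\<le>n. \<tau> ^ (n - k) *\<^sub>R R k b e)"
        unfolding R(3) scaleR_sum_right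
      proof (rule sum.cong)
        fix k assume "k \<in> {..n}"
        then have "\<tau> ^ n * inverse \<tau> ^ k = \<tau> ^ (n - k)"
          using \<tau> by (simp add: power_diff power_inverse divide_inverse)
        then show "\<tau> ^ n *\<^sub>R R k (inverse \<tau> *\<^sub>R b) e = \<tau> ^ (n - k) *\<^sub>R R k b e"
          using R_scale[of k "inverse \<tau>" b e] \<open>k \<in> _\<close> by simp
      qed simp
      also have "\<dots> = (\<Sum>k<n. \<tau> ^ (n - k) *\<^sub>R R k b e) + P b"
        by (simp add: R(2) lessThan_Suc_atMost[symmetric])
      finally have "P (b + d) - P b = (\<Sum>k<n. \<tau> ^ (n - k) *\<^sub>R R k b e)" by simp
      then have "norm (P (b + d) - P b) \<le> (\<Sum>k<n. norm (\<tau> ^ (n - k) *\<^sub>R R k b e))"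
        by (simp only: norm_sum)
      also have "\<dots> \<le> (\<Sum>k<n. M k * \<tau>)"
      proof (rule sum_mono)
        fix k assume k: "k \<in> {..<n}"
        have "\<tau> ^ (n - k) \<le> \<tau> ^ 1" using k \<tau> by (intro power_decreasing) auto
        moreover have "norm (R k b e) \<le> M k"
          using M[of k "(b, e)"] k b False by (simp add: B_def e_def)
        ultimately have "\<tau> ^ (n - k) * norm (R k b e) \<le> \<tau> ^ 1 * M k"
          using \<tau> by (intro mult_mono) auto
        then show "norm (\<tau> ^ (n - k) *\<^sub>R R k b e) \<le> M k * \<tau>"
          using \<tau> by (simp add: mult.commute)
      qed
      finally show ?thesis by (simp add: sum_distrib_right \<tau>_def)
    qed
  qed
qed

lemma hom_uniformly_continuous:
  assumes P: "P \<in> hom n" and b: "eventually (\<lambda>i. norm (b i) \<le> C) G"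
    and ab: "((\<lambda>i. a i - b i) \<longlongrightarrow> 0) G"
  shows "((\<lambda>i. P (a i) - P (b i)) \<longlongrightarrow> 0) G"
proof -
  obtain L where L: "\<And>b d. norm b \<le> C \<Longrightarrow> norm d \<le> 1 \<Longrightarrow> norm (P (b + d) - P b) \<le> L * norm d"
    using hom_lipschitz[OF P] by blast
  show ?thesis
  proof (rule Lim_null_comparison)
    have "eventually (\<lambda>i. norm (a i - b i) < 1) G"
      using ab by (rule tendsto_zero_norm_less) simp
    with b show "eventually (\<lambda>i. norm (P (a i) - P (b i)) \<le> L * norm (a i - b i)) G"
    proof eventually_elim
      case (elim i)
      then show ?case using L[of "b i" "a i - b i"] by simp
    qed
    show "((\<lambda>i. L * norm (a i - b i)) \<longlongrightarrow> 0) G"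
      using tendsto_mult_left[OF tendsto_norm[OF ab], of L] by simp
  qed
qed

end


section \<open>Weakly continuous polynomials\<close>

text \<open>Property (M) in the form used below, for families instead of filters on the space. The
  margin \<open>e\<close> pays for turning an upper limit back into an eventual bound.\<close>

lemma property_M_family:
  assumes M: "property_M s" and le: "norm x \<le> norm x'"
    and g: "eventually (\<lambda>i. norm (g i) \<le> C) G" and weak: "weakly_converges s (filtermap g G) 0"
    and c: "eventually (\<lambda>i. norm (x' + g i) \<le> c) G" and e: "e > 0"
  shows "eventually (\<lambda>i. norm (x + g i) \<le> c + e) G"
proof -
  let ?G = "filtermap g G"
  have "Bfun (\<lambda>y. y) ?G"
    by (rule BfunI[where K=C]) (simp add: eventually_filtermap g)
  then have "Limsup ?G (\<lambda>y. ereal (norm (x + y))) \<le> Limsup ?G (\<lambda>y. ereal (norm (x' + y)))"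
    using M le weak unfolding property_M_def by blast
  also have "\<dots> \<le> ereal c"
    by (rule Limsup_bounded) (simp add: eventually_filtermap c)
  also have "\<dots> < ereal (c + e)" using e by simp
  finally have "eventually (\<lambda>y. ereal (norm (x + y)) < ereal (c + e)) ?G"
    by (rule Limsup_lessD)
  then have "eventually (\<lambda>i. ereal (norm (x + g i)) < ereal (c + e)) G"
    by (simp add: eventually_filtermap)
  then show ?thesis by eventually_elim simp
qed

lemma below_critical_degree:
  assumes "1 \<le> k" "enat k < critical_degree sE sF"
  shows "weakly_cont_polys sE sF k = hom_polys sE sF k"
proof (rule ccontr)
  assume "\<not> ?thesis"
  then have "critical_degree sE sF \<le> enat k"
    unfolding critical_degree_def using assms(1) by (intro INF_lower) simp
  then show False using assms(2) by simp
qed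

lemma critical_degree_ge_1: "1 \<le> critical_degree sE sF"
  unfolding critical_degree_def by (rule INF_greatest) (simp add: one_enat_def)

context banach_over
begin

lemma diff_id_ops: "T \<in> ops \<Longrightarrow> (\<lambda>x. x - T x) \<in> ops"
proof (rule opsI)
  fix x assume T: "T \<in> ops"
  show "norm (x - T x) \<le> (1 + onorm T) * norm x"
    using norm_triangle_ineq4[of x "T x"] ops_bound[OF T, of x] by (simp add: distrib_right)
qed (simp_all add: ops_add ops_scale scale_right_diff_distrib)

lemma weakly_converges_shift:
  "weakly_converges scale (filtermap z G) x \<Longrightarrow> weakly_converges scale (filtermap (\<lambda>i. z i + y) G) (x + y)"
  unfolding weakly_converges_filtermap by (auto simp: E.dual_add intro!: tendsto_add)

lemma compact_weak_tendsto:
  assumes K: "K \<in> cops" and z: "eventually (\<lambda>i. norm (z i) \<le> C) G"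
    and weak: "weakly_converges scale (filtermap z G) x"
  shows "((\<lambda>i. K (z i - x)) \<longlongrightarrow> 0) G" "((\<lambda>i. K (z i)) \<longlongrightarrow> K x) G"
proof -
  have "weakly_converges scale (filtermap (\<lambda>i. z i + - x) G) (x + - x)"
    by (rule weakly_converges_shift[OF weak])
  then have null: "weakly_converges scale (filtermap (\<lambda>i. z i - x) G) 0" by simp
  have bound: "eventually (\<lambda>i. norm (z i - x) \<le> C + norm x) G"
    using z by eventually_elim (rule norm_triangle_le_diff, simp)
  show "((\<lambda>i. K (z i - x)) \<longlongrightarrow> 0) G" by (rule compact_weakly_null[OF K bound null])
  then show "((\<lambda>i. K (z i)) \<longlongrightarrow> K x) G" by (simp add: ops_diff[OF comp_ops[OF K]] LIM_zero_iff)
qed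

text \<open>K* f tends to f in norm, hence uniformly on the ball, so the vector may depend on
  \<open>K\<close>. The bound 3 is 1 for \<open>x K\<close> plus 2 for its image, as eventually
  \<open>onorm K \<le> 2\<close>.\<close>

lemma residual_weakly_null:
  assumes G: "approximating G" and x: "\<And>K. norm (x K) \<le> 1"
  shows "eventually (\<lambda>K. norm (x K - K (x K)) \<le> 3) G"
    and "weakly_converges scale (filtermap (\<lambda>K. x K - K (x K)) G) 0"
proof -
  show "eventually (\<lambda>K. norm (x K - K (x K)) \<le> 3) G"
    using approximatingD(2)[OF G] approximatingD(3)[OF G zero_less_one]
  proof eventually_elim
    case (elim K)
    have "norm (K (x K)) \<le> onorm K * norm (x K)" by (rule ops_bound[OF comp_ops[OF elim(1)]])
    also have "\<dots> \<le> 2 * 1"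
      using elim x[of K] onorm_nonneg[OF comp_ops[OF elim(1)]] by (intro mult_mono) auto
    finally show ?case using norm_triangle_ineq4[of "x K" "K (x K)"] x[of K] by simp
  qed
  show "weakly_converges scale (filtermap (\<lambda>K. x K - K (x K)) G) 0"
    unfolding weakly_converges_filtermap
  proof
    fix f assume f: "f \<in> E.dual"
    have "eventually (\<lambda>K. norm (f (x K - K (x K))) < e) G" if e: "e > 0" for e
    proof -
      have e2: "e / 2 > 0" using e by simp
      show ?thesis
        using approximatingD(5)[OF G f e2]
      proof eventually_elim
        case (elim K)
        have "norm (f (x K - K (x K))) \<le> e / 2 * norm (x K)" using elim by blast
        also have "\<dots> \<le> e / 2 * 1" using e x[of K] by (intro mult_left_mono) auto
        finally show ?case using e by simp
      qed
    qed
    then show "((\<lambda>K. f (x K - K (x K))) \<longlongrightarrow> f 0) G"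
      by (simp add: tendsto_iff E.dual_zero[OF f])
  qed
qed

end

context polynomial_spaces
begin

section \<open>Weak continuity on bounded sets below and at the critical degree\<close>

lemma wc_hom: "P \<in> wc n \<Longrightarrow> P \<in> hom n"
  by (simp add: weakly_cont_polys_def)

lemma wc_tendsto:
  assumes P: "P \<in> wc n" and z: "eventually (\<lambda>i. norm (z i) \<le> C) G"
    and weak: "weakly_converges sE (filtermap z G) x"
  shows "((\<lambda>i. P (z i)) \<longlongrightarrow> P x) G"
proof -
  have "Bfun (\<lambda>y. y) (filtermap z G)"
    by (rule BfunI[where K=C]) (simp add: eventually_filtermap z)
  then have "((\<lambda>y. norm (P y - P x)) \<longlongrightarrow> 0) (filtermap z G)"
    using P weak unfolding weakly_cont_polys_def by blast
  then show ?thesis by (simp add: filterlim_filtermap tendsto_norm_zero_iff LIM_zero_iff)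
qed

lemma wcI:
  assumes "P \<in> hom n"
    and "\<And>G x C. eventually (\<lambda>y. norm y \<le> C) G \<Longrightarrow> weakly_converges sE G x \<Longrightarrow> (P \<longlongrightarrow> P x) G"
  shows "P \<in> wc n"
  unfolding weakly_cont_polys_def
proof (intro CollectI conjI allI impI assms(1))
  fix G x assume G: "Bfun (\<lambda>y. y) G \<and> weakly_converges sE G x"
  then obtain C where "eventually (\<lambda>y. norm y \<le> C) G" by (auto elim: BfunE)
  then have "(P \<longlongrightarrow> P x) G" using assms(2) G by blast
  then show "((\<lambda>y. norm (P y - P x)) \<longlongrightarrow> 0) G" by (simp add: tendsto_norm_zero_iff LIM_zero_iff)
qed

text \<open>What the minimality of the critical degree provides. As there, degrees start at 1; the
  constant terms of expansions are treated separately.\<close>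

definition low :: "nat \<Rightarrow> bool" where
  "low n \<longleftrightarrow> (\<forall>k. 1 \<le> k \<longrightarrow> k < n \<longrightarrow> hom k \<subseteq> wc k)"

lemma lowD: "low n \<Longrightarrow> 1 \<le> k \<Longrightarrow> k < n \<Longrightarrow> P \<in> hom k \<Longrightarrow> P \<in> wc k"
  unfolding low_def by blast

text \<open>\<open>P\<close> need not be weakly continuous, but in \<open>P (w + y) - P w\<close>
  the top term of the expansion cancels and only degrees below \<open>n\<close> remain.\<close>

lemma difference_tendsto:
  assumes n: "low n" and P: "P \<in> hom n" and z: "eventually (\<lambda>i. norm (z i) \<le> C) G"
    and weak: "weakly_converges sE (filtermap z G) x"
  shows "((\<lambda>i. P (z i + y) - P (z i)) \<longlongrightarrow> P (x + y) - P x) G"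
proof -
  obtain R where R: "\<And>k y. k \<le> n \<Longrightarrow> (\<lambda>x. R k x y) \<in> hom k" "\<And>x y. R n x y = P x"
    "\<And>x y. P (x + y) = (\<Sum>k\<le>n. R k x y)" using hom_expansion[OF P] by blast
  have eq: "P (w + y) - P w = (\<Sum>k<n. R k w y)" for w
    by (simp add: R(2,3) lessThan_Suc_atMost[symmetric])
  have "((\<lambda>i. R k (z i) y) \<longlongrightarrow> R k x y) G" if k: "k < n" for k
  proof (cases "k = 0")
    case True
    then have "R k w y = R k 0 y" for w using hom_degree_0[of "\<lambda>x. R k x y" w] R(1)[of k y] by simp
    then have "R k (z i) y = R k x y" for i by metis
    then show ?thesis by simp
  next
    case False
    then have "(\<lambda>x. R k x y) \<in> wc k" using R(1)[of k y] k by (intro lowD[OF n]) auto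
    from wc_tendsto[OF this z weak] show ?thesis .
  qed
  then show ?thesis unfolding eq by (intro tendsto_sum) auto
qed

text \<open>When \<open>y\<close> tends weakly to \<open>x\<close>, \<open>K y\<close> tends to
  \<open>K x\<close> in norm. By uniform continuity on bounded sets \<open>P (y - K y)\<close> may
  be replaced by \<open>P (y - K x)\<close>, and this is a shift by a fixed vector.\<close>

lemma difference_compact_wc:
  assumes n: "low n" and P: "P \<in> hom n" and K: "K \<in> E.cops"
  shows "P - (\<lambda>x. P (x - K x)) \<in> wc n"
proof (rule wcI)
  have K': "K \<in> E.ops" using K by (rule E.comp_ops)
  show "P - (\<lambda>x. P (x - K x)) \<in> hom n"
    by (rule hom_diff[OF P hom_compose[OF P E.diff_id_ops[OF K']]])
  fix G x C assume bd: "eventually (\<lambda>y. norm y \<le> C) G" and weak: "weakly_converges sE G x"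
  have weak': "weakly_converges sE (filtermap (\<lambda>y. y) G) x" using weak by simp
  have Kx: "((\<lambda>y. K (y - x)) \<longlongrightarrow> 0) G" by (rule E.compact_weak_tendsto(1)[OF K bd weak'])
  have near: "((\<lambda>y. (y - K x) - (y - K y)) \<longlongrightarrow> 0) G"
    using Kx by (simp add: E.ops_diff[OF K'])
  have bound: "eventually (\<lambda>y. norm (y - K y) \<le> (1 + onorm K) * C) G"
    using bd
  proof eventually_elim
    case (elim y)
    have "norm (y - K y) \<le> norm y + onorm K * norm y"
      using norm_triangle_ineq4[of y "K y"] E.ops_bound[OF K', of y] by linarith
    also have "\<dots> = (1 + onorm K) * norm y" by (simp add: distrib_right)
    also have "\<dots> \<le> (1 + onorm K) * C"
      using elim E.onorm_nonneg[OF K'] by (intro mult_left_mono) auto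
    finally show ?case .
  qed
  have 1: "((\<lambda>y. P (y - K x) - P (y - K y)) \<longlongrightarrow> 0) G"
    by (rule hom_uniformly_continuous[OF P bound near])
  have 2: "((\<lambda>y. P (y + - K x) - P y) \<longlongrightarrow> P (x + - K x) - P x) G"
    by (rule difference_tendsto[OF n P bd weak'])
  have "((\<lambda>y. (P (y - K x) - P (y - K y)) - (P (y + - K x) - P y)) \<longlongrightarrow> 0 - (P (x + - K x) - P x)) G"
    by (rule tendsto_diff[OF 1 2])
  then show "((P - (\<lambda>x. P (x - K x))) \<longlongrightarrow> (P - (\<lambda>x. P (x - K x))) x) G" by (simp add: fun_diff_def)
qed

lemma compose_compact_wc:
  assumes P: "P \<in> hom n" and K: "K \<in> E.cops"
  shows "(\<lambda>x. P (K x)) \<in> wc n"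
proof (rule wcI)
  have K': "K \<in> E.ops" using K by (rule E.comp_ops)
  show "(\<lambda>x. P (K x)) \<in> hom n" by (rule hom_compose[OF P K'])
  fix G x C assume bd: "eventually (\<lambda>y. norm y \<le> C) G" and weak: "weakly_converges sE G x"
  have weak': "weakly_converges sE (filtermap (\<lambda>y. y) G) x" using weak by simp
  have "(K \<longlongrightarrow> K x) G" by (rule E.compact_weak_tendsto(2)[OF K bd weak'])
  then show "((\<lambda>x. P (K x)) \<longlongrightarrow> P (K x)) G" by (rule hom_tendsto[OF P])
qed

lemma poly_norm_tendsto_0:
  assumes h: "eventually (\<lambda>i. h i \<in> hom n) G"
    and sel: "\<And>x. (\<And>i. norm (x i) \<le> 1) \<Longrightarrow> ((\<lambda>i. h i (x i)) \<longlongrightarrow> 0) G"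
  shows "((\<lambda>i. poly_norm (h i)) \<longlongrightarrow> 0) G"
  unfolding tendsto_iff dist_norm
proof (intro allI impI)
  fix e :: real assume e: "e > 0"
  have "eventually (\<lambda>i. \<forall>x\<in>cball 0 1. norm (h i x) \<le> e / 2) G"
  proof (rule eventually_ball_of_selections)
    fix x :: "'c \<Rightarrow> 'a" assume "\<And>i. norm (x i) \<le> 1"
    then have "eventually (\<lambda>i. norm (h i (x i)) < e / 2) G"
      using e by (intro tendsto_zero_norm_less sel) auto
    then show "eventually (\<lambda>i. norm (h i (x i)) \<le> e / 2) G" by eventually_elim simp
  qed
  with h show "eventually (\<lambda>i. norm (poly_norm (h i) - 0) < e) G"
  proof eventually_elim
    case (elim i)
    have "poly_norm (h i) \<le> e / 2" using elim(2) by (intro poly_norm_le) auto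
    then show ?case using poly_norm_nonneg[OF elim(1)] e by simp
  qed
qed

text \<open>For every selection the residuals form a bounded weakly null family, and
  \<open>P\<close> vanishes at 0 because the degree is positive.\<close>

lemma residual_tendsto_0:
  assumes P: "P \<in> wc n" and n: "n \<ge> 1" and G: "E.approximating G"
  shows "((\<lambda>K. poly_norm (\<lambda>x. P (x - K x))) \<longlongrightarrow> 0) G"
proof (rule poly_norm_tendsto_0)
  show "eventually (\<lambda>K. (\<lambda>x. P (x - K x)) \<in> hom n) G"
    using E.approximatingD(2)[OF G]
    by eventually_elim (rule hom_compose[OF wc_hom[OF P] E.diff_id_ops[OF E.comp_ops]])
  fix x :: "('a \<Rightarrow> 'a) \<Rightarrow> 'a" assume "\<And>K. norm (x K) \<le> 1"
  from wc_tendsto[OF P E.residual_weakly_null[OF G this]]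
  show "((\<lambda>K. P (x K - K (x K))) \<longlongrightarrow> 0) G" by (simp add: hom_zero[OF wc_hom[OF P] n])
qed

text \<open>Up to a small error \<open>P\<close> is \<open>x \<mapsto> P x - P (x - K x)\<close> with \<open>K\<close> compact. As \<open>K a\<^sub>i\<close> and \<open>K b\<^sub>i\<close> have a
  common limit \<open>u\<close>, only \<open>x \<mapsto> P x - P (x - u)\<close> remains, which has smaller degree.\<close>

lemma wc_uniformly_continuous:
  fixes a b :: "'i \<Rightarrow> 'a"
  assumes n: "low n" and H: "E.approximating H" and P: "P \<in> wc m" and m: "m \<le> n"
    and a: "eventually (\<lambda>i. norm (a i) \<le> C) V" and b: "eventually (\<lambda>i. norm (b i) \<le> C) V"
    and weak: "weakly_converges sE (filtermap (\<lambda>i. a i - b i) V) 0"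
  shows "((\<lambda>i. P (a i) - P (b i)) \<longlongrightarrow> 0) V"
  using P m
proof (induction m arbitrary: P rule: less_induct)
  case (less m)
  have P: "P \<in> hom m" using wc_hom[OF less.prems(1)] .
  show ?case
  proof (cases "m = 0")
    case True
    then have "P x = P 0" for x using hom_degree_0 P by blast
    then have "P (a i) - P (b i) = 0" for i by (metis diff_self)
    then show ?thesis by simp
  next
    case False
    show ?thesis
    proof (rule tendsto_zero_if_ultrafilters)
      \<comment> \<open>Along an ultrafilter the vectors \<open>K (a i)\<close> converge even though
        \<open>a i\<close> itself may have no limit.\<close>
      fix U assume U: "ultrafilter U" "U \<le> V"
      have aU: "eventually (\<lambda>i. norm (a i) \<le> C) U" and bU: "eventually (\<lambda>i. norm (b i) \<le> C) U"
        using a b U(2) by (auto dest: filter_leD)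
      have weakU: "weakly_converges sE (filtermap (\<lambda>i. a i - b i) U) 0"
        using weak U(2) unfolding weakly_converges_filtermap by (blast intro: tendsto_mono)
      have abU: "eventually (\<lambda>i. norm (a i - b i) \<le> C + C) U"
        using aU bU by eventually_elim (rule norm_triangle_le_diff, rule add_mono)
      have null: "((\<lambda>i. K (a i - b i)) \<longlongrightarrow> 0) U" if "K \<in> E.cops" for K
        by (rule E.compact_weakly_null[OF that abU weakU])
      have main: "((\<lambda>i. (P (a i) - P (a i - K (a i))) - (P (b i) - P (b i - K (b i)))) \<longlongrightarrow> 0) U"
        if K: "K \<in> E.cops" for K
      proof -
        obtain u where u: "((\<lambda>i. K (a i)) \<longlongrightarrow> u) U"
          using E.compact_ultra_limit[OF U(1) K aU] .
        have "((\<lambda>i. K (a i) - K (a i - b i)) \<longlongrightarrow> u - 0) U"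
          by (intro tendsto_diff u null K)
        then have u': "((\<lambda>i. K (b i)) \<longlongrightarrow> u) U"
          by (simp add: E.ops_diff[OF E.comp_ops[OF K]])
        have near: "((\<lambda>i. P (c i - K (c i)) - P (c i - u)) \<longlongrightarrow> 0) U"
          if c: "eventually (\<lambda>i. norm (c i) \<le> C) U" and lim: "((\<lambda>i. K (c i)) \<longlongrightarrow> u) U" for c
        proof (rule hom_uniformly_continuous[OF P])
          show "eventually (\<lambda>i. norm (c i - u) \<le> C + norm u) U"
            using c by eventually_elim (rule norm_triangle_le_diff, simp)
          have "((\<lambda>i. u - K (c i)) \<longlongrightarrow> u - u) U" by (intro tendsto_diff tendsto_const lim)
          then show "((\<lambda>i. c i - K (c i) - (c i - u)) \<longlongrightarrow> 0) U" by simp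
        qed
        obtain R where R: "\<And>k y. k \<le> m \<Longrightarrow> (\<lambda>x. R k x y) \<in> hom k" "\<And>x y. R m x y = P x"
          "\<And>x y. P (x + y) = (\<Sum>k\<le>m. R k x y)" using hom_expansion[OF P] by blast
        have eq: "P (w + - u) - P w = (\<Sum>k<m. R k w (- u))" for w
          by (simp only: R(2,3) lessThan_Suc_atMost[symmetric] sum.lessThan_Suc) simp
        have "((\<lambda>i. R k (a i) (- u) - R k (b i) (- u)) \<longlongrightarrow> 0) U" if k: "k < m" for k
        proof -
          have Rk: "(\<lambda>x. R k x (- u)) \<in> hom k" using R(1) k by simp
          \<comment> \<open>Degree 0 lies outside the range of \<open>low\<close>, so the constant
            coefficient is checked directly.\<close>
          have "(\<lambda>x. R k x (- u)) \<in> wc k"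
          proof (cases "k = 0")
            case True
            have "R k y (- u) = R k x (- u)" for x y
              using hom_degree_0[of "\<lambda>x. R k x (- u)"] Rk True by metis
            then have const: "(\<lambda>x. R k x (- u)) = (\<lambda>x. R k 0 (- u))" by blast
            show ?thesis
            proof (rule wcI[OF Rk])
              fix G :: "'a filter" and x
              have "((\<lambda>x. R k 0 (- u)) \<longlongrightarrow> R k 0 (- u)) G" by (rule tendsto_const)
              then show "((\<lambda>x. R k x (- u)) \<longlongrightarrow> R k x (- u)) G"
                unfolding const fun_cong[OF const, of x] .
            qed
          next
            case False
            then show ?thesis using Rk k less.prems(2) by (intro lowD[OF n]) auto
          qed
          \<comment> \<open>As \<open>a i\<close> and \<open>b i\<close> need not converge weakly,
            weak continuity of the coefficient cannot be applied to each of them; its uniform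
            version in degree \<open>k < m\<close> is the induction hypothesis.\<close>
          then show ?thesis
            using less.IH[OF k, of "\<lambda>x. R k x (- u)"] k less.prems(2) U(2) by (auto intro: tendsto_mono)
        qed
        then have "((\<lambda>i. \<Sum>k<m. R k (a i) (- u) - R k (b i) (- u)) \<longlongrightarrow> (\<Sum>k<m. 0)) U"
          by (intro tendsto_sum) auto
        then have low_part: "((\<lambda>i. (P (a i + - u) - P (a i)) - (P (b i + - u) - P (b i))) \<longlongrightarrow> 0) U"
          unfolding eq sum_subtractf by simp
        have "((\<lambda>i. (P (b i - K (b i)) - P (b i - u)) - (P (a i - K (a i)) - P (a i - u)) -
            ((P (a i + - u) - P (a i)) - (P (b i + - u) - P (b i)))) \<longlongrightarrow> 0 - 0 - 0) U"
          by (intro tendsto_diff near low_part aU bU u u')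
        then show ?thesis by (simp add: algebra_simps)
      qed
      show "((\<lambda>i. P (a i) - P (b i)) \<longlongrightarrow> 0) U"
        unfolding tendsto_iff dist_norm
      proof (intro allI impI)
        fix e :: real assume e: "e > 0"
        then have e3: "e / 3 > 0" by simp
        obtain d where d: "d > 0"
          "\<And>P x. P \<in> hom m \<Longrightarrow> poly_norm P < d \<Longrightarrow> norm x \<le> C \<Longrightarrow> norm (P x) \<le> e / 3"
          using poly_norm_small[OF e3, of m C] by blast
        \<comment> \<open>For a weakly continuous \<open>P\<close> the part
          \<open>P o (Id - K)\<close> is uniformly small on the ball of radius \<open>C\<close> for
          some compact \<open>K\<close>; this \<open>K\<close> is now fixed.\<close>
        have "eventually (\<lambda>K. norm (poly_norm (\<lambda>x. P (x - K x))) < d) H"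
          using residual_tendsto_0[OF less.prems(1) _ H] False d(1) by (intro tendsto_zero_norm_less) auto
        with E.approximatingD(2)[OF H]
        have "eventually (\<lambda>K. K \<in> E.cops \<and> norm (poly_norm (\<lambda>x. P (x - K x))) < d) H"
          by (rule eventually_conj)
        then obtain K where K: "K \<in> E.cops" "norm (poly_norm (\<lambda>x. P (x - K x))) < d"
          using eventually_happens'[OF E.approximatingD(1)[OF H]] by blast
        have PK: "(\<lambda>x. P (x - K x)) \<in> hom m"
          by (rule hom_compose[OF P E.diff_id_ops[OF E.comp_ops[OF K(1)]]])
        have small: "norm (P (x - K x)) \<le> e / 3" if x: "norm x \<le> C" for x
          using d(2)[OF PK _ x] K(2) by simp
        have "eventually (\<lambda>i. norm ((P (a i) - P (a i - K (a i))) - (P (b i) - P (b i - K (b i)))) < e / 3) U"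
          by (rule tendsto_zero_norm_less[OF main[OF K(1)] e3])
        with aU bU show "eventually (\<lambda>i. norm (P (a i) - P (b i) - 0) < e) U"
        proof eventually_elim
          case (elim i)
          let ?w = "(P (a i) - P (a i - K (a i))) - (P (b i) - P (b i - K (b i)))"
          have "P (a i) - P (b i) - 0 = ?w - 0 - P (b i - K (b i)) + P (a i - K (a i))" by simp
          also have "norm \<dots> \<le> norm ?w + norm (0::'b) + norm (P (b i - K (b i))) + norm (P (a i - K (a i)))"
            by (rule norm_diff_diff_add_le)
          finally show ?case using small[OF elim(1)] small[OF elim(2)] elim(3) by simp
        qed
      qed
    qed
  qed
qed

text \<open>\<open>x K\<close> and \<open>K (x K)\<close> have a weakly null difference but in
  general no weak limit, so continuity at a point is not enough and the uniform version is
  used.\<close>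

lemma compose_tendsto:
  assumes n: "low n" and P: "P \<in> wc n" and G: "E.approximating G"
  shows "((\<lambda>K. poly_norm (P - (\<lambda>x. P (K x)))) \<longlongrightarrow> 0) G"
proof (rule poly_norm_tendsto_0)
  show "eventually (\<lambda>K. P - (\<lambda>x. P (K x)) \<in> hom n) G"
    using E.approximatingD(2)[OF G]
    by eventually_elim (rule hom_diff[OF wc_hom[OF P] hom_compose[OF wc_hom[OF P] E.comp_ops]])
  fix x :: "('a \<Rightarrow> 'a) \<Rightarrow> 'a" assume x: "\<And>K. norm (x K) \<le> 1"
  have "((\<lambda>K. P (x K) - P (K (x K))) \<longlongrightarrow> 0) G"
  proof (rule wc_uniformly_continuous[OF n G P order_refl])
    \<comment> \<open>One radius must serve both families; \<open>K (x K)\<close> differs from a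
      unit-ball vector by at most 3.\<close>
    show "eventually (\<lambda>K. norm (x K) \<le> 4) G"
      using order_trans[OF x one_le_numeral] by (intro always_eventually allI)
    show "eventually (\<lambda>K. norm (K (x K)) \<le> 4) G"
      using E.residual_weakly_null(1)[OF G, of x, OF x]
    proof eventually_elim
      case (elim K)
      then show ?case using x[of K] norm_triangle_ineq4[of "x K" "x K - K (x K)"] by simp
    qed
    show "weakly_converges sE (filtermap (\<lambda>K. x K - K (x K)) G) 0"
      by (rule E.residual_weakly_null(2)[OF G, of x, OF x])
  qed
  then show "((\<lambda>K. (P - (\<lambda>x. P (K x))) (x K)) \<longlongrightarrow> 0) G" by simp
qed

lemma wc_closed_subspace: "closed_subspace_of (fun_scale sF) (hom n) poly_norm (wc n)"
proof -
  interpret module "fun_scale sF :: 'k \<Rightarrow> ('a \<Rightarrow> 'b) \<Rightarrow> 'a \<Rightarrow> 'b" by (rule hom_module)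
  have tend: "(P \<longlongrightarrow> P x) G"
    if "P \<in> wc n" "eventually (\<lambda>y. norm y \<le> C) G" "weakly_converges sE G x" for P C G x
    using wc_tendsto[OF that(1), of "\<lambda>y. y" C G x] that(2,3) by simp
  have "subspace (wc n)"
  proof (rule subspaceI)
    show "0 \<in> wc n"
      by (rule wcI) (use subspace_0[OF hom_subspace] in \<open>auto simp: zero_fun_def\<close>)
    show "P + Q \<in> wc n" if P: "P \<in> wc n" and Q: "Q \<in> wc n" for P Q
    proof (rule wcI)
      show "P + Q \<in> hom n" by (intro hom_add wc_hom P Q)
      fix G x C assume "eventually (\<lambda>y. norm y \<le> C) G" "weakly_converges sE G x"
      then have "((\<lambda>y. P y + Q y) \<longlongrightarrow> P x + Q x) G" by (intro tendsto_add tend P Q)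
      then show "((P + Q) \<longlongrightarrow> (P + Q) x) G" by (simp add: plus_fun_def)
    qed
    show "fun_scale sF c P \<in> wc n" if P: "P \<in> wc n" for c P
    proof (rule wcI)
      show "fun_scale sF c P \<in> hom n" by (intro hom_fun_scale wc_hom P)
      fix G x C assume "eventually (\<lambda>y. norm y \<le> C) G" "weakly_converges sE G x"
      then have "((\<lambda>y. sF c (P y)) \<longlongrightarrow> sF c (P x)) G"
        by (intro bounded_linear.tendsto[OF F.bounded_linear_scale] tend P)
      then show "(fun_scale sF c P \<longlongrightarrow> fun_scale sF c P x) G" by (simp add: fun_scale_def)
    qed
  qed
  moreover have "P \<in> wc n" if P: "P \<in> hom n" and approx: "\<And>e. e > 0 \<Longrightarrow> \<exists>Q\<in>wc n. poly_norm (P - Q) < e" for P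
  proof (rule wcI[OF P])
    fix G x C assume bd: "eventually (\<lambda>y. norm y \<le> C) G" and weak: "weakly_converges sE G x"
    show "(P \<longlongrightarrow> P x) G"
      unfolding tendsto_iff dist_norm
    proof (intro allI impI)
      fix e :: real assume e: "e > 0"
      then have e3: "e / 3 > 0" by simp
      \<comment> \<open>The radius covers the limit point \<open>x\<close> as well as the points
        that approach it.\<close>
      obtain d where d: "d > 0"
        "\<And>P y. P \<in> hom n \<Longrightarrow> poly_norm P < d \<Longrightarrow> norm y \<le> max C (norm x) \<Longrightarrow> norm (P y) \<le> e / 3"
        using poly_norm_small[OF e3, of n "max C (norm x)"] by blast
      obtain Q where Q: "Q \<in> wc n" "poly_norm (P - Q) < d" using approx[OF d(1)] by blast
      have small: "norm (P y - Q y) \<le> e / 3" if "norm y \<le> max C (norm x)" for y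
        using d(2)[OF hom_diff[OF P wc_hom[OF Q(1)]] Q(2) that] by simp
      have "((\<lambda>y. Q y - Q x) \<longlongrightarrow> 0) G"
        using tend[OF Q(1) bd weak] by (simp add: LIM_zero_iff)
      then have "eventually (\<lambda>y. norm (Q y - Q x) < e / 3) G"
        using e by (intro tendsto_zero_norm_less) auto
      with bd show "eventually (\<lambda>y. norm (P y - P x) < e) G"
      proof eventually_elim
        case (elim y)
        have "norm ((P y - Q y) - 0 - (P x - Q x) + (Q y - Q x)) \<le> norm (P y - Q y) + norm (0::'b) + norm (P x - Q x) + norm (Q y - Q x)"
          by (rule norm_diff_diff_add_le)
        moreover have "norm (P y - Q y) \<le> e / 3" using elim by (intro small) auto
        ultimately show ?case using small[of x] elim by simp
      qed
    qed
  qed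
  ultimately show ?thesis
    unfolding closed_subspace_of_def using wc_hom by blast
qed

text \<open>The total error of the mixed estimate: \<open>(1 + 4 * d) ^ n\<close> bounds
  \<open>Q (x' + z)\<close>, the term \<open>d * (1 + d) ^ n\<close> is the part
  \<open>d *\<^sub>R P u\<close> that is split off, and \<open>3 * d\<close> covers the asymptotic
  additivity of \<open>Q\<close>, the margin in property (M) of \<open>F\<close>, and
  \<open>P (b x) - P u\<close>.\<close>

lemma small_parameter:
  fixes e :: real
  assumes "e > 0"
  obtains d :: real where "0 < d" "d < 1" "(1 + 4 * d) ^ n + d * (1 + d) ^ n + 3 * d \<le> 1 + e"
proof -
  let ?g = "\<lambda>d::real. (1 + 4 * d) ^ n + d * (1 + d) ^ n + 3 * d"
  have "(?g \<longlongrightarrow> (1 + 4 * 0) ^ n + 0 * (1 + 0) ^ n + 3 * 0) (at_right 0)"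
    by (intro tendsto_intros)
  then have "eventually (\<lambda>d. ?g d < 1 + e) (at_right 0)"
    using assms by (intro order_tendstoD(2)) auto
  moreover have "eventually (\<lambda>d::real. d \<in> {0<..<1}) (at_right 0)"
    by (rule eventually_at_right_real) simp
  ultimately have "eventually (\<lambda>d. ?g d < 1 + e \<and> d \<in> {0<..<1}) (at_right 0)"
    by (rule eventually_conj)
  then obtain d where "?g d < 1 + e \<and> d \<in> {0<..<1}"
    using eventually_happens'[OF trivial_limit_at_right_real] by blast
  then show ?thesis using that[of d] by simp
qed

section \<open>The mixed estimate\<close>

lemma compose_estimate:
  assumes P: "P \<in> hom n" "poly_norm P \<le> 1" and G: "E.approximating G" and d: "d > 0"
  shows "eventually (\<lambda>K. \<forall>x\<in>cball 0 1. norm (P (K x)) \<le> (1 + d) ^ n) G"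
  using E.approximatingD(2)[OF G] E.approximatingD(3)[OF G d]
proof eventually_elim
  case (elim K)
  show ?case
  proof
    fix x :: 'a assume x: "x \<in> cball 0 1"
    have "norm (K x) \<le> onorm K * norm x" by (rule E.ops_bound[OF E.comp_ops[OF elim(1)]])
    also have "\<dots> \<le> (1 + d) * 1" using elim x d by (intro mult_mono) auto
    finally have Kx: "norm (K x) \<le> 1 + d" by simp
    have "norm (P (K x)) \<le> poly_norm P * norm (K x) ^ n" by (rule poly_norm_bound[OF P(1)])
    also have "\<dots> \<le> 1 * (1 + d) ^ n"
      using P(2) Kx d by (intro mult_mono power_mono) auto
    finally show "norm (P (K x)) \<le> (1 + d) ^ n" by simp
  qed
qed

text \<open>Along an ultrafilter \<open>b x\<^sub>a \<rightarrow> u\<close> and \<open>z\<^sub>a = x\<^sub>a - a x\<^sub>a\<close> is weakly null. For \<open>x'\<close> of norm at most \<open>\<parallel>u\<parallel>\<close>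
  that almost norms \<open>Q\<close>, property (M) of \<open>F\<close> compares \<open>P u + Q z\<^sub>a\<close> with \<open>Q x' + Q z\<^sub>a\<close>, which is close to
  \<open>Q (x' + z\<^sub>a)\<close>, and property (M) of \<open>E\<close> compares \<open>x' + z\<^sub>a\<close> with \<open>u + z\<^sub>a\<close>, which is close to
  \<open>b x\<^sub>a + x\<^sub>a - a x\<^sub>a\<close>.\<close>

lemma mixed_estimate_normalized:
  assumes n: "low n" "n \<ge> 1"
    and ME: "M_ideal (fun_scale sE) E.ops onorm E.cops" and MF: "property_M sF"
    and scalar: "\<forall>f\<in>F.E.dual. \<forall>Q\<in>hom n. (\<lambda>x. f (Q x)) \<in> weakly_cont_polys sE (*) n"
    and U: "ultrafilter U" "E.approximating U"
    and P: "P \<in> hom n" "poly_norm P \<le> 1" and Q: "Q \<in> hom n" "poly_norm Q = 1" and e: "e > 0"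
  shows "eventually (\<lambda>b. eventually (\<lambda>a. \<forall>x\<in>cball 0 1. norm (P (b x) + Q (x - a x)) \<le> 1 + e) U) U"
proof -
  obtain d where d: "0 < d" "d < 1" "(1 + 4 * d) ^ n + d * (1 + d) ^ n + 3 * d \<le> 1 + e"
    using small_parameter[OF e] .
  \<comment> \<open>The supremum that defines \<open>poly_norm Q\<close> need not be attained, hence
    the defect \<open>d\<close>, which reappears as the factor \<open>1 - d\<close> on
    \<open>P u\<close>.\<close>
  have "\<exists>x\<in>cball 0 1. 1 - d < norm (Q x)"
    using less_cSUP_iff[OF _ hom_bdd_above[OF Q(1)], of "1 - d"] Q(2) d(1) unfolding poly_norm_def by simp
  then obtain x0 where x0: "norm x0 \<le> 1" "1 - d < norm (Q x0)" by auto
  show ?thesis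
    using E.approximatingD(2)[OF U(2)] E.approximatingD(3)[OF U(2) d(1)] compose_estimate[OF P U(2) d(1)]
  proof eventually_elim
    case (elim b)
    have b: "b \<in> E.cops" "b \<in> E.ops" using elim(1) E.comp_ops by auto
    show ?case
    proof (rule eventually_ball_of_selections)
      fix x :: "('a \<Rightarrow> 'a) \<Rightarrow> 'a" assume x: "\<And>a. norm (x a) \<le> 1"
      define z where "z a = x a - a (x a)" for a
      have z: "eventually (\<lambda>a. norm (z a) \<le> 3) U" "weakly_converges sE (filtermap z U) 0"
        using E.residual_weakly_null[OF U(2), of x] x unfolding z_def by auto
      obtain u where u: "((\<lambda>a. b (x a)) \<longlongrightarrow> u) U"
        using E.compact_ultra_limit[OF U(1) b(1), of x 1] x by auto
      have Pu: "((\<lambda>a. P (b (x a))) \<longlongrightarrow> P u) U" by (rule hom_tendsto[OF P(1) u])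
      have U_bot: "U \<noteq> bot" using U(1) by (simp add: ultrafilter_def)
      have Pu_le: "norm (P u) \<le> (1 + d) ^ n"
        using elim(3) x by (intro tendsto_upperbound[OF tendsto_norm[OF Pu] _ U_bot] always_eventually) auto
      have ub: "eventually (\<lambda>a. norm (u - b (x a)) < d) U"
        using tendsto_diff[OF tendsto_const u, of u] d(1) by (intro tendsto_zero_norm_less) auto
      \<comment> \<open>The clause on compact \<open>S\<close> is used with \<open>S = b\<close>.
        The three errors \<open>d\<close> come from \<open>onorm b \<le> 1 + d\<close>, from the
        clause itself, and from replacing \<open>b (x a)\<close> by its limit
        \<open>u\<close>.\<close>
      have uz: "eventually (\<lambda>a. norm (u + z a) \<le> 1 + 3 * d) U"
        using ub E.approximatingD(4)[OF U(2) b(1) d(1)]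
      proof eventually_elim
        case (elim a)
        have "norm (b (x a) + x a - a (x a)) \<le> (max 1 (onorm b) + d) * norm (x a)" using elim(2) by blast
        also have "\<dots> \<le> (1 + 2 * d) * 1"
          using \<open>onorm b \<le> 1 + d\<close> x[of a] d by (intro mult_mono) auto
        finally have "norm (b (x a) + x a - a (x a)) \<le> 1 + 2 * d" by simp
        moreover have "u + z a = (u - b (x a)) + (b (x a) + x a - a (x a))" by (simp add: z_def)
        ultimately show ?case
          using norm_triangle_ineq[of "u - b (x a)" "b (x a) + x a - a (x a)"] elim(1) by simp
      qed
      \<comment> \<open>Scaling \<open>x0\<close> by \<open>norm u\<close> keeps \<open>x'\<close>
        no longer than \<open>u\<close>, and by homogeneity \<open>Q x'\<close> has norm at least
        \<open>(1 - d) * norm u ^ n\<close>.\<close>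
      define x' where "x' = norm u *\<^sub>R x0"
      have x'_le: "norm x' \<le> norm u" using x0(1) by (simp add: x'_def mult_left_le)
      have x'z: "eventually (\<lambda>a. norm (x' + z a) \<le> (1 + 3 * d) + d) U"
        by (rule E.property_M_of_M_ideal[OF ME x'_le z uz d(1)])
      \<comment> \<open>Although \<open>Q\<close> need not be weakly continuous, it is
        asymptotically additive along weakly null families: its increments by a fixed vector are
        weakly continuous.\<close>
      have "((\<lambda>a. Q (z a + x') - Q (z a)) \<longlongrightarrow> Q (0 + x') - Q 0) U"
        by (rule difference_tendsto[OF n(1) Q(1) z])
      then have "((\<lambda>a. Q (z a + x') - Q (z a) - Q x') \<longlongrightarrow> 0) U"
        using hom_zero[OF Q(1) n(2)] by (simp add: LIM_zero)
      then have "eventually (\<lambda>a. norm (Q (z a + x') - Q (z a) - Q x') < d) U"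
        using d(1) by (rule tendsto_zero_norm_less)
      with x'z have Qx': "eventually (\<lambda>a. norm (Q x' + Q (z a)) \<le> (1 + 4 * d) ^ n + d) U"
      proof eventually_elim
        case (elim a)
        have "norm (Q (z a + x')) \<le> poly_norm Q * norm (z a + x') ^ n" by (rule poly_norm_bound[OF Q(1)])
        also have "\<dots> \<le> (1 + 4 * d) ^ n"
          using elim(1) Q(2) by (simp add: add.commute power_mono)
        finally have "norm (Q (z a + x')) \<le> (1 + 4 * d) ^ n" .
        moreover have "Q x' + Q (z a) = Q (z a + x') - (Q (z a + x') - Q (z a) - Q x')" by simp
        ultimately show ?case
          using norm_triangle_ineq4[of "Q (z a + x')" "Q (z a + x') - Q (z a) - Q x'"] elim(2) by simp
      qed
      have Qz: "eventually (\<lambda>a. norm (Q (z a)) \<le> 3 ^ n) U"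
        using z(1)
      proof eventually_elim
        case (elim a)
        then show ?case using poly_norm_bound[OF Q(1), of "z a"] Q(2) power_mono[OF elim, of n] by simp
      qed
      \<comment> \<open>\<open>Q (z a)\<close> need not tend to 0 in norm. Its weak convergence,
        which property (M) of \<open>F\<close> asks for, is where the scalar critical degree of
        \<open>E\<close> enters.\<close>
      have Qweak: "weakly_converges sF (filtermap (\<lambda>a. Q (z a)) U) 0"
        unfolding weakly_converges_filtermap
      proof
        fix f assume f: "f \<in> F.E.dual"
        have "Bfun (\<lambda>y. y) (filtermap z U)"
          by (rule BfunI[where K=3]) (simp add: eventually_filtermap z(1))
        then have "((\<lambda>y. norm (f (Q y) - f (Q 0))) \<longlongrightarrow> 0) (filtermap z U)"
          using scalar f Q(1) z(2) unfolding weakly_cont_polys_def by blast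
        then show "((\<lambda>a. f (Q (z a))) \<longlongrightarrow> f 0) U"
          by (simp add: filterlim_filtermap tendsto_norm_zero_iff LIM_zero_iff hom_zero[OF Q(1) n(2)])
      qed
      have "norm ((1 - d) *\<^sub>R P u) \<le> norm (Q x')"
      proof -
        have "norm (P u) \<le> 1 * norm u ^ n"
          by (rule order_trans[OF poly_norm_bound[OF P(1)] mult_right_mono[OF P(2)]]) simp
        then have "(1 - d) * norm (P u) \<le> norm (Q x0) * norm u ^ n"
          using d x0(2) by (intro mult_mono) auto
        then show ?thesis using d by (simp add: x'_def hom_scaleR[OF Q(1)] mult.commute)
      qed
      from property_M_family[OF MF this Qz Qweak Qx' d(1)]
      have "eventually (\<lambda>a. norm ((1 - d) *\<^sub>R P u + Q (z a)) \<le> (1 + 4 * d) ^ n + d + d) U" .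
      moreover have "eventually (\<lambda>a. norm (P (b (x a)) - P u) < d) U"
        using Pu d(1) by (intro tendsto_zero_norm_less) (simp_all add: LIM_zero)
      ultimately have "eventually (\<lambda>a. norm (P (b (x a)) + Q (z a)) \<le> 1 + e) U"
      proof eventually_elim
        case (elim a)
        have "P (b (x a)) + Q (z a) = (P (b (x a)) - P u) + (d *\<^sub>R P u + ((1 - d) *\<^sub>R P u + Q (z a)))"
          by (simp add: algebra_simps)
        also have "norm \<dots> \<le> norm (P (b (x a)) - P u) + (norm (d *\<^sub>R P u) + norm ((1 - d) *\<^sub>R P u + Q (z a)))"
          by (rule norm_triangle_mono[OF order_refl norm_triangle_ineq])
        also have "norm (d *\<^sub>R P u) \<le> d * (1 + d) ^ n" using Pu_le d(1) by simp
        finally show ?case using elim d(3) by linarith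
      qed
      then show "eventually (\<lambda>a. norm (P (b (x a)) + Q (x a - a (x a))) \<le> 1 + e) U"
        by (simp add: z_def)
    qed
  qed
qed

text \<open>Domination of \<open>P\<close> by \<open>Q\<close> needs \<open>Q\<close> of full norm.
  For \<open>Q = l Q'\<close> with \<open>Q'\<close> of norm 1, the sum is the convex combination
  with weights \<open>1 - l\<close> and \<open>l\<close> of \<open>P (b x)\<close> and
  \<open>P (b x) + Q' (x - a x)\<close>. The zero polynomial cannot be normalised and is treated
  apart.\<close>

lemma mixed_estimate:
  assumes n: "low n" "n \<ge> 1"
    and ME: "M_ideal (fun_scale sE) E.ops onorm E.cops" and MF: "property_M sF"
    and scalar: "\<forall>f\<in>F.E.dual. \<forall>Q\<in>hom n. (\<lambda>x. f (Q x)) \<in> weakly_cont_polys sE (*) n"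
    and U: "ultrafilter U" "E.approximating U"
    and P: "P \<in> hom n" "poly_norm P \<le> 1" and Q: "Q \<in> hom n" "poly_norm Q \<le> 1" and e: "e > 0"
  shows "eventually (\<lambda>b. eventually (\<lambda>a. \<forall>x\<in>cball 0 1. norm (P (b x) + Q (x - a x)) \<le> 1 + e) U) U"
proof -
  obtain d where d: "0 < d" "d < 1" "(1 + 4 * d) ^ n + d * (1 + d) ^ n + 3 * d \<le> 1 + e"
    using small_parameter[OF e] .
  have d_e: "(1 + d) ^ n \<le> 1 + e"
  proof -
    have "(1 + d) ^ n \<le> (1 + 4 * d) ^ n" using d by (intro power_mono) auto
    moreover have "0 \<le> d * (1 + d) ^ n" using d by simp
    ultimately show ?thesis using d by linarith
  qed
  show ?thesis
  proof (cases "poly_norm Q = 0")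
    case True
    then have Q0: "Q x = 0" for x using poly_norm_bound[OF Q(1), of x] by simp
    show ?thesis
      using compose_estimate[OF P U(2) d(1)]
    proof eventually_elim
      case (elim b)
      then have "\<forall>x\<in>cball 0 1. norm (P (b x) + Q (x - a x)) \<le> 1 + e" for a
        using d_e Q0 by force
      then show ?case by simp
    qed
  next
    case False
    define l where "l = poly_norm Q"
    have l: "0 < l" "l \<le> 1" using False poly_norm_nonneg[OF Q(1)] Q(2) by (auto simp: l_def)
    define Q' where "Q' = fun_scale sF (of_real (inverse l)) Q"
    have Q': "Q' \<in> hom n" unfolding Q'_def by (rule hom_fun_scale[OF Q(1)])
    have "poly_norm Q' = norm (of_real (inverse l) :: 'k) * poly_norm Q"
      unfolding Q'_def by (rule normed_carrier.N_scale[OF normed_carrier_hom Q(1)])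
    also have "\<dots> = 1" unfolding norm_of_real using l by (simp add: l_def)
    finally have Q'_norm: "poly_norm Q' = 1" .
    have Q_eq: "Q x = l *\<^sub>R Q' x" for x
      unfolding Q'_def fun_scale_def F.scale_of_real using l by simp
    show ?thesis
      using compose_estimate[OF P U(2) d(1)]
        mixed_estimate_normalized[OF n ME MF scalar U P Q' Q'_norm e]
    proof eventually_elim
      case (elim b)
      show ?case
        using elim(2)
      proof eventually_elim
        case (elim a)
        show ?case
        proof
          fix x :: 'a assume x: "x \<in> cball 0 1"
          have "P (b x) + Q (x - a x) = (1 - l) *\<^sub>R P (b x) + l *\<^sub>R (P (b x) + Q' (x - a x))"
            by (simp add: Q_eq algebra_simps)
          also have "norm \<dots> \<le> norm ((1 - l) *\<^sub>R P (b x)) + norm (l *\<^sub>R (P (b x) + Q' (x - a x)))"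
            by (rule norm_triangle_ineq)
          also have "\<dots> = (1 - l) * norm (P (b x)) + l * norm (P (b x) + Q' (x - a x))"
            using l by simp
          also have "\<dots> \<le> (1 - l) * (1 + e) + l * (1 + e)"
          proof (intro add_mono mult_left_mono)
            show "norm (P (b x)) \<le> 1 + e"
              using \<open>\<forall>x\<in>cball 0 1. norm (P (b x)) \<le> (1 + d) ^ n\<close> x d_e order_trans by blast
            show "norm (P (b x) + Q' (x - a x)) \<le> 1 + e" using elim x by blast
          qed (use l in auto)
          finally show "norm (P (b x) + Q (x - a x)) \<le> 1 + e" by (simp add: algebra_simps)
        qed
      qed
    qed
  qed
qed

lemma hom_functional:
  assumes f: "f \<in> F.E.dual" and P: "P \<in> hom n"
  shows "(\<lambda>x. f (P x)) \<in> hom_polys sE (*) n"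
proof -
  obtain A where A: "multilinear sE sF n A" "\<And>x. P x = A (\<lambda>i. x)" using hom_multilinear[OF P] by blast
  have "vector_space ((*) :: 'k \<Rightarrow> 'k \<Rightarrow> 'k)" by unfold_locales (auto simp: algebra_simps)
  then have "multilinear sE (*) n (\<lambda>x. f (A x))"
    unfolding multilinear_def Vector_Spaces.linear_iff
  proof (intro conjI allI impI)
    show "f (A x) = f (A y)" if "\<forall>i<n. x i = y i" for x y
      using multilinearD(1)[OF A(1), of x y] that by simp
  qed (simp_all only: E.vector_space_axioms multilinearD(2,3)[OF A(1)]
      F.E.dual_add[OF f UNIV_I UNIV_I] F.E.dual_scale[OF f UNIV_I])
  moreover have "continuous_on UNIV (\<lambda>x. f (P x))"
    by (rule bounded_linear.continuous_on[OF F.bounded_linear_dual[OF f] hom_continuous[OF P]])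
  ultimately show ?thesis unfolding hom_polys_def using A(2) by auto
qed

text \<open>A single ultrafilter below an approximating filter indexes both families of the
  criterion, \<open>P o K\<close> and \<open>P o (Id - K)\<close>; it is run through twice
  independently only in the mixed estimate.\<close>

theorem wc_M_ideal:
  assumes n: "low n" "n \<ge> 1"
    and ME: "M_ideal (fun_scale sE) E.ops onorm E.cops" and MF: "property_M sF"
    and scalar: "hom_polys sE (*) n \<subseteq> weakly_cont_polys sE ((*) :: 'k \<Rightarrow> 'k \<Rightarrow> 'k) n"
  shows "M_ideal (fun_scale sF) (hom n) poly_norm (wc n)"
proof -
  interpret H: normed_carrier "fun_scale sF" "hom n" poly_norm by (rule normed_carrier_hom)
  obtain G where "E.approximating G" using E.approximating_exists[OF ME] by blast
  moreover from this obtain U where U: "ultrafilter U" "U \<le> G"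
    using ultrafilter_exists[OF E.approximatingD(1)] by blast
  ultimately have appr: "E.approximating U"
    by (intro E.approximating_mono[of G U]) (auto simp: ultrafilter_def)
  show ?thesis
  proof (rule H.M_ideal_criterion[OF wc_closed_subspace U(1),
        where A="\<lambda>K P x. P (K x)" and B="\<lambda>K P x. P (x - K x)"])
    show "eventually (\<lambda>K. \<forall>P\<in>hom n. (\<lambda>x. P (K x)) \<in> wc n \<and> (\<lambda>x. P (x - K x)) \<in> hom n \<and>
        P - (\<lambda>x. P (x - K x)) \<in> wc n) U"
      using E.approximatingD(2)[OF appr]
    proof eventually_elim
      case (elim K)
      show ?case
      proof (intro ballI conjI)
        fix P assume P: "P \<in> hom n"
        show "(\<lambda>x. P (K x)) \<in> wc n" by (rule compose_compact_wc[OF P elim])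
        show "(\<lambda>x. P (x - K x)) \<in> hom n" by (rule hom_compose[OF P E.diff_id_ops[OF E.comp_ops[OF elim]]])
        show "P - (\<lambda>x. P (x - K x)) \<in> wc n" by (rule difference_compact_wc[OF n(1) P elim])
      qed
    qed
    show "((\<lambda>K. poly_norm (P - (\<lambda>x. P (K x)))) \<longlongrightarrow> 0) U" if "P \<in> wc n" for P
      by (rule compose_tendsto[OF n(1) that appr])
    show "((\<lambda>K. poly_norm (\<lambda>x. P (x - K x))) \<longlongrightarrow> 0) U" if "P \<in> wc n" for P
      by (rule residual_tendsto_0[OF that n(2) appr])
    fix P Q e assume PQ: "P \<in> hom n" "Q \<in> hom n" "poly_norm P \<le> 1" "poly_norm Q \<le> 1" "(e::real) > 0"
    have "\<forall>f\<in>F.E.dual. \<forall>Q\<in>hom n. (\<lambda>x. f (Q x)) \<in> weakly_cont_polys sE (*) n"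
      using scalar hom_functional by blast
    from mixed_estimate[OF n ME MF this U(1) appr PQ(1,3,2,4,5)]
    show "eventually (\<lambda>b. eventually (\<lambda>a. poly_norm ((\<lambda>x. P (b x)) + (\<lambda>x. Q (x - a x))) \<le> 1 + e) U) U"
    proof eventually_elim
      case (elim b)
      then show ?case by eventually_elim (auto intro!: poly_norm_le)
    qed
  qed (auto simp: fun_scale_def fun_eq_iff)
qed

end

theorem corollary4p9:
  fixes sE :: "'k::real_or_complex \<Rightarrow> 'a::banach \<Rightarrow> 'a"
    and sF :: "'k \<Rightarrow> 'b::banach \<Rightarrow> 'b"
    and n :: nat
  assumes "banach_over sE" and "banach_over sF"
    and "enat n = critical_degree sE sF"
    and "critical_degree sE sF < scalar_critical_degree sE"
    and "M_ideal (fun_scale sE) (bounded_operators sE) onorm (compact_operators sE)"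
    and "property_M sF"
  shows "M_ideal (fun_scale sF) (hom_polys sE sF n) poly_norm (weakly_cont_polys sE sF n)"
proof -
  interpret polynomial_spaces sE sF
    using assms(1,2) by (simp add: polynomial_spaces_def)
  have "1 \<le> enat n" unfolding assms(3) by (rule critical_degree_ge_1)
  then have n: "1 \<le> n" by (simp add: one_enat_def)
  have "hom k \<subseteq> wc k" if "1 \<le> k" "k < n" for k
    using below_critical_degree[OF that(1), of sE sF] that(2) assms(3)[symmetric] by simp
  then have "low n" by (simp add: low_def)
  \<comment> \<open>Strict inequality puts degree \<open>n\<close> itself below the scalar critical
    degree, so that also scalar polynomials of this top degree are weakly continuous.\<close>
  moreover have "enat n < critical_degree sE ((*) :: 'k \<Rightarrow> 'k \<Rightarrow> 'k)"
    using assms(4) unfolding scalar_critical_degree_def assms(3) .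
  then have "hom_polys sE (*) n \<subseteq> weakly_cont_polys sE ((*) :: 'k \<Rightarrow> 'k \<Rightarrow> 'k) n"
    using below_critical_degree[OF n] by blast
  ultimately show ?thesis using wc_M_ideal n assms(5,6) by blast
qed

end
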